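(* Let $\mathbb{F}$ be a field with no quadratic extensions. A complete set of representatives of the conjugacy classes in $\mathrm{AGL}_4(\mathbb{F})$ of the abelian regular subgroups of $\mathrm{AGL}_4(\mathbb{F})$ (each abelian regular subgroup is conjugate to exactly one member of the list) is given by the following subgroups, where $x_1,x_2,x_3,x_4$ range over $\mathbb{F}$. Indecomposable ones: (1) $S_{(5)}=\left\{\begin{pmatrix}1&x_1&x_2&x_3&x_4\\0&1&x_1&x_2&x_3\\0&0&1&x_1&x_2\\0&0&0&1&x_1\\0&0&0&0&1\end{pmatrix}\right\}$; (2) $S^{\sharp}_{(3,2)}=\left\{\begin{pmatrix}1&x_1&x_2&x_3&x_4\\0&1&x_1&0&x_2\\0&0&1&0&x_1\\0&0&0&1&x_3\\0&0&0&0&1\end{pmatrix}\right\}$; (3) $U_1^4=\left\{\begin{pmatrix}1&x_1&x_2&x_3&x_4\\0&1&x_1&0&x_3\\0&0&1&0&0\\0&0&0&1&x_1\\0&0&0&0&1\end{pmatrix}\right\}$; (4) $U_2^4=\left\{\begin{pmatrix}1&x_1&x_2&x_3&x_4\\0&1&0&0&x_1\\0&0&1&0&x_3\\0&0&0&1&x_2\\0&0&0&0&1\end{pmatrix}\right\}$. Decomposable ones: (5) $S_{(4,1)}=\left\{\begin{pmatrix}1&x_1&x_2&x_3&x_4\\0&1&x_1&x_2&0\\0&0&1&x_1&0\\0&0&0&1&0\\0&0&0&0&1\end{pmatrix}\right\}$; (6) $S_{(3,2)}=\left\{\begin{pmatrix}1&x_1&x_2&x_3&x_4\\0&1&x_1&0&0\\0&0&1&0&0\\0&0&0&1&x_3\\0&0&0&0&1\end{pmatrix}\right\}$;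 (7) $S_{(3,1,1)}=\left\{\begin{pmatrix}1&x_1&x_2&x_3&x_4\\0&1&x_1&0&0\\0&0&1&0&0\\0&0&0&1&0\\0&0&0&0&1\end{pmatrix}\right\}$; (8) $S^{\sharp}_{(2,2,1)}=\left\{\begin{pmatrix}1&x_1&x_2&x_3&x_4\\0&1&0&x_1&0\\0&0&1&x_2&0\\0&0&0&1&0\\0&0&0&0&1\end{pmatrix}\right\}$; (9) only when $\mathrm{char}\,\mathbb{F}=2$: $\left\{\begin{pmatrix}1&x_1&x_2&x_3&x_4\\0&1&0&x_2&0\\0&0&1&x_1&0\\0&0&0&1&0\\0&0&0&0&1\end{pmatrix}\right\}$; (10) $S_{(2,1^3)}=\left\{\begin{pmatrix}1&x_1&x_2&x_3&x_4\\0&1&0&0&0\\0&0&1&0&0\\0&0&0&1&0\\0&0&0&0&1\end{pmatrix}\right\}$. The corresponding algebras $\mathbb{F}I_5+U$ are isomorphic respectively to the quotients of polynomial rings: (1) $\mathbb{F}[t_1]/\langle t_1^5\rangle$; (2) $\mathbb{F}[t_1,t_2]/\langle t_1^3-t_2^2,\,t_1t_2\rangle$; (3) $\mathbb{F}[t_1,t_2]/\langle t_1^3,\,t_1^2t_2,\,t_2^2\rangle$; (4) $\mathbb{F}[t_1,t_2,t_3]/\langle t_1^2-t_2t_3,\,t_2^2,\,t_3^2,\,t_1t_2,\,t_1t_3\rangle$; (5) $\mathbb{F}[t_1,t_2]/\langle t_1^4,\,t_2^2,\,t_1t_2\rangle$; (6) $\mathbb{F}[t_1,t_2]/\langle t_1^3,\,t_2^3,\,t_1t_2\rangle$;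 (7) $\mathbb{F}[t_1,t_2,t_3]/\langle t_1^3,\,t_2^2,\,t_3^2,\,t_1t_2,\,t_1t_3,\,t_2t_3\rangle$; (8) $\mathbb{F}[t_1,t_2,t_3]/\langle t_1^2-t_2^2,\,t_3^2,\,t_1t_2,\,t_1t_3,\,t_2t_3\rangle$; (9) $\mathbb{F}[t_1,t_2,t_3]/\langle t_1^2,\,t_2^2,\,t_3^2,\,t_1t_3,\,t_2t_3\rangle$; (10) $\mathbb{F}[t_1,t_2,t_3,t_4]/\langle t_1,t_2,t_3,t_4\rangle^2$.
   Context: "No quadratic extensions" means that $\mathbb{F}$ has no field extension of degree $2$. $\mathrm{AGL}_n(\mathbb{F})$ is the subgroup of $\mathrm{GL}_{n+1}(\mathbb{F})$ consisting of the matrices with first column $(1,0,\dots,0)^{\mathrm T}$; $\pi:\mathrm{AGL}_n(\mathbb{F})\to\mathrm{GL}_n(\mathbb{F})$ sends $\begin{pmatrix}1&v\\0&A\end{pmatrix}$ to $A$. A subgroup $R\le\mathrm{AGL}_n(\mathbb{F})$ is regular if for every $v\in\mathbb{F}^n$ there is exactly one element of $R$ with first row $(1,v)$. A subgroup $H\le\mathrm{AGL}_n(\mathbb{F})$ is indecomposable if $\mathbb{F}^n$ is not a direct sum of non-trivial $\pi(H)$-invariant subspaces (acting on row vectors from the right), and decomposable otherwise. $\mathbb{F}I_{n+1}+U=\{\alpha I_{n+1}+\beta u:\alpha,\beta\in\mathbb{F},\ u\in U\}$. *)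

theory Defs
  imports
    "Jordan_Normal_Form.VS_Connect"
    "HOL-Algebra.Embedded_Algebras"
    "HOL-Algebra.QuotRing"
    "HOL-Algebra.Ideal_Product"
    "HOL-Library.Poly_Mapping"
begin

text \<open>
  A field extension of degree 2 of \<open>'a\<close> is a field \<open>L\<close> with an embedding \<open>h\<close> of \<open>'a\<close> such that
  \<open>L\<close> has dimension 2 over the image of \<open>h\<close>.  A field of dimension 2 over \<open>'a\<close> is in bijection with
  \<open>'a \<times> 'a\<close>, so up to isomorphism every such extension has its elements in that type.
\<close>

definition no_quadratic_extensions :: "'a::field itself \<Rightarrow> bool" where
  "no_quadratic_extensions _ \<longleftrightarrow>
     \<not> (\<exists>(L :: ('a \<times> 'a) ring) h.
           field L \<and> h \<in> Ring.ring_hom (class_ring :: 'a ring) L \<and>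
           ring.dimension L 2 (range h) (carrier L))"


section \<open>Affine groups\<close>

definition GL :: "'a::field itself \<Rightarrow> nat \<Rightarrow> 'a mat monoid" where
  "GL _ n = units_of (ring_mat TYPE('a) n ())"

definition AGL :: "'a::field itself \<Rightarrow> nat \<Rightarrow> 'a mat monoid" where
  "AGL _ n = (GL TYPE('a) (n + 1))
     \<lparr>carrier := {M \<in> carrier (GL TYPE('a) (n + 1)). col M 0 = unit_vec (n + 1) 0}\<rparr>"

definition linear_part :: "'a mat \<Rightarrow> 'a mat" where
  "linear_part M = mat_delete M 0 0"

definition conjugate_in :: "('g, 'm) monoid_scheme \<Rightarrow> 'g set \<Rightarrow> 'g set \<Rightarrow> bool" where
  "conjugate_in G H K \<longleftrightarrow> (\<exists>g\<in>carrier G. K = g <#\<^bsub>G\<^esub> H #>\<^bsub>G\<^esub> inv\<^bsub>G\<^esub> g)"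

definition regular_subgroup :: "nat \<Rightarrow> 'a::field mat set \<Rightarrow> bool" where
  "regular_subgroup n R \<longleftrightarrow> subgroup R (AGL TYPE('a) n) \<and>
     (\<forall>v\<in>carrier_vec n. \<exists>!M. M \<in> R \<and> row M 0 = vCons 1 v)"

definition abelian_regular_subgroup :: "nat \<Rightarrow> 'a::field mat set \<Rightarrow> bool" where
  "abelian_regular_subgroup n R \<longleftrightarrow> regular_subgroup n R \<and>
     comm_group ((AGL TYPE('a) n)\<lparr>carrier := R\<rparr>)"

definition row_vec_mult :: "'a::semiring_0 vec \<Rightarrow> 'a mat \<Rightarrow> 'a vec" where
  "row_vec_mult v A = vec (dim_col A) (\<lambda>j. v \<bullet> col A j)"

definition invariant_subspace :: "nat \<Rightarrow> 'a::field mat set \<Rightarrow> 'a vec set \<Rightarrow> bool" where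
  "invariant_subspace n H W \<longleftrightarrow>
     VectorSpace.subspace class_ring W (module_vec TYPE('a) n) \<and>
     (\<forall>M\<in>H. \<forall>w\<in>W. row_vec_mult w (linear_part M) \<in> W)"

text \<open>
  Two summands suffice: in a direct sum of several non-zero invariant subspaces, all
  but the first can be added up.
\<close>

definition decomposable :: "nat \<Rightarrow> 'a::field mat set \<Rightarrow> bool" where
  "decomposable n H \<longleftrightarrow>
     (\<exists>V W. invariant_subspace n H V \<and> V \<noteq> {0\<^sub>v n} \<and>
            invariant_subspace n H W \<and> W \<noteq> {0\<^sub>v n} \<and>
            V \<inter> W = {0\<^sub>v n} \<and> {v + w | v w. v \<in> V \<and> w \<in> W} = carrier_vec n)"

abbreviation indecomposable :: "nat \<Rightarrow> 'a::field mat set \<Rightarrow> bool" where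
  "indecomposable n H \<equiv> \<not> decomposable n H"


section \<open>Algebras\<close>

text \<open>
  A (unital) algebra over the field \<open>'a\<close> is given by a ring together with its structure map
  \<open>c \<mapsto> c \<cdot> 1\<close>; algebra isomorphisms are the ring isomorphisms compatible with the structure maps.
\<close>

definition algebra_isomorphic ::
    "('r, 'm) ring_scheme \<Rightarrow> ('a \<Rightarrow> 'r) \<Rightarrow> ('s, 'n) ring_scheme \<Rightarrow> ('a \<Rightarrow> 's) \<Rightarrow> bool" where
  "algebra_isomorphic A f B g \<longleftrightarrow> (\<exists>h\<in>ring_iso A B. \<forall>c. h (f c) = g c)"

definition span_algebra :: "nat \<Rightarrow> 'a::field mat set \<Rightarrow> 'a mat ring" where
  "span_algebra n U = (ring_mat TYPE('a) (n + 1) ())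
     \<lparr>carrier := {\<alpha> \<cdot>\<^sub>m 1\<^sub>m (n + 1) + \<beta> \<cdot>\<^sub>m u | \<alpha> \<beta> u. u \<in> U}\<rparr>"

definition scalar_mat :: "nat \<Rightarrow> 'a::field \<Rightarrow> 'a mat" where
  "scalar_mat n c = c \<cdot>\<^sub>m 1\<^sub>m (n + 1)"

text \<open>
  A monomial is a finitely supported exponent function, a polynomial a finitely supported
  function from monomials to coefficients.  The polynomial ring in \<open>t\<^sub>1, \<dots>, t\<^sub>k\<close> consists of
  the polynomials whose monomials involve only the indices \<open>1, \<dots>, k\<close>.
\<close>

type_synonym 'a mpoly = "(nat \<Rightarrow>\<^sub>0 nat) \<Rightarrow>\<^sub>0 'a"

definition poly_ring :: "nat \<Rightarrow> 'a::field mpoly ring" where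
  "poly_ring k = class_ring \<lparr>carrier := {p. \<forall>m\<in>Poly_Mapping.keys p. Poly_Mapping.keys m \<subseteq> {1..k}}\<rparr>"

definition tvar :: "nat \<Rightarrow> 'a::field mpoly" where
  "tvar i = Poly_Mapping.single (Poly_Mapping.single i 1) 1"

definition scalar_poly :: "'a::field \<Rightarrow> 'a mpoly" where
  "scalar_poly c = Poly_Mapping.single 0 c"

definition scalar_coset :: "nat \<Rightarrow> 'a::field mpoly set \<Rightarrow> 'a \<Rightarrow> 'a mpoly set" where
  "scalar_coset k I c = I +>\<^bsub>poly_ring k\<^esub> scalar_poly c"


section \<open>The list of subgroups\<close>

datatype label =
    S5 | S32_sharp | U1_4 | U2_4
  | S41 | S32 | S311 | S221_sharp | Char_two | S2111

primrec rep_mat :: "label \<Rightarrow> 'a::field \<Rightarrow> 'a \<Rightarrow> 'a \<Rightarrow> 'a \<Rightarrow> 'a mat" where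
  "rep_mat S5 x1 x2 x3 x4 = mat_of_rows_list 5
     [[1, x1, x2, x3, x4],
      [0,  1, x1, x2, x3],
      [0,  0,  1, x1, x2],
      [0,  0,  0,  1, x1],
      [0,  0,  0,  0,  1]]"
| "rep_mat S32_sharp x1 x2 x3 x4 = mat_of_rows_list 5
     [[1, x1, x2, x3, x4],
      [0,  1, x1,  0, x2],
      [0,  0,  1,  0, x1],
      [0,  0,  0,  1, x3],
      [0,  0,  0,  0,  1]]"
| "rep_mat U1_4 x1 x2 x3 x4 = mat_of_rows_list 5
     [[1, x1, x2, x3, x4],
      [0,  1, x1,  0, x3],
      [0,  0,  1,  0,  0],
      [0,  0,  0,  1, x1],
      [0,  0,  0,  0,  1]]"
| "rep_mat U2_4 x1 x2 x3 x4 = mat_of_rows_list 5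
     [[1, x1, x2, x3, x4],
      [0,  1,  0,  0, x1],
      [0,  0,  1,  0, x3],
      [0,  0,  0,  1, x2],
      [0,  0,  0,  0,  1]]"
| "rep_mat S41 x1 x2 x3 x4 = mat_of_rows_list 5
     [[1, x1, x2, x3, x4],
      [0,  1, x1, x2,  0],
      [0,  0,  1, x1,  0],
      [0,  0,  0,  1,  0],
      [0,  0,  0,  0,  1]]"
| "rep_mat S32 x1 x2 x3 x4 = mat_of_rows_list 5
     [[1, x1, x2, x3, x4],
      [0,  1, x1,  0,  0],
      [0,  0,  1,  0,  0],
      [0,  0,  0,  1, x3],
      [0,  0,  0,  0,  1]]"
| "rep_mat S311 x1 x2 x3 x4 = mat_of_rows_list 5
     [[1, x1, x2, x3, x4],
      [0,  1, x1,  0,  0],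
      [0,  0,  1,  0,  0],
      [0,  0,  0,  1,  0],
      [0,  0,  0,  0,  1]]"
| "rep_mat S221_sharp x1 x2 x3 x4 = mat_of_rows_list 5
     [[1, x1, x2, x3, x4],
      [0,  1,  0, x1,  0],
      [0,  0,  1, x2,  0],
      [0,  0,  0,  1,  0],
      [0,  0,  0,  0,  1]]"
| "rep_mat Char_two x1 x2 x3 x4 = mat_of_rows_list 5
     [[1, x1, x2, x3, x4],
      [0,  1,  0, x2,  0],
      [0,  0,  1, x1,  0],
      [0,  0,  0,  1,  0],
      [0,  0,  0,  0,  1]]"
| "rep_mat S2111 x1 x2 x3 x4 = mat_of_rows_list 5
     [[1, x1, x2, x3, x4],
      [0,  1,  0,  0,  0],
      [0,  0,  1,  0,  0],
      [0,  0,  0,  1,  0],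
      [0,  0,  0,  0,  1]]"

definition rep :: "label \<Rightarrow> 'a::field mat set" where
  "rep l = {rep_mat l x1 x2 x3 x4 | x1 x2 x3 x4. True}"

definition indecomposable_labels :: "label set" where
  "indecomposable_labels = {S5, S32_sharp, U1_4, U2_4}"

definition decomposable_labels :: "'a::field itself \<Rightarrow> label set" where
  "decomposable_labels _ =
     {S41, S32, S311, S221_sharp, S2111} \<union> (if CHAR('a) = 2 then {Char_two} else {})"

definition labels :: "'a::field itself \<Rightarrow> label set" where
  "labels _ = indecomposable_labels \<union> decomposable_labels TYPE('a)"

primrec nvars :: "label \<Rightarrow> nat" where
  "nvars S5 = 1"
| "nvars S32_sharp = 2"
| "nvars U1_4 = 2"
| "nvars U2_4 = 3"
| "nvars S41 = 2"
| "nvars S32 = 2"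
| "nvars S311 = 3"
| "nvars S221_sharp = 3"
| "nvars Char_two = 3"
| "nvars S2111 = 4"

primrec rel_ideal :: "label \<Rightarrow> 'a::field mpoly set" where
  "rel_ideal S5 = Idl\<^bsub>poly_ring 1\<^esub> {tvar 1 ^ 5}"
| "rel_ideal S32_sharp = Idl\<^bsub>poly_ring 2\<^esub> {tvar 1 ^ 3 - tvar 2 ^ 2, tvar 1 * tvar 2}"
| "rel_ideal U1_4 = Idl\<^bsub>poly_ring 2\<^esub> {tvar 1 ^ 3, tvar 1 ^ 2 * tvar 2, tvar 2 ^ 2}"
| "rel_ideal U2_4 = Idl\<^bsub>poly_ring 3\<^esub> {tvar 1 ^ 2 - tvar 2 * tvar 3, tvar 2 ^ 2, tvar 3 ^ 2, tvar 1 * tvar 2, tvar 1 * tvar 3}"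
| "rel_ideal S41 = Idl\<^bsub>poly_ring 2\<^esub> {tvar 1 ^ 4, tvar 2 ^ 2, tvar 1 * tvar 2}"
| "rel_ideal S32 = Idl\<^bsub>poly_ring 2\<^esub> {tvar 1 ^ 3, tvar 2 ^ 3, tvar 1 * tvar 2}"
| "rel_ideal S311 =
     Idl\<^bsub>poly_ring 3\<^esub> {tvar 1 ^ 3, tvar 2 ^ 2, tvar 3 ^ 2, tvar 1 * tvar 2, tvar 1 * tvar 3, tvar 2 * tvar 3}"
| "rel_ideal S221_sharp =
     Idl\<^bsub>poly_ring 3\<^esub> {tvar 1 ^ 2 - tvar 2 ^ 2, tvar 3 ^ 2, tvar 1 * tvar 2, tvar 1 * tvar 3, tvar 2 * tvar 3}"
| "rel_ideal Char_two = Idl\<^bsub>poly_ring 3\<^esub> {tvar 1 ^ 2, tvar 2 ^ 2, tvar 3 ^ 2, tvar 1 * tvar 3, tvar 2 * tvar 3}"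
| "rel_ideal S2111 =
     ideal_prod (poly_ring 4) (Idl\<^bsub>poly_ring 4\<^esub> {tvar 1, tvar 2, tvar 3, tvar 4})
                              (Idl\<^bsub>poly_ring 4\<^esub> {tvar 1, tvar 2, tvar 3, tvar 4})"

end

(* An abelian regular subgroup of AGL_n is {1 + S(x)}, where x is the first row of S(x); commutativity
   makes S linear and turns x * y = x S(y) into a commutative associative product on F^n for which
   no x * y = x with x nonzero, and conjugation in AGL_n is isomorphism of these algebras.
   In dimension 4, if some cube x^3 is nonzero, the powers of x together with at most one further
   vector form a basis with the required table.  Otherwise all triple products vanish: if all
   products lie on a line, the algebra is a symmetric bilinear form (square roots normalise it, and
   alternating forms occur only in characteristic 2); if not, two generators satisfy a quadratic
   relation, which splits into linear factors. *)
theory Submission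
  imports Defs "HOL-Library.Product_Plus"
begin

section \<open>Square roots and quadratic equations\<close>

text \<open>Nilpotency is not given: invertibility of the matrices only says that x * y = x forces x
  = 0. Coefficients are therefore eliminated by the remark that multiplication operators have no
  nonzero eigenvalue. The absence of quadratic extensions enters only in the form that every monic
  quadratic polynomial has a root, which covers square roots in every characteristic. Distinctness
  is settled by seven properties phrased with products, zero and equality alone, so that a bijection
  preserving these suffices and no linearity has to be carried along. The presentations pass through
  the algebra with a unit adjoined: on one side it is the matrix algebra, seen by its action on row
  vectors; on the other it is the image of polynomial evaluation, whose kernel is found by reducing
  every polynomial to a combination of 1 and four basis monomials.\<close>

lemma quadratic_root:
  assumes "no_quadratic_extensions TYPE('a::field)"
  shows "\<exists>k :: 'a. k * k = b * k + c"
proof (rule ccontr)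
  assume no_root: "\<not> (\<exists>k. k * k = b * k + c)"
  \<comment> \<open>This is the quotient of the polynomial ring by t^2 - b t - c, the pair (p, q)
    standing for p + q t. Without a root it is a quadratic extension, against the
    assumption.\<close>
  define L :: "('a \<times> 'a) ring" where
    "L = \<lparr>carrier = UNIV, mult = \<lambda>(p, q) (r, s). (p * r + q * s * c, p * s + q * r + q * s * b),
      one = (1, 0), zero = (0, 0), add = \<lambda>(p, q) (r, s). (p + r, q + s)\<rparr>"
  define h :: "'a \<Rightarrow> 'a \<times> 'a" where "h = (\<lambda>a. (a, 0))"
  have L: "carrier L = UNIV" "(p, q) \<otimes>\<^bsub>L\<^esub> (r, s) = (p * r + q * s * c, p * s + q * r + q * s * b)"
    "\<one>\<^bsub>L\<^esub> = (1, 0)" "\<zero>\<^bsub>L\<^esub> = (0, 0)" "(p, q) \<oplus>\<^bsub>L\<^esub> (r, s) = (p + r, q + s)" for p q r s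
    by (simp_all add: L_def)
  \<comment> \<open>The norm of p + q t. If it vanished with q nonzero, - p / q would be a root; if
    q = 0, it is p^2.\<close>
  have norm: "p * p + b * p * q - c * q * q \<noteq> 0" if "(p, q) \<noteq> (0, 0)" for p q
  proof
    assume eq: "p * p + b * p * q - c * q * q = 0"
    show False
    proof (cases "q = 0")
      case True
      then show False using eq that by simp
    next
      case False
      have "(- (p / q)) * (- (p / q)) - (b * (- (p / q)) + c) = (p * p + b * p * q - c * q * q) / (q * q)"
        using False by (simp add: field_simps)
      then show False using eq no_root by (metis div_0 eq_iff_diff_eq_0)
    qed
  qed
  interpret L: cring L
  proof (rule cringI)
    show "abelian_group L"
    proof (rule abelian_groupI)
      fix x assume "x \<in> carrier L"
      obtain p q where "x = (p, q)" by (cases x)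
      then have "(- p, - q) \<oplus>\<^bsub>L\<^esub> x = \<zero>\<^bsub>L\<^esub>" by (simp add: L)
      then show "\<exists>y\<in>carrier L. y \<oplus>\<^bsub>L\<^esub> x = \<zero>\<^bsub>L\<^esub>" using L(1) by blast
    qed (auto simp: L)
    show "Group.comm_monoid L"
      by (rule comm_monoidI) (auto simp: L algebra_simps)
  qed (auto simp: L algebra_simps)
  have "field L"
  proof (rule L.cring_fieldI2)
    fix x assume "x \<noteq> \<zero>\<^bsub>L\<^esub>"
    then obtain p q where x: "x = (p, q)" and "(p, q) \<noteq> (0, 0)" by (cases x) (auto simp: L)
    then have n: "p * p + b * p * q - c * q * q \<noteq> 0" (is "?n \<noteq> 0") using norm by blast
    \<comment> \<open>The inverse is the conjugate p + q (b - t) divided by the norm.\<close>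
    have "x \<otimes>\<^bsub>L\<^esub> ((p + q * b) / ?n, - q / ?n) = (?n / ?n, 0)"
      by (simp add: x L add_divide_distrib[symmetric] diff_divide_distrib[symmetric]) (simp add: algebra_simps)
    then show "\<exists>y\<in>carrier L. x \<otimes>\<^bsub>L\<^esub> y = \<one>\<^bsub>L\<^esub>" using n L by auto
  qed (simp add: L)
  moreover have "h \<in> Ring.ring_hom (class_ring :: 'a ring) L"
    by (rule ring_hom_memI) (auto simp: h_def L)
  moreover have "L.dimension 2 (range h) (carrier L)"
  proof -
    have sub: "range h \<subseteq> carrier L" by (simp add: L)
    \<comment> \<open>Dimension 2 is reached by two line extensions of the zero space, by 1 and then
      by t.\<close>
    have E1: "L.line_extension (range h) (1, 0) {\<zero>\<^bsub>L\<^esub>} = range h"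
      by (rule Set.set_eqI) (auto simp: L.line_extension_mem_iff L h_def)
    have E2: "L.line_extension (range h) (0, 1) (range h) = carrier L"
      by (rule Set.set_eqI) (auto simp: L.line_extension_mem_iff L h_def)
    have "L.dimension (Suc 0) (range h) (range h)"
      using L.Suc_dim[of "(1, 0)" "{\<zero>\<^bsub>L\<^esub>}" 0 "range h"] L.zero_dim[of "range h"]
      by (simp only: E1) (simp add: L)
    moreover have "(0, 1) \<notin> range h" by (auto simp: h_def)
    ultimately have "L.dimension (Suc (Suc 0)) (range h) (carrier L)"
      using L.Suc_dim[of "(0, 1)" "range h" "Suc 0" "range h"] by (simp add: E2 L(1))
    then show ?thesis by (simp add: numeral_2_eq_2)
  qed
  ultimately show False using assms by (auto simp: no_quadratic_extensions_def)
qed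

section \<open>Commutative nil algebras of dimension four\<close>

type_synonym 'a quad = "'a \<times> 'a \<times> 'a \<times> 'a"

text \<open>The formulas are read off the columns of the matrices in \<open>rep_mat\<close>: the
  value is x times the lower right block formed with y, minus x. The agreement with the matrices is
  verified in \<open>lin_rep\<close>.\<close>

fun table :: "label \<Rightarrow> 'a::field quad \<Rightarrow> 'a quad \<Rightarrow> 'a quad" where
  "table S5 (x1, x2, x3, x4) (y1, y2, y3, y4) =
     (0, x1 * y1, x1 * y2 + x2 * y1, x1 * y3 + x2 * y2 + x3 * y1)"
| "table S32_sharp (x1, x2, x3, x4) (y1, y2, y3, y4) =
     (0, x1 * y1, 0, x1 * y2 + x2 * y1 + x3 * y3)"
| "table U1_4 (x1, x2, x3, x4) (y1, y2, y3, y4) = (0, x1 * y1, 0, x1 * y3 + x3 * y1)"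
| "table U2_4 (x1, x2, x3, x4) (y1, y2, y3, y4) = (0, 0, 0, x1 * y1 + x2 * y3 + x3 * y2)"
| "table S41 (x1, x2, x3, x4) (y1, y2, y3, y4) = (0, x1 * y1, x1 * y2 + x2 * y1, 0)"
| "table S32 (x1, x2, x3, x4) (y1, y2, y3, y4) = (0, x1 * y1, 0, x3 * y3)"
| "table S311 (x1, x2, x3, x4) (y1, y2, y3, y4) = (0, x1 * y1, 0, 0)"
| "table S221_sharp (x1, x2, x3, x4) (y1, y2, y3, y4) = (0, 0, x1 * y1 + x2 * y2, 0)"
| "table Char_two (x1, x2, x3, x4) (y1, y2, y3, y4) = (0, 0, x1 * y2 + x2 * y1, 0)"
| "table S2111 (x1, x2, x3, x4) (y1, y2, y3, y4) = (0, 0, 0, 0)"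

text \<open>The space is abstract so that the classification can choose bases freely. The axiom
  \<open>nil\<close> is the trace left by invertibility of the group elements; nilpotency itself is
  not among the axioms.\<close>

locale nil_algebra4 = finite_dimensional_vector_space scale Basis
  for scale :: "'a::field \<Rightarrow> 'v::ab_group_add \<Rightarrow> 'v" (infixr "*s" 75) and Basis +
  fixes mul :: "'v \<Rightarrow> 'v \<Rightarrow> 'v" (infixl "\<star>" 70)
  assumes card_Basis: "card Basis = 4"
    and mul_commute: "x \<star> y = y \<star> x"
    and mul_assoc: "(x \<star> y) \<star> z = x \<star> (y \<star> z)"
    and mul_add_left: "(x + y) \<star> z = x \<star> z + y \<star> z"
    and mul_scale_left: "(c *s x) \<star> y = c *s (x \<star> y)"
    and nil: "x \<star> y = x \<Longrightarrow> x = 0"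
begin

fun comb :: "'v \<Rightarrow> 'v \<Rightarrow> 'v \<Rightarrow> 'v \<Rightarrow> 'a quad \<Rightarrow> 'v" where
  "comb n1 n2 n3 n4 (x1, x2, x3, x4) = x1 *s n1 + x2 *s n2 + x3 *s n3 + x4 *s n4"

text \<open>Four vectors spanning a space of dimension four form a basis, so this says that the
  algebra has the given multiplication table in a suitable basis.\<close>

definition realizes :: "label \<Rightarrow> bool" where
  "realizes l \<longleftrightarrow> (\<exists>n1 n2 n3 n4. span {n1, n2, n3, n4} = UNIV \<and>
     (\<forall>x y. comb n1 n2 n3 n4 x \<star> comb n1 n2 n3 n4 y = comb n1 n2 n3 n4 (table l x y)))"

lemma mul_add_right: "z \<star> (x + y) = z \<star> x + z \<star> y"
  using mul_add_left mul_commute by metis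

lemma mul_scale_right: "x \<star> (c *s y) = c *s (x \<star> y)"
  using mul_scale_left mul_commute by metis

lemma mul_zero_left [simp]: "0 \<star> x = 0"
  using mul_add_left[of 0 0 x] by simp

lemma mul_zero_right [simp]: "x \<star> 0 = 0"
  using mul_commute mul_zero_left by metis

lemma mul_minus_left: "(- x) \<star> y = - (x \<star> y)"
  using mul_add_left[of x "- x" y] by (simp add: eq_neg_iff_add_eq_0 add.commute)

lemma mul_minus_right: "y \<star> (- x) = - (y \<star> x)"
  using mul_minus_left mul_commute by metis

lemma mul_diff_left: "(x - y) \<star> z = x \<star> z - y \<star> z"
  using mul_add_left[of x "- y" z] by (simp add: mul_minus_left)

lemma mul_diff_right: "z \<star> (x - y) = z \<star> x - z \<star> y"
  using mul_diff_left mul_commute by metis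

lemmas mul_bilinear = mul_add_left mul_add_right mul_diff_left mul_diff_right
  mul_minus_left mul_minus_right mul_scale_left mul_scale_right

lemmas scale_distribs = scale_left_distrib scale_right_distrib scale_left_diff_distrib scale_right_diff_distrib

lemma mul_left_commute: "x \<star> (y \<star> z) = y \<star> (x \<star> z)"
  by (metis mul_assoc mul_commute)

lemmas mul_ac = mul_assoc mul_commute mul_left_commute

text \<open>If x were an eigenvector of multiplication by y with eigenvalue c nonzero, dividing y by
  c would give a violation of \<open>nil\<close>. This is the form in which \<open>nil\<close> is
  used throughout.\<close>

lemma nil_scale: "x \<star> y = c *s x \<Longrightarrow> x \<noteq> 0 \<Longrightarrow> c = 0"
proof (rule ccontr)
  assume "x \<star> y = c *s x" "x \<noteq> 0" "c \<noteq> 0"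
  then have "x \<star> (inverse c *s y) = x" by (simp add: mul_scale_right)
  with nil \<open>x \<noteq> 0\<close> show False by blast
qed

lemma nil_scale_neg: "c *s x + x \<star> y = 0 \<Longrightarrow> x \<noteq> 0 \<Longrightarrow> c = 0"
  using nil_scale[of x y "- c"] by (simp add: eq_neg_iff_add_eq_0 add.commute)

section \<open>Spans and independence of few vectors in dimension four\<close>

lemma in_span2: "x \<in> span {u, v} \<longleftrightarrow> (\<exists>a b. x = a *s u + b *s v)"
  by (simp add: span_breakdown_eq span_empty diff_eq_eq add.commute)

lemma in_span3: "x \<in> span {u, v, w} \<longleftrightarrow> (\<exists>a b c. x = a *s u + b *s v + c *s w)"
  unfolding span_breakdown_eq[of _ u] in_span2 by (simp add: diff_eq_eq add_ac)

lemma in_span4: "x \<in> span {u, v, w, t} \<longleftrightarrow> (\<exists>a b c d. x = a *s u + b *s v + c *s w + d *s t)"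
  unfolding span_breakdown_eq[of _ u] in_span3 by (simp add: diff_eq_eq add_ac)

text \<open>A set does not record whether u, v, w coincide, so the cardinality is asserted along
  with independence; dimension counts need both.\<close>

lemma independent3:
  assumes "\<And>a b c. a *s u + b *s v + c *s w = 0 \<Longrightarrow> a = 0 \<and> b = 0 \<and> c = 0"
  shows "independent {u, v, w} \<and> card {u, v, w} = 3"
proof -
  have w: "w \<noteq> 0" using assms[of 0 0 1] by auto
  have v: "v \<notin> span {w}"
  proof
    assume "v \<in> span {w}"
    then obtain k where "v = k *s w" by (auto simp: span_breakdown_eq)
    then show False using assms[of 0 1 "- k"] by auto
  qed
  have u: "u \<notin> span {v, w}"
  proof
    assume "u \<in> span {v, w}"
    then obtain k m where "u = k *s v + m *s w" by (auto simp: in_span2)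
    then have "1 *s u + (- k) *s v + (- m) *s w = 0" by simp
    from assms[OF this] show False by simp
  qed
  have "v \<noteq> w" "u \<noteq> v" "u \<noteq> w" using u v by (auto intro: span_base)
  then show ?thesis using u v w by (simp add: independent_insert span_breakdown_eq)
qed

lemma independent4:
  assumes "\<And>a b c d. a *s u + b *s v + c *s w + d *s t = 0 \<Longrightarrow> a = 0 \<and> b = 0 \<and> c = 0 \<and> d = 0"
  shows "independent {u, v, w, t} \<and> card {u, v, w, t} = 4"
proof -
  have 3: "independent {v, w, t} \<and> card {v, w, t} = 3"
    by (rule independent3) (use assms[of 0] in auto)
  have u: "u \<notin> span {v, w, t}"
  proof
    assume "u \<in> span {v, w, t}"
    then obtain k m n where "u = k *s v + m *s w + n *s t" by (auto simp: in_span3)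
    then have "1 *s u + (- k) *s v + (- m) *s w + (- n) *s t = 0" by simp
    from assms[OF this] show False by simp
  qed
  then have "u \<notin> {v, w, t}" using span_base[of u "{v, w, t}"] by auto
  then show ?thesis using u 3 by (simp add: independent_insert[of u "{v, w, t}"] del: insert_iff)
qed

lemma span4_UNIV:
  assumes "\<And>a b c d. a *s u + b *s v + c *s w + d *s t = 0 \<Longrightarrow> a = 0 \<and> b = 0 \<and> c = 0 \<and> d = 0"
  shows "span {u, v, w, t} = UNIV"
  using independent4[OF assms] card_eq_dim[of "{u, v, w, t}" UNIV] card_Basis by auto

text \<open>The last four vectors would already span the space, making the first a combination of
  them. It serves to refute nonzero triple products.\<close>

lemma dependent5:
  assumes "\<And>a b c d e. a *s u + b *s v + c *s w + d *s t + e *s r = 0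
      \<Longrightarrow> a = 0 \<and> b = 0 \<and> c = 0 \<and> d = 0 \<and> e = 0"
  shows False
proof -
  have "span {v, w, t, r} = UNIV" by (rule span4_UNIV) (use assms[of 0] in auto)
  then obtain b c d e where "u = b *s v + c *s w + d *s t + e *s r"
    using in_span4[of u v w t r] by auto
  then have "1 *s u + (- b) *s v + (- c) *s w + (- d) *s t + (- e) *s r = 0" by simp
  from assms[OF this] show False by simp
qed

lemma dependent3:
  assumes "{u, v, w} \<subseteq> span {p, q}"
  obtains a b c where "a *s u + b *s v + c *s w = 0" "a \<noteq> 0 \<or> b \<noteq> 0 \<or> c \<noteq> 0"
proof (rule ccontr)
  assume "\<not> thesis"
  then have i: "independent {u, v, w} \<and> card {u, v, w} = 3"
    using that by (intro independent3) blast
  then have "card {u, v, w} \<le> card {p, q}"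
    using independent_span_bound[OF _ _ assms] by simp
  then show False using i card_insert_le_m1[of 2 "{q}" p] by simp
qed

lemma not_span3: obtains y where "y \<notin> span {u, v, w}"
proof -
  have "span {u, v, w} \<noteq> UNIV"
  proof
    assume "span {u, v, w} = UNIV"
    then have "dim (UNIV :: 'v set) \<le> card {u, v, w}" by (intro dim_le_card) auto
    also have "\<dots> \<le> 3" by (simp add: card_insert_if)
    finally show False by (simp add: card_Basis)
  qed
  then show ?thesis using that by auto
qed

lemma span_UNIV_trans: "span S = UNIV \<Longrightarrow> S \<subseteq> span T \<Longrightarrow> span T = UNIV"
  using span_minimal[OF _ subspace_span] by blast

section \<open>Criteria for recognising a multiplication table\<close>

lemma realizesI:
  assumes "span {n1, n2, n3, n4} = UNIV"
    and "\<And>x y. comb n1 n2 n3 n4 x \<star> comb n1 n2 n3 n4 y = comb n1 n2 n3 n4 (table l x y)"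
  shows "realizes l"
  using assms unfolding realizes_def by blast

lemma realizes_S5:
  assumes "span {n, n \<star> n, n \<star> (n \<star> n), n \<star> (n \<star> (n \<star> n))} = UNIV"
    and "n \<star> (n \<star> (n \<star> (n \<star> n))) = 0"
  shows "realizes S5"
  by (rule realizesI[OF assms(1)], clarify)
    (simp add: mul_bilinear mul_assoc assms(2) scale_distribs mult.commute add_ac)

text \<open>Since n2 = n1 n1 and n4 = n1 n2, every remaining product contains a factor that can be
  moved next to n1 and vanishes by n1 n3 = 0 or n1 n4 = 0.\<close>

lemma realizes_S32_sharp:
  assumes "span {n1, n2, n3, n4} = UNIV"
    and "n1 \<star> n1 = n2" "n1 \<star> n2 = n4" "n1 \<star> n3 = 0" "n1 \<star> n4 = 0" "n3 \<star> n3 = n4"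
  shows "realizes S32_sharp"
proof -
  have *: "n2 \<star> n2 = 0" "n2 \<star> n3 = 0" "n2 \<star> n4 = 0" "n3 \<star> n4 = 0" "n4 \<star> n4 = 0"
    using assms by (metis mul_ac mul_zero_left mul_zero_right)+
  show ?thesis
    by (rule realizesI[OF assms(1)], clarify)
      (simp add: mul_bilinear assms * mul_commute[of n2 n1] mul_commute[of n3 n1] mul_commute[of n4 n1]
        mul_commute[of n3 n2] mul_commute[of n4 n2] mul_commute[of n4 n3] scale_distribs mult.commute add_ac)
qed

lemma realizes_S41:
  assumes "span {n1, n2, n3, n4} = UNIV"
    and "n1 \<star> n1 = n2" "n1 \<star> n2 = n3" "n1 \<star> n3 = 0" "n1 \<star> n4 = 0" "n4 \<star> n4 = 0"
  shows "realizes S41"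
proof -
  have *: "n2 \<star> n2 = 0" "n2 \<star> n3 = 0" "n2 \<star> n4 = 0" "n3 \<star> n4 = 0" "n3 \<star> n3 = 0"
    using assms by (metis mul_ac mul_zero_left mul_zero_right)+
  show ?thesis
    by (rule realizesI[OF assms(1)], clarify)
      (simp add: mul_bilinear assms * mul_commute[of n2 n1] mul_commute[of n3 n1] mul_commute[of n4 n1]
        mul_commute[of n3 n2] mul_commute[of n4 n2] mul_commute[of n4 n3] scale_distribs mult.commute add_ac)
qed

text \<open>When triple products vanish, every basis vector that is itself a product annihilates the
  algebra. Only the products among the other basis vectors have to be prescribed.\<close>

lemma realizes_class2:
  assumes "span {n1, n2, n3, n4} = UNIV"
    and triple: "\<And>x y z. x \<star> (y \<star> z) = 0"
  shows "n1 \<star> n1 = n2 \<Longrightarrow> n1 \<star> n3 = n4 \<Longrightarrow> n3 \<star> n3 = 0 \<Longrightarrow> realizes U1_4"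
    and "n1 \<star> n1 = n4 \<Longrightarrow> n2 \<star> n3 = n4 \<Longrightarrow> n1 \<star> n2 = 0 \<Longrightarrow> n1 \<star> n3 = 0 \<Longrightarrow> n2 \<star> n2 = 0
      \<Longrightarrow> n3 \<star> n3 = 0 \<Longrightarrow> realizes U2_4"
    and "n1 \<star> n1 = n2 \<Longrightarrow> n3 \<star> n3 = n4 \<Longrightarrow> n1 \<star> n3 = 0 \<Longrightarrow> realizes S32"
    and "n1 \<star> n1 = n2 \<Longrightarrow> n1 \<star> n3 = 0 \<Longrightarrow> n1 \<star> n4 = 0 \<Longrightarrow> n3 \<star> n3 = 0 \<Longrightarrow> n3 \<star> n4 = 0
      \<Longrightarrow> n4 \<star> n4 = 0 \<Longrightarrow> realizes S311"
    and "n1 \<star> n1 = n3 \<Longrightarrow> n2 \<star> n2 = n3 \<Longrightarrow> n1 \<star> n2 = 0 \<Longrightarrow> n1 \<star> n4 = 0 \<Longrightarrow> n2 \<star> n4 = 0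
      \<Longrightarrow> n4 \<star> n4 = 0 \<Longrightarrow> realizes S221_sharp"
    and "n1 \<star> n2 = n3 \<Longrightarrow> n1 \<star> n1 = 0 \<Longrightarrow> n2 \<star> n2 = 0 \<Longrightarrow> n1 \<star> n4 = 0 \<Longrightarrow> n2 \<star> n4 = 0
      \<Longrightarrow> n4 \<star> n4 = 0 \<Longrightarrow> realizes Char_two"
proof -
  note comms = mul_commute[of n2 n1] mul_commute[of n3 n1] mul_commute[of n4 n1]
    mul_commute[of n3 n2] mul_commute[of n4 n2] mul_commute[of n4 n3]
  \<comment> \<open>Any value m of the multiplication is annihilated from both sides.\<close>
  have r: "z \<star> m = 0 \<and> m \<star> z = 0" if "x \<star> y = m" for x y m z
    using triple that mul_commute by metis
  note simps = mul_bilinear comms scale_distribs mult.commute add_ac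
  {
    assume a: "n1 \<star> n1 = n2" "n1 \<star> n3 = n4" "n3 \<star> n3 = 0"
    show "realizes U1_4"
      by (rule realizesI[OF assms(1)], clarify)
        (simp add: simps a r[OF a(1)] r[OF a(2)])
  next
    assume a: "n1 \<star> n1 = n4" "n2 \<star> n3 = n4" "n1 \<star> n2 = 0" "n1 \<star> n3 = 0" "n2 \<star> n2 = 0" "n3 \<star> n3 = 0"
    show "realizes U2_4"
      by (rule realizesI[OF assms(1)], clarify)
        (simp add: simps a r[OF a(1)] r[OF a(2)])
  next
    assume a: "n1 \<star> n1 = n2" "n3 \<star> n3 = n4" "n1 \<star> n3 = 0"
    show "realizes S32"
      by (rule realizesI[OF assms(1)], clarify)
        (simp add: simps a r[OF a(1)] r[OF a(2)])
  next
    assume a: "n1 \<star> n1 = n2" "n1 \<star> n3 = 0" "n1 \<star> n4 = 0" "n3 \<star> n3 = 0" "n3 \<star> n4 = 0" "n4 \<star> n4 = 0"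
    show "realizes S311"
      by (rule realizesI[OF assms(1)], clarify) (simp add: simps a r[OF a(1)])
  next
    assume a: "n1 \<star> n1 = n3" "n2 \<star> n2 = n3" "n1 \<star> n2 = 0" "n1 \<star> n4 = 0" "n2 \<star> n4 = 0" "n4 \<star> n4 = 0"
    show "realizes S221_sharp"
      by (rule realizesI[OF assms(1)], clarify) (simp add: simps a r[OF a(1)])
  next
    assume a: "n1 \<star> n2 = n3" "n1 \<star> n1 = 0" "n2 \<star> n2 = 0" "n1 \<star> n4 = 0" "n2 \<star> n4 = 0" "n4 \<star> n4 = 0"
    show "realizes Char_two"
      by (rule realizesI[OF assms(1)], clarify) (simp add: simps a r[OF a(1)])
  }
qed

section \<open>Algebras with a nonzero cube\<close>

lemma fourth_power_nonzero:
  assumes "x \<star> (x \<star> (x \<star> x)) \<noteq> 0"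
  shows "realizes S5"
proof -
  define b where "b = x \<star> x"
  define c where "c = x \<star> b"
  define d where "d = x \<star> c"
  have d: "d \<noteq> 0" using assms by (simp add: d_def c_def b_def)
  then have nz: "x \<noteq> 0" "b \<noteq> 0" "c \<noteq> 0" by (auto simp: d_def c_def b_def)
  have bb: "b \<star> b = d" "b \<star> x = c" "c \<star> x = d" "b \<star> c = x \<star> d" "c \<star> b = x \<star> d" "d \<star> x = x \<star> d"
    by (simp_all add: d_def c_def b_def mul_ac)
  have span: "span {x, b, c, d} = UNIV"
  proof (rule span4_UNIV)
    fix p q r s assume *: "p *s x + q *s b + r *s c + s *s d = 0"
    \<comment> \<open>All powers above x are multiples of x, so the relation reads p x + x y = 0 and
      kills p. The same argument then runs with b and c in place of x.\<close>
    have "p *s x + x \<star> (q *s x + r *s b + s *s c) = 0"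
      using * by (simp add: mul_bilinear b_def[symmetric] c_def[symmetric] d_def[symmetric] add_ac)
    then have p: "p = 0" using nil_scale_neg nz by blast
    then have "q *s b + b \<star> (r *s x + s *s b) = 0" using * by (simp add: mul_bilinear bb add_ac)
    then have q: "q = 0" using nil_scale_neg nz by blast
    then have "r *s c + c \<star> (s *s x) = 0" using * p by (simp add: mul_bilinear bb add_ac)
    then have r: "r = 0" using nil_scale_neg nz by blast
    with * p q d show "p = 0 \<and> q = 0 \<and> r = 0 \<and> s = 0" by simp
  qed
  \<comment> \<open>The fifth power is expanded in the basis of powers; its coefficients are shown
    to vanish from the lowest power upwards.\<close>
  obtain p q r s where *: "x \<star> d = p *s x + q *s b + r *s c + s *s d"
    using span in_span4[of "x \<star> d" x b c d] by auto
  \<comment> \<open>The terms above the lowest one are moved to the left, where x factors out. What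
    remains exhibits x as an eigenvector with eigenvalue p.\<close>
  have "x \<star> (d - q *s x - r *s b - s *s c) = p *s x"
    using * by (simp add: mul_bilinear b_def[symmetric] c_def[symmetric] d_def[symmetric])
  then have p: "p = 0" using nil_scale nz by blast
  have "b \<star> (c - r *s x - s *s b) = q *s b"
    using * p by (simp add: mul_bilinear bb)
  then have q: "q = 0" using nil_scale nz by blast
  have "c \<star> (b - s *s x) = r *s c"
    using * p q by (simp add: mul_bilinear bb)
  then have r: "r = 0" using nil_scale nz by blast
  have "d \<star> x = s *s d" using * p q r bb by simp
  then have "s = 0" using nil_scale d by blast
  then show ?thesis
    using realizes_S5[of x] span * p q r by (simp add: d_def c_def b_def)
qed

text \<open>A vector outside the span of x, x^2, x^3 can be corrected to a vector z with x z = 0.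
  Then z^2 can only be a multiple of x^3, and whether it is zero decides between the two
  tables.\<close>

lemma third_power_nonzero:
  assumes root: "\<And>c :: 'a. \<exists>k. k * k = c"
    and x3: "x \<star> (x \<star> x) \<noteq> 0" and x4: "x \<star> (x \<star> (x \<star> x)) = 0"
  shows "realizes S41 \<or> realizes S32_sharp"
proof -
  define b where "b = x \<star> x"
  define c where "c = x \<star> b"
  have c: "c \<noteq> 0" using x3 by (simp add: c_def b_def)
  then have nz: "x \<noteq> 0" "b \<noteq> 0" by (auto simp: c_def b_def)
  have xc: "x \<star> c = 0" using x4 by (simp add: c_def b_def)
  have bb: "b \<star> x = c" "b \<star> b = 0" "c \<star> x = 0" "c \<star> b = 0"
    using xc by (simp_all add: c_def b_def mul_ac)
  have bc: "x \<star> x = b" "x \<star> b = c" by (simp_all add: b_def c_def)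
  obtain y where y: "y \<notin> span {x, b, c}" using not_span3 by blast
  have indep: "p = 0 \<and> q = 0 \<and> r = 0 \<and> s = 0"
    if *: "p *s x + q *s b + r *s c + s *s z = 0" and z: "z \<notin> span {x, b, c}" for p q r s z
  proof -
    have s: "s = 0"
    proof (rule ccontr)
      assume "s \<noteq> 0"
      have "s *s z = - (p *s x + q *s b + r *s c)" using * by (metis eq_neg_iff_add_eq_0 add.commute)
      then have "inverse s *s (s *s z) = inverse s *s (- (p *s x + q *s b + r *s c))" by simp
      then have "z = inverse s *s (- (p *s x + q *s b + r *s c))" using \<open>s \<noteq> 0\<close> by simp
      also have "\<dots> \<in> span {x, b, c}"
        by (intro span_scale span_neg span_add) (auto intro: span_base)
      finally show False using z by blast
    qed
    have "p *s x + x \<star> (q *s x + r *s b) = 0"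
      using * s by (simp add: mul_bilinear bc add_ac)
    then have p: "p = 0" using nil_scale_neg nz by blast
    then have "q *s b + b \<star> (r *s x) = 0" using * s by (simp add: mul_bilinear bb)
    then have "q = 0" using nil_scale_neg nz by blast
    with * p s c show ?thesis by simp
  qed
  have span: "span {x, b, c, z} = UNIV" if "z \<notin> span {x, b, c}" for z
    using indep that by (intro span4_UNIV) blast
  obtain p q r s where xy: "x \<star> y = p *s x + q *s b + r *s c + s *s y"
    using span[OF y] in_span4[of "x \<star> y" x b c y] by auto
  have not_span: "y + w \<notin> span {x, b, c}" if "w \<in> span {x, b, c}" for w
    using y that span_add_eq2 by blast
  have s: "s = 0"
  proof (rule ccontr)
    assume s: "s \<noteq> 0"
    \<comment> \<open>These solve the triangular system that turns \<open>y\<close> plus a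
      combination of x, x^2, x^3 into an eigenvector of multiplication by x with eigenvalue
      \<open>s\<close>.\<close>
    define k l m where "k = p / s" and "l = (q + k) / s" and "m = (r + l) / s"
    let ?y = "y + (k *s x + l *s b + m *s c)"
    have klm: "s * k = p" "s * l = q + k" "s * m = r + l"
      using s by (simp_all add: k_def l_def m_def)
    have "?y \<star> x = s *s ?y"
      using xy by (simp add: mul_bilinear bb bc mul_commute[of y x] klm scale_distribs add_ac)
    then have "?y = 0" using nil_scale s by blast
    moreover have "k *s x + l *s b + m *s c \<in> span {x, b, c}"
      by (intro span_scale span_add) (auto intro: span_base)
    ultimately show False using not_span span_zero by metis
  qed
  \<comment> \<open>Subtracting q x + r x^2 removes the terms q x^2 + r x^3 from x y; the remaining
    p x is excluded as an eigenvalue relation.\<close>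
  define z where "z = y + (- q *s x + - r *s b)"
  have "x \<star> z = p *s x"
    using xy s by (simp add: z_def mul_bilinear bc)
  then have p: "p = 0" using nil_scale nz by blast
  with \<open>x \<star> z = p *s x\<close> have xz: "x \<star> z = 0" by simp
  have z: "z \<notin> span {x, b, c}"
    unfolding z_def by (intro not_span span_scale span_add) (auto intro: span_base)
  have cz: "c \<star> z = 0" "b \<star> z = 0" by (metis b_def c_def mul_ac xz mul_zero_right)+
  obtain p q r s where zz: "z \<star> z = p *s x + q *s b + r *s c + s *s z"
    using span[OF z] in_span4[of "z \<star> z" x b c z] by auto
  \<comment> \<open>Multiplying the expansion of z^2 by x leaves p x^2 + q x^3, which must vanish
    since x z = 0.\<close>
  have "x \<star> (z \<star> z) = 0" using xz by (metis mul_assoc mul_zero_left)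
  then have "0 *s x + p *s b + q *s c + 0 *s z = 0"
    using zz xz xc by (simp add: mul_bilinear bc)
  from indep[OF this z] have pq: "p = 0" "q = 0" by auto
  \<comment> \<open>Now z^2 = r c + s z and c z = 0, so z^2 is an eigenvector of multiplication by z
    with eigenvalue s, unless it is zero.\<close>
  have "(z \<star> z) \<star> z = s *s (z \<star> z)"
    using cz zz pq by (metis add_0 mul_add_left mul_scale_left scale_zero_left scale_zero_right)
  then have "s = 0 \<or> z \<star> z = 0" using nil_scale by blast
  then have s: "s = 0" using indep[of 0 0 r s z] zz pq z by auto
  then have zz: "z \<star> z = r *s c" using zz pq by simp
  show ?thesis
  proof (cases "r = 0")
    case True
    then have "realizes S41"
      using realizes_S41[OF span[OF z]] bc xc xz zz by simp
    then show ?thesis ..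
  next
    case False
    \<comment> \<open>Rescaling z by a square root of 1 / r makes its square equal to x^3.\<close>
    obtain k where k: "k * k = inverse r" using root by blast
    then have "k \<noteq> 0" using False by auto
    have "span {x, b, k *s z, c} = UNIV"
    proof (rule span_UNIV_trans[OF span[OF z]])
      have "inverse k *s (k *s z) \<in> span {x, b, k *s z, c}"
        by (rule span_scale) (auto intro: span_base)
      then show "{x, b, c, z} \<subseteq> span {x, b, k *s z, c}"
        using \<open>k \<noteq> 0\<close> by (auto intro: span_base)
    qed
    moreover have zz': "(k *s z) \<star> (k *s z) = c"
    proof -
      have "(k *s z) \<star> (k *s z) = ((k * k) * r) *s c" by (simp add: mul_bilinear zz mult.assoc)
      then show ?thesis using k False by simp
    qed
    moreover have "x \<star> (k *s z) = 0" by (simp add: mul_scale_right xz)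
    ultimately have "realizes S32_sharp" using realizes_S32_sharp bc xc by blast
    then show ?thesis ..
  qed
qed

section \<open>Vanishing of all triple products when cubes vanish\<close>

lemma triple_products_zero:
  assumes cube: "\<And>x. x \<star> (x \<star> x) = 0"
  shows "x \<star> (y \<star> z) = 0"
proof -
  \<comment> \<open>Full polarisation of x^3 = 0 gives only 6 x y z = 0, which is empty in
    characteristic 2 or 3. Instead, if x^2 y were nonzero, then x, y, x^2, x y, x^2 y would be five
    independent vectors.\<close>
  have sq: "x \<star> (x \<star> y) = 0" for x y
  proof (rule ccontr)
    define e where "e = x \<star> (x \<star> y)"
    assume "x \<star> (x \<star> y) \<noteq> 0"
    then have e: "e \<noteq> 0" by (simp add: e_def)
    define f where "f = x \<star> x"
    define g where "g = x \<star> y"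
    have xe: "x \<star> e = 0" using cube[of x] by (metis e_def mul_assoc mul_zero_left)
    have prods: "f \<star> x = 0" "f \<star> f = 0" "f \<star> g = 0" "f \<star> y = e" "x \<star> g = e" "x \<star> f = 0" "f \<star> e = 0"
      "y \<star> f = e" "g \<star> x = e" "y \<star> x = g" "x \<star> x = f" "x \<star> y = g"
      using cube[of x] xe by (simp_all add: e_def f_def g_def mul_ac)
    show False
    proof (rule dependent5[of x y f g e])
      fix p q r s t assume *: "p *s x + q *s y + r *s f + s *s g + t *s e = 0"
      \<comment> \<open>Multiplication by x^2 annihilates every term except y, because x^3 =
        0.\<close>
      have "f \<star> (p *s x + q *s y + r *s f + s *s g + t *s e) = q *s e"
        by (simp add: mul_bilinear prods)
      then have q: "q = 0" using * e by simp
      have xmul: "x \<star> (p *s x + q *s y + r *s f + s *s g + t *s e) = p *s f + s *s e"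
        by (simp add: mul_bilinear prods q xe)
      \<comment> \<open>Multiplying the relation by x and then by y returns p e up to a multiple of
        e by an algebra element, so the eigenvalue argument removes p.\<close>
      have "p *s e + e \<star> (s *s y) = y \<star> (p *s f + s *s e)"
        by (simp add: mul_bilinear prods mul_commute[of e y])
      then have "p *s e + e \<star> (s *s y) = 0" using * xmul by simp
      then have p: "p = 0" using nil_scale_neg e by blast
      then have s: "s = 0" using xmul * e by simp
      have "r *s e + e \<star> (t *s y) = y \<star> (r *s f + t *s e)"
        by (simp add: mul_bilinear prods mul_commute[of e y])
      also have "\<dots> = 0" using * p q s by simp
      finally have r: "r = 0" using nil_scale_neg e by blast
      then show "p = 0 \<and> q = 0 \<and> r = 0 \<and> s = 0 \<and> t = 0" using * p q s e by simp
    qed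
  qed
  show ?thesis
  proof (rule ccontr)
    define e where "e = x \<star> (y \<star> z)"
    define g where "g = x \<star> y"
    assume "x \<star> (y \<star> z) \<noteq> 0"
    then have e: "e \<noteq> 0" by (simp add: e_def)
    \<comment> \<open>From x^2 y = 0 for all x and y, any product of at least three factors with a
      repeated factor vanishes.\<close>
    have sqs: "w \<star> (v \<star> w) = 0" "w \<star> (u \<star> (v \<star> w)) = 0" "v \<star> (w \<star> w) = 0"
        "u \<star> (v \<star> (w \<star> w)) = 0" for u v w
      using sq[of w] by (metis mul_ac mul_zero_right)+
    have prods: "y \<star> z \<star> x = e" "y \<star> z \<star> y = 0" "y \<star> z \<star> z = 0" "y \<star> z \<star> g = 0" "y \<star> z \<star> e = 0"
        "x \<star> z \<star> y = e" "x \<star> z \<star> z = 0" "x \<star> z \<star> g = 0" "x \<star> z \<star> e = 0"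
        "g \<star> z = e" "g \<star> g = 0" "g \<star> e = 0" "z \<star> e = 0" "z \<star> g = e"
      using sq sqs by (simp_all add: e_def g_def mul_ac)
    show False
    proof (rule dependent5[of x y z g e])
      fix p q r s t assume *: "p *s x + q *s y + r *s z + s *s g + t *s e = 0"
      \<comment> \<open>Multiplying by y z, x z, x y isolates the coefficients of x, y, z in turn;
        the others meet a repeated factor.\<close>
      have "y \<star> z \<star> (p *s x + q *s y + r *s z + s *s g + t *s e) = p *s e"
        by (simp add: mul_bilinear prods)
      then have p: "p = 0" using * e by simp
      have "x \<star> z \<star> (p *s x + q *s y + r *s z + s *s g + t *s e) = q *s e"
        by (simp add: mul_bilinear prods p)
      then have q: "q = 0" using * e by simp
      have "g \<star> (p *s x + q *s y + r *s z + s *s g + t *s e) = r *s e"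
        by (simp add: mul_bilinear prods p q)
      then have r: "r = 0" using * e by simp
      have "z \<star> (s *s g + t *s e) = s *s e"
        by (simp add: mul_bilinear prods)
      then have s: "s = 0" using * p q r e by simp
      show "p = 0 \<and> q = 0 \<and> r = 0 \<and> s = 0 \<and> t = 0" using * p q r s e by simp
    qed
  qed
qed

section \<open>Triple products zero, products not confined to a line\<close>

lemma pencil:
  assumes root: "\<And>b c :: 'a. \<exists>k. k * k = b * k + c"
    and triple: "\<And>x y z. x \<star> (y \<star> z) = 0"
    and span: "span {x, y, x \<star> x, x \<star> y, y \<star> y} = UNIV"
    and rel: "a *s (x \<star> x) + b *s (x \<star> y) + c *s (y \<star> y) = 0" and a: "a \<noteq> 0"
  shows "realizes S32 \<or> realizes U1_4"
proof -
  \<comment> \<open>With r and s the two roots of a t^2 + b t + c, the relation becomes (x - r y)(x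
    - s y) = 0.\<close>
  obtain r where r: "r * r = (- b / a) * r + (- c / a)" using root by blast
  define s where "s = - b / a - r"
  define u where "u = x - r *s y"
  define v where "v = x - s *s y"
  have xx: "x \<star> x = (r + s) *s (x \<star> y) - (r * s) *s (y \<star> y)"
  proof -
    have "r + s = - b / a" by (simp add: s_def)
    moreover have "r * s = c / a"
      by (simp add: s_def right_diff_distrib r mult.commute)
    moreover have "x \<star> x = (- b / a) *s (x \<star> y) - (c / a) *s (y \<star> y)"
    proof -
      have "a *s (x \<star> x) = - (b *s (x \<star> y) + c *s (y \<star> y))"
        using rel by (simp only: eq_neg_iff_add_eq_0 add.assoc)
      then have "inverse a *s (a *s (x \<star> x)) = inverse a *s (- (b *s (x \<star> y) + c *s (y \<star> y)))" by simp
      then show ?thesis using a by (simp add: scale_distribs divide_inverse mult.commute)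
    qed
    ultimately show ?thesis by simp
  qed
  have uv: "u \<star> v = 0"
    by (simp add: u_def v_def mul_bilinear xx mul_commute[of y x] scale_distribs)
  show ?thesis
  proof (cases "r = s")
    \<comment> \<open>A double root gives u^2 = 0, and u together with y generates
      \<open>U1_4\<close>. Distinct roots give two generators with product zero, which is
      \<open>S32\<close>.\<close>
    case True
    have x: "x = u + r *s y" by (simp add: u_def)
    have uu: "u \<star> u = 0" using uv True by (simp add: u_def v_def)
    have xy: "x \<star> y = y \<star> u + r *s (y \<star> y)"
      by (simp add: x mul_bilinear mul_commute[of u y])
    have xx: "x \<star> x = r *s (y \<star> u) + r *s (y \<star> u) + (r * r) *s (y \<star> y)"
      by (simp add: x mul_bilinear mul_commute[of u y] uu scale_distribs)
    have "span {y, y \<star> y, u, y \<star> u} = UNIV"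
    proof (rule span_UNIV_trans[OF span])
      have "x \<in> span {y, y \<star> y, u, y \<star> u}" "x \<star> x \<in> span {y, y \<star> y, u, y \<star> u}"
        "x \<star> y \<in> span {y, y \<star> y, u, y \<star> u}"
        unfolding xy xx by (auto simp: x intro!: span_add span_scale intro: span_base)
      then show "{x, y, x \<star> x, x \<star> y, y \<star> y} \<subseteq> span {y, y \<star> y, u, y \<star> u}"
        by (auto intro: span_base)
    qed
    then have "realizes U1_4"
      by (rule realizes_class2(1)[OF _ triple]) (use uu in simp_all)
    then show ?thesis ..
  next
    case False
    \<comment> \<open>Because v - u = (r - s) y, the old generators are recovered from u and v, and
      the span carries over.\<close>
    define k where "k = 1 / (r - s)"
    have k: "k * (r - s) = 1" using False by (simp add: k_def)
    have y: "y = k *s (v - u)"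
    proof -
      have "k *s (v - u) = (k * (r - s)) *s y" by (simp add: u_def v_def scale_distribs algebra_simps)
      then show ?thesis using k by simp
    qed
    have x: "x = u + r *s y" by (simp add: u_def)
    have yy: "y \<star> y = (k * k) *s (u \<star> u + v \<star> v)"
      by (subst (1 2) y) (simp add: mul_bilinear uv mul_commute[of v u] scale_distribs)
    have uy: "u \<star> y = - k *s (u \<star> u)" by (subst y) (simp add: mul_bilinear uv scale_distribs)
    let ?T = "{u, u \<star> u, v, v \<star> v}"
    have T: "u \<in> span ?T" "v \<in> span ?T" "u \<star> u \<in> span ?T" "v \<star> v \<in> span ?T"
      by (auto intro: span_base)
    have yT: "y \<in> span ?T" unfolding y by (intro span_scale span_diff T)
    have yyT: "y \<star> y \<in> span ?T" unfolding yy by (intro span_scale span_add T)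
    have uyT: "u \<star> y \<in> span ?T" unfolding uy by (intro span_scale T)
    have xT: "x \<in> span ?T" unfolding x by (intro span_scale span_add T yT)
    have "x \<star> y = u \<star> y + r *s (y \<star> y)" by (simp add: x mul_bilinear)
    also have "\<dots> \<in> span ?T" by (intro span_scale span_add uyT yyT)
    finally have xyT: "x \<star> y \<in> span ?T" .
    have "x \<star> x = u \<star> u + r *s (u \<star> y) + r *s (x \<star> y)"
      by (simp add: x mul_bilinear mul_commute[of y u] scale_distribs)
    also have "\<dots> \<in> span ?T" by (intro span_scale span_add uyT xyT T)
    finally have xxT: "x \<star> x \<in> span ?T" .
    have "span ?T = UNIV"
      by (rule span_UNIV_trans[OF span]) (use xT yT xxT xyT yyT in auto)
    then have "realizes S32"
      by (rule realizes_class2(3)[OF _ triple]) (use uv in simp_all)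
    then show ?thesis ..
  qed
qed

text \<open>Two independent products p, q lie in the annihilator, so only two further basis vectors
  x, y contribute. The three products x^2, x y, y^2 then lie in the plane of p and q, and this
  yields the quadratic relation.\<close>

lemma two_generator_products:
  assumes root: "\<And>b c :: 'a. \<exists>k. k * k = b * k + c"
    and triple: "\<And>x y z. x \<star> (y \<star> z) = 0"
    and nonprop: "\<And>p. \<exists>x y. \<forall>c. x \<star> y \<noteq> c *s p"
  shows "realizes S32 \<or> realizes U1_4"
proof -
  obtain p1 p2 where 1: "\<forall>c. p1 \<star> p2 \<noteq> c *s 0" using nonprop by blast
  obtain q1 q2 where 2: "\<forall>c. q1 \<star> q2 \<noteq> c *s (p1 \<star> p2)" using nonprop by blast
  define p where "p = p1 \<star> p2"
  define q where "q = q1 \<star> q2"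
  have p0: "p \<noteq> 0" and q: "q \<noteq> c *s p" for c using 1 2 by (auto simp: p_def q_def)
  have ann: "p \<star> z = 0" "q \<star> z = 0" "z \<star> p = 0" "z \<star> q = 0" for z
    using triple mul_commute by (metis p_def q_def)+
  obtain x where x: "x \<notin> span {p, q, q}" using not_span3 by blast
  obtain y where y: "y \<notin> span {p, q, x}" using not_span3 by blast
  have pq_indep: "a = 0 \<and> b = 0" if "a *s p + b *s q = 0" for a b
  proof (cases "b = 0")
    case False
    have "b *s q = (- a) *s p" using that by (simp add: eq_neg_iff_add_eq_0 add.commute)
    then have "inverse b *s (b *s q) = inverse b *s ((- a) *s p)" by simp
    then show ?thesis using q[of "inverse b * - a"] False by simp
  qed (use that p0 in auto)
  have "span {p, q, x, y} = UNIV"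
  proof -
    have q0: "q \<noteq> 0" "p \<noteq> q" using q[of 0] q[of 1] by auto
    have "p \<notin> span {q}"
      using pq_indep[of 1] by (metis add.right_neutral diff_add_cancel in_span2 insert_absorb2
          scale_one scale_zero_left scale_minus_left add.right_inverse zero_neq_one span_breakdown_eq span_empty singletonD eq_iff_diff_eq_0)
    then have "independent {p, q}" using q0 by (simp add: independent_insert)
    moreover have "x \<notin> span {p, q}" "x \<noteq> p" "x \<noteq> q"
      using x by (auto intro: span_base)
    moreover have "y \<notin> span {x, p, q}" "y \<noteq> p" "y \<noteq> q" "y \<noteq> x"
      using y by (auto intro: span_base simp: insert_commute)
    ultimately have "independent {y, x, p, q} \<and> card {y, x, p, q} = 4"
      using q0 by (simp add: independent_insert[of y] independent_insert[of x])
    then have "span {y, x, p, q} = UNIV"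
      using card_eq_dim[of "{y, x, p, q}" UNIV] card_Basis by auto
    moreover have "{y, x, p, q} = {p, q, x, y}" by auto
    ultimately show ?thesis by simp
  qed
  then have coords: "\<exists>a b c d. z = a *s p + b *s q + c *s x + d *s y" for z
    using in_span4[of z p q x y] by auto
  have prods: "z \<star> w \<in> span {x \<star> x, x \<star> y, y \<star> y}" for z w
  proof -
    obtain a b c d where z: "z = a *s p + b *s q + c *s x + d *s y" using coords by blast
    obtain a' b' c' d' where w: "w = a' *s p + b' *s q + c' *s x + d' *s y" using coords by blast
    show ?thesis
      by (auto simp: z w mul_bilinear ann mul_commute[of y x] intro!: span_add span_scale intro: span_base)
  qed
  \<comment> \<open>The products x^2, x y, y^2 span all products, so they cannot all be multiples of
    one vector.\<close>
  have not_mult: False if "x \<star> x = a *s m" "x \<star> y = b *s m" "y \<star> y = c *s m" for a b c m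
  proof -
    obtain z w where zw: "\<forall>c. z \<star> w \<noteq> c *s m" using nonprop by blast
    have "span {x \<star> x, x \<star> y, y \<star> y} \<subseteq> span {m}"
      using that by (intro span_minimal subspace_span) (auto intro: span_scale span_base)
    then have "z \<star> w \<in> span {m}" using prods by blast
    then show False using zw by (auto simp: span_breakdown_eq)
  qed
  \<comment> \<open>A product with component c x + d y annihilates x and y. If c or d were nonzero,
    this would make x^2, x y, y^2 multiples of a single one of them.\<close>
  have in_pq: "z \<star> w \<in> span {p, q}" for z w
  proof -
    obtain a b c d where t: "z \<star> w = a *s p + b *s q + c *s x + d *s y" using coords by blast
    have "x \<star> (z \<star> w) = c *s (x \<star> x) + d *s (x \<star> y)" "y \<star> (z \<star> w) = c *s (x \<star> y) + d *s (y \<star> y)"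
      by (simp_all add: t mul_bilinear ann mul_commute[of y x])
    then have e: "c *s (x \<star> x) = (- d) *s (x \<star> y)" "c *s (x \<star> y) = (- d) *s (y \<star> y)"
        "d *s (x \<star> y) = (- c) *s (x \<star> x)" "d *s (y \<star> y) = (- c) *s (x \<star> y)"
      using triple by (simp_all add: eq_neg_iff_add_eq_0 add.commute)
    have divide: "m = (inverse k * l) *s n" if "k *s m = l *s n" "k \<noteq> 0" for k l m n
    proof -
      have "m = inverse k *s (k *s m)" using that(2) by simp
      also have "\<dots> = inverse k *s (l *s n)" by (simp only: that(1))
      finally show ?thesis by simp
    qed
    have c: "c = 0"
    proof (rule ccontr)
      assume "c \<noteq> 0"
      with divide[OF e(1)] divide[OF e(2)] not_mult[of _ "y \<star> y" _ 1] show False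
        by (metis scale_scale scale_one)
    qed
    have d: "d = 0"
    proof (rule ccontr)
      assume "d \<noteq> 0"
      with divide[OF e(3)] divide[OF e(4)] not_mult[of 1 "x \<star> x"] show False
        by (metis scale_scale scale_one)
    qed
    show ?thesis unfolding t c d by (auto intro!: span_add span_scale intro: span_base)
  qed
  \<comment> \<open>Three vectors in a space spanned by two satisfy a nontrivial linear
    relation.\<close>
  then have "{x \<star> x, x \<star> y, y \<star> y} \<subseteq> span {p, q}" by auto
  then obtain a b c where rel: "a *s (x \<star> x) + b *s (x \<star> y) + c *s (y \<star> y) = 0"
    and abc: "a \<noteq> 0 \<or> b \<noteq> 0 \<or> c \<noteq> 0" by (rule dependent3)
  have span: "span {x, y, x \<star> x, x \<star> y, y \<star> y} = UNIV"
  proof (rule span_UNIV_trans[OF \<open>span {p, q, x, y} = UNIV\<close>])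
    have "p \<in> span {x \<star> x, x \<star> y, y \<star> y}" "q \<in> span {x \<star> x, x \<star> y, y \<star> y}"
      using prods by (auto simp: p_def q_def)
    moreover have "span {x \<star> x, x \<star> y, y \<star> y} \<subseteq> span {x, y, x \<star> x, x \<star> y, y \<star> y}"
      by (intro span_mono) auto
    ultimately show "{p, q, x, y} \<subseteq> span {x, y, x \<star> x, x \<star> y, y \<star> y}" by (auto intro: span_base)
  qed
  consider "a \<noteq> 0" | "c \<noteq> 0" | "a = 0" "c = 0" "b \<noteq> 0" using abc by blast
  then show ?thesis
  proof cases
    case 1
    then show ?thesis using pencil[OF root triple span rel] by simp
  next
    case 2
    have "span {y, x, y \<star> y, y \<star> x, x \<star> x} = UNIV"
      using span by (simp add: insert_commute mul_commute[of y x])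
    moreover have "c *s (y \<star> y) + b *s (y \<star> x) + a *s (x \<star> x) = 0"
      using rel by (simp add: add_ac mul_commute[of y x])
    ultimately show ?thesis using pencil[OF root triple] 2 by blast
  next
    \<comment> \<open>The relation has no square term to normalise, but it already says x y = 0, so
      x and y are the orthogonal generators.\<close>
    case 3
    then have xy: "x \<star> y = 0" using rel by simp
    have "span {x, x \<star> x, y, y \<star> y} = UNIV"
      by (rule span_UNIV_trans[OF span]) (auto simp: xy span_zero intro: span_base)
    then have "realizes S32"
      by (rule realizes_class2(3)[OF _ triple]) (use xy in simp_all)
    then show ?thesis ..
  qed
qed

section \<open>Products on a line: symmetric bilinear forms\<close>

lemma normalized_square:
  assumes root: "\<And>c :: 'a. \<exists>k. k * k = c" and c: "w \<star> w = c *s p" "c \<noteq> 0"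
  obtains k where "k \<noteq> 0" "(k *s w) \<star> (k *s w) = p"
proof -
  obtain k where k: "k * k = inverse c" using root by blast
  have "(k *s w) \<star> (k *s w) = (k * k * c) *s p" by (simp add: mul_bilinear c(1) mult_ac)
  also have "k * k * c = 1" using k c(2) by simp
  finally show ?thesis using that[of k] k c(2) by fastforce
qed

text \<open>Products are multiples of p, hence values of a form on x, y, z. Orthogonalising z
  against y and rescaling gives orthonormal vectors; their number, two or three, selects the
  table.\<close>

lemma diagonal_form:
  assumes root: "\<And>c :: 'a. \<exists>k. k * k = c"
    and triple: "\<And>x y z. x \<star> (y \<star> z) = 0"
    and span: "span {x, p, y, z} = UNIV"
    and prods: "x \<star> x = p" "x \<star> y = 0" "x \<star> z = 0" "y \<star> y = a *s p" "y \<star> z = b *s p" "z \<star> z = c *s p"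
    and a: "a \<noteq> 0"
  shows "realizes S221_sharp \<or> realizes U2_4"
proof -
  obtain k where k: "k \<noteq> 0" "(k *s y) \<star> (k *s y) = p"
    using normalized_square[OF root prods(4) a] by blast
  define v where "v = k *s y"
  \<comment> \<open>Gram-Schmidt against y, possible because y y = a p with a nonzero.\<close>
  define w where "w = z - (b / a) *s y"
  have v: "x \<star> v = 0" "v \<star> v = p" using k prods by (simp_all add: v_def mul_scale_right)
  have "y \<star> w = 0" using a by (simp add: w_def mul_bilinear prods)
  then have w: "x \<star> w = 0" "v \<star> w = 0"
    by (simp_all add: v_def mul_scale_left) (simp add: w_def mul_bilinear prods)
  obtain d where d: "w \<star> w = d *s p"
  proof
    show "w \<star> w = (c - b / a * b) *s p"
      using a by (simp add: w_def mul_bilinear prods mul_commute[of z y] scale_distribs)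
  qed
  have span: "span {x, p, v, w} = UNIV"
  proof (rule span_UNIV_trans[OF span])
    have y: "y \<in> span {x, p, v, w}"
    proof -
      have "y = inverse k *s v" using k by (simp add: v_def)
      also have "\<dots> \<in> span {x, p, v, w}" by (rule span_scale) (auto intro: span_base)
      finally show ?thesis .
    qed
    have "z = w + (b / a) *s y" by (simp add: w_def)
    also have "\<dots> \<in> span {x, p, v, w}" using y by (intro span_add span_scale) (auto intro: span_base)
    finally show "{x, p, y, z} \<subseteq> span {x, p, v, w}" using y by (auto intro: span_base)
  qed
  show ?thesis
  proof (cases "d = 0")
    case True
    have "span {x, v, p, w} = UNIV" using span by (simp add: insert_commute)
    then have "realizes S221_sharp"
      by (rule realizes_class2(5)[OF _ triple]) (use v w d prods True in simp_all)
    then show ?thesis ..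
  next
    case False
    obtain l where l: "l \<noteq> 0" "(l *s w) \<star> (l *s w) = p"
      using normalized_square[OF root d False] by blast
    define u where "u = l *s w"
    have u: "x \<star> u = 0" "v \<star> u = 0" "u \<star> u = p" using l w by (simp_all add: u_def mul_scale_right)
    have span: "span {x, p, v, u} = UNIV"
    proof (rule span_UNIV_trans[OF span])
      have "w = inverse l *s u" using l by (simp add: u_def)
      also have "\<dots> \<in> span {x, p, v, u}" by (rule span_scale) (auto intro: span_base)
      finally show "{x, p, v, w} \<subseteq> span {x, p, v, u}" by (auto intro: span_base)
    qed
    have comms: "v \<star> x = 0" "u \<star> x = 0" "u \<star> v = 0" using u v mul_commute by metis+
    have "realizes U2_4"
    proof (cases "(2 :: 'a) = 0")
      case True
      have two: "m + m = 0" for m :: 'v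
      proof -
        have "m + m = (2 :: 'a) *s m" by (metis one_add_one scale_left_distrib scale_one)
        then show ?thesis using True by simp
      qed
      \<comment> \<open>In characteristic 2 the sum of three orthonormal vectors has square p and is
        orthogonal to x + v and x + u; these two have square zero and product p. That is the form of
        \<open>U2_4\<close>.\<close>
      let ?T = "{x + v + u, x + v, x + u, p}"
      have "span ?T = UNIV"
      proof (rule span_UNIV_trans[OF span])
        have T: "x + v + u \<in> span ?T" "x + v \<in> span ?T" "x + u \<in> span ?T"
          by (auto intro: span_base)
        have "u \<in> span ?T" "v \<in> span ?T" "x \<in> span ?T"
          using span_diff[OF T(1,2)] span_diff[OF T(1,3)] span_diff[OF span_add[OF T(2,3)] T(1)]
          by (simp_all add: algebra_simps)
        then show "{x, p, v, u} \<subseteq> span ?T" by (auto intro: span_base)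
      qed
      then show ?thesis
        by (rule realizes_class2(2)[OF _ triple]) (simp_all add: mul_bilinear u v prods comms two)
    next
      case False
      \<comment> \<open>With i^2 = - 1 the vectors v + i u and (v - i u) / 2 form a hyperbolic pair,
        as \<open>U2_4\<close> requires alongside x.\<close>
      obtain i :: 'a where i: "i * i = - 1" using root by blast
      then have i0: "i \<noteq> 0" by auto
      define n2 where "n2 = v + i *s u"
      define n3 where "n3 = (1 / 2) *s (v - i *s u)"
      have "span {x, n2, n3, p} = UNIV"
      proof (rule span_UNIV_trans[OF span])
        have half: "(1 / 2) *s m + (1 / 2) *s m = m" for m
          using False by (simp add: scale_left_distrib[symmetric])
        have T: "n2 \<in> span {x, n2, n3, p}" "n3 \<in> span {x, n2, n3, p}" by (auto intro: span_base)
        have "v = (1 / 2) *s n2 + n3" using half by (simp add: n2_def n3_def scale_distribs)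
        also have "\<dots> \<in> span {x, n2, n3, p}" by (intro span_add span_scale T)
        finally have v: "v \<in> span {x, n2, n3, p}" .
        have "u = (- i) *s (n2 - v)" using i by (simp add: n2_def)
        also have "\<dots> \<in> span {x, n2, n3, p}" by (intro span_diff span_scale T v)
        finally show "{x, p, v, u} \<subseteq> span {x, n2, n3, p}" using v by (auto intro: span_base)
      qed
      moreover have "n2 \<star> n3 = p"
      proof -
        have "n2 \<star> n3 = (1 / 2) *s (p - (i * i) *s p)"
          by (simp add: n2_def n3_def mul_bilinear u v comms)
        then show ?thesis using i False by (simp add: scale_distribs scale_left_distrib[symmetric])
      qed
      moreover have "n2 \<star> n2 = 0" "n3 \<star> n3 = 0" "x \<star> n2 = 0" "x \<star> n3 = 0"
        using i by (simp_all add: n2_def n3_def mul_bilinear u v comms)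
      ultimately show ?thesis using realizes_class2(2)[OF _ triple] prods(1) by blast
    qed
    then show ?thesis ..
  qed
qed

text \<open>The vector x with x^2 nonzero splits off orthogonally, and p = x^2 lies in the radical.
  What is left is a form on a plane spanned by y and z, treated according to whether it has a
  nonzero diagonal entry, only an off-diagonal one, or is zero.\<close>

lemma nonalternating_form:
  assumes root: "\<And>c :: 'a. \<exists>k. k * k = c"
    and triple: "\<And>x y z. x \<star> (y \<star> z) = 0"
    and x: "x \<star> x \<noteq> 0" and multiple: "\<And>y z. \<exists>c. y \<star> z = c *s (x \<star> x)"
  shows "realizes S311 \<or> realizes S221_sharp \<or> realizes U2_4"
proof -
  define p where "p = x \<star> x"
  have p0: "p \<noteq> 0" using x by (simp add: p_def)
  have xp: "x \<star> p = 0" by (simp add: p_def triple)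
  obtain y0 where y0: "y0 \<notin> span {x, p, p}" using not_span3 by blast
  obtain z0 where z0: "z0 \<notin> span {x, p, y0}" using not_span3 by blast
  \<comment> \<open>If x were c p, then p = x x would equal c (x p), which is zero.\<close>
  have "independent {x, p} \<and> x \<noteq> p"
  proof -
    have "x \<notin> span {p}"
    proof
      assume "x \<in> span {p}"
      then obtain c where "x = c *s p" by (auto simp: span_breakdown_eq)
      then have "p = c *s (x \<star> p)" by (metis p_def mul_scale_right)
      then show False using xp p0 by simp
    qed
    then show ?thesis using p0 by (auto simp: independent_insert intro: span_base)
  qed
  moreover have "y0 \<notin> span {x, p}" "y0 \<noteq> x" "y0 \<noteq> p" using y0 by (auto intro: span_base)
  moreover have "z0 \<notin> span {y0, x, p}" "z0 \<noteq> x" "z0 \<noteq> p" "z0 \<noteq> y0"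
    using z0 by (auto simp: insert_commute intro: span_base)
  ultimately have "independent {z0, y0, x, p} \<and> card {z0, y0, x, p} = 4"
    by (simp add: independent_insert[of z0] independent_insert[of y0])
  then have "span {z0, y0, x, p} = UNIV"
    using card_eq_dim[of "{z0, y0, x, p}" UNIV] card_Basis by auto
  obtain b where b: "x \<star> y0 = b *s p" using multiple p_def by blast
  obtain c where c: "x \<star> z0 = c *s p" using multiple p_def by blast
  \<comment> \<open>Projection onto the orthogonal complement of x, using x x = p.\<close>
  define y where "y = y0 - b *s x"
  define z where "z = z0 - c *s x"
  have xy: "x \<star> y = 0" and xz: "x \<star> z = 0"
    using b c by (simp_all add: y_def z_def mul_bilinear p_def)
  have span: "span {x, p, y, z} = UNIV"
  proof (rule span_UNIV_trans[OF \<open>span {z0, y0, x, p} = UNIV\<close>])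
    have "y + b *s x \<in> span {x, p, y, z}" "z + c *s x \<in> span {x, p, y, z}"
      by (auto intro!: span_add span_scale intro: span_base)
    then show "{z0, y0, x, p} \<subseteq> span {x, p, y, z}" by (auto simp: y_def z_def intro: span_base)
  qed
  obtain a where yy: "y \<star> y = a *s p" using multiple p_def by blast
  obtain d where yz: "y \<star> z = d *s p" using multiple p_def by blast
  obtain e where zz: "z \<star> z = e *s p" using multiple p_def by blast
  consider "a \<noteq> 0" | "e \<noteq> 0" | "a = 0" "e = 0" "d \<noteq> 0" | "a = 0" "e = 0" "d = 0" by blast
  then show ?thesis
  proof cases
    case 1
    then show ?thesis
      using diagonal_form[OF root triple span p_def[symmetric] xy xz yy yz zz] by blast
  next
    case 2
    have "span {x, p, z, y} = UNIV" using span by (simp add: insert_commute)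
    moreover have "z \<star> y = d *s p" using yz mul_commute by metis
    ultimately show ?thesis
      using diagonal_form[OF root triple _ p_def[symmetric] xz xy zz _ yy] 2 by blast
  next
    \<comment> \<open>Here y and z are isotropic with y z nonzero: after scaling z they are already
      the hyperbolic pair of \<open>U2_4\<close>.\<close>
    case 3
    have "span {x, y, inverse d *s z, p} = UNIV"
    proof (rule span_UNIV_trans[OF span])
      have "d *s (inverse d *s z) \<in> span {x, y, inverse d *s z, p}"
        by (rule span_scale) (auto intro: span_base)
      then show "{x, p, y, z} \<subseteq> span {x, y, inverse d *s z, p}" using 3 by (auto intro: span_base)
    qed
    then have "realizes U2_4"
      by (rule realizes_class2(2)[OF _ triple])
        (use 3 xy xz yy yz zz in \<open>simp_all add: mul_bilinear p_def\<close>)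
    then show ?thesis by blast
  next
    case 4
    then have "realizes S311"
      by (intro realizes_class2(4)[OF span triple]) (use xy xz yy yz zz in \<open>simp_all add: p_def triple\<close>)
    then show ?thesis by blast
  qed
qed

text \<open>All squares vanish, so u and v span a hyperbolic plane. Its complement in a space of
  dimension four consists of p, which is in the radical, and one more vector, whose square is zero
  as well.\<close>

lemma alternating_form:
  assumes triple: "\<And>x y z. x \<star> (y \<star> z) = 0"
    and uv: "u \<star> v \<noteq> 0" and multiple: "\<And>y z. \<exists>c. y \<star> z = c *s (u \<star> v)"
    and square: "\<And>x. x \<star> x = 0"
  shows "realizes Char_two" and "CHAR('a) = 2"
proof -
  define p where "p = u \<star> v"
  have p0: "p \<noteq> 0" using uv by (simp add: p_def)
  \<comment> \<open>Expanding (u + v)^2 = 0 leaves u v + v u = 2 p, and so 2 = 0 in the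
    field.\<close>
  have "u \<star> (u + v) + v \<star> (u + v) = 0" using mul_add_left[of u v "u + v"] square by simp
  then have "p + p = 0" by (simp add: p_def mul_add_right square mul_commute[of v u])
  then have "(1 + 1) *s p = 0" by (simp only: scale_left_distrib scale_one)
  then have two: "(2 :: 'a) = 0" using p0 by simp
  then have "CHAR('a) dvd 2" using of_nat_eq_0_iff_char_dvd[where ?'a = 'a and n = 2] by simp
  then have "0 < CHAR('a)" "CHAR('a) \<le> 2" using dvd_pos_nat[of 2] dvd_imp_le[of _ 2] by auto
  then show "CHAR('a) = 2" using CHAR_not_1[where ?'a = 'a] by linarith
  obtain y0 where y0: "y0 \<notin> span {u, v, p}" using not_span3 by blast
  obtain a where a: "y0 \<star> u = a *s p" using multiple p_def by blast
  obtain b where b: "y0 \<star> v = b *s p" using multiple p_def by blast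
  \<comment> \<open>The coefficients cross over, since u pairs with v and not with itself.\<close>
  define y where "y = y0 - (a *s v + b *s u)"
  have yu: "u \<star> y = 0" and yv: "v \<star> y = 0"
    using a b by (simp_all add: y_def mul_bilinear square mul_commute[of _ y0] mul_commute[of v u] p_def)
  have y: "y \<notin> span {u, v, p}"
  proof
    assume "y \<in> span {u, v, p}"
    then have "y + (a *s v + b *s u) \<in> span {u, v, p}"
      by (intro span_add span_scale) (auto intro: span_base)
    then show False using y0 by (simp add: y_def)
  qed
  have "span {u, v, p, y} = UNIV"
  proof (rule span4_UNIV)
    fix q r s t assume *: "q *s u + r *s v + s *s p + t *s y = 0"
    have "(q *s u + r *s v + s *s p + t *s y) \<star> v = q *s p"
      "(q *s u + r *s v + s *s p + t *s y) \<star> u = r *s p"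
      using yu yv triple by (simp_all add: mul_bilinear square p_def mul_commute[of v u] mul_commute[of y] mul_assoc)
    then have qr: "q = 0" "r = 0" using * p0 by simp_all
    have t: "t = 0"
    proof (rule ccontr)
      assume "t \<noteq> 0"
      then have "y = inverse t *s (t *s y)" by simp
      also have "t *s y = - s *s p" using * qr by (simp add: eq_neg_iff_add_eq_0 add.commute)
      also have "inverse t *s (- s *s p) \<in> span {u, v, p}" by (intro span_scale span_base) auto
      finally show False using y by simp
    qed
    then show "q = 0 \<and> r = 0 \<and> s = 0 \<and> t = 0" using * qr p0 by simp
  qed
  then show "realizes Char_two"
    by (rule realizes_class2(6)[OF _ triple]) (use yu yv square in \<open>simp_all add: p_def\<close>)
qed

theorem realizes_label:
  assumes root: "\<And>b c :: 'a. \<exists>k. k * k = b * k + c"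
  shows "\<exists>l\<in>labels TYPE('a). realizes l"
proof -
  have sqrt: "\<exists>k. k * k = c" for c :: 'a using root[of 0 c] by simp
  show ?thesis
  proof (cases "\<exists>x. x \<star> (x \<star> x) \<noteq> 0")
    case True
    then have "realizes S5 \<or> realizes S41 \<or> realizes S32_sharp"
      using fourth_power_nonzero third_power_nonzero[OF sqrt] by metis
    then show ?thesis by (auto simp: labels_def indecomposable_labels_def decomposable_labels_def)
  next
    case False
    then have triple: "x \<star> (y \<star> z) = 0" for x y z using triple_products_zero by blast
    show ?thesis
    proof (cases "\<exists>p. \<forall>x y. \<exists>c. x \<star> y = c *s p")
      case False
      then have "realizes S32 \<or> realizes U1_4"
        using two_generator_products[OF root triple] by blast
      then show ?thesis by (auto simp: labels_def indecomposable_labels_def decomposable_labels_def)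
    next
      case True
      then obtain p where p: "\<And>x y. \<exists>c. x \<star> y = c *s p" by blast
      \<comment> \<open>Any nonzero product may replace p as generator of the line that contains all
        products.\<close>
      have multiple: "\<exists>c. y \<star> z = c *s (u \<star> v)" if "u \<star> v \<noteq> 0" for u v y z
      proof -
        obtain c where c: "u \<star> v = c *s p" using p by blast
        obtain d where d: "y \<star> z = d *s p" using p by blast
        have "c \<noteq> 0" using that c by auto
        then have "y \<star> z = (d / c) *s (u \<star> v)" by (simp add: c d)
        then show ?thesis ..
      qed
      consider x where "x \<star> x \<noteq> 0" | u v where "\<And>x. x \<star> x = 0" "u \<star> v \<noteq> 0" | "\<And>x y. x \<star> y = 0" by blast
      then show ?thesis
      proof cases
        case 1
        then have "realizes S311 \<or> realizes S221_sharp \<or> realizes U2_4"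
          using nonalternating_form[OF sqrt triple] multiple by blast
        then show ?thesis by (auto simp: labels_def indecomposable_labels_def decomposable_labels_def)
      next
        case 2
        then have "realizes Char_two" "CHAR('a) = 2"
          using alternating_form[OF triple, of u v] multiple by blast+
        then show ?thesis by (auto simp: labels_def decomposable_labels_def)
      next
        case 3
        obtain n1 n2 n3 n4 where "Basis = {n1, n2, n3, n4}"
          using card_Basis by (auto simp: numeral_eq_Suc card_Suc_eq)
        then have "span {n1, n2, n3, n4} = UNIV" using span_Basis by simp
        then have "realizes S2111"
          by (rule realizesI, clarify) (simp add: 3)
        then show ?thesis by (auto simp: labels_def decomposable_labels_def)
      qed
    qed
  qed
qed

end

section \<open>Affine matrices and abelian regular subgroups\<close>

definition quad_vec :: "'a quad \<Rightarrow> 'a vec" where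
  "quad_vec = (\<lambda>(a, b, c, d). vec 4 (\<lambda>i. [a, b, c, d] ! i))"

definition quad_scale :: "'a::field \<Rightarrow> 'a quad \<Rightarrow> 'a quad" where
  "quad_scale k = (\<lambda>(a, b, c, d). (k * a, k * b, k * c, k * d))"

definition quad_basis :: "'a::field quad set" where
  "quad_basis = {(1, 0, 0, 0), (0, 1, 0, 0), (0, 0, 1, 0), (0, 0, 0, 1)}"

definition affine :: "'a::field mat \<Rightarrow> bool" where
  "affine M \<longleftrightarrow> M \<in> carrier_mat 5 5 \<and> col M 0 = unit_vec 5 0"

definition translation :: "'a::field mat \<Rightarrow> 'a quad" where
  "translation M = (M $$ (0, 1), M $$ (0, 2), M $$ (0, 3), M $$ (0, 4))"

text \<open>The linear part acts on row vectors from the right, which is why products of matrices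
  compose in reverse order in \<open>affine_mult\<close>.\<close>

definition lin :: "'a::field mat \<Rightarrow> 'a quad \<Rightarrow> 'a quad" where
  "lin M = (\<lambda>(a, b, c, d). let f = (\<lambda>j. a * M $$ (1, j) + b * M $$ (2, j) + c * M $$ (3, j) + d * M $$ (4, j))
     in (f 1, f 2, f 3, f 4))"

text \<open>The lower rows are the images of the standard basis vectors, so a linear map is turned
  into a matrix by naming n1, ..., n4.\<close>

definition affine_mat :: "'a::field quad \<Rightarrow> 'a quad \<Rightarrow> 'a quad \<Rightarrow> 'a quad \<Rightarrow> 'a quad \<Rightarrow> 'a mat" where
  "affine_mat t n1 n2 n3 n4 = (case (t, n1, n2, n3, n4) of
     ((t1, t2, t3, t4), (a1, a2, a3, a4), (b1, b2, b3, b4), (c1, c2, c3, c4), (d1, d2, d3, d4)) \<Rightarrow>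
     mat_of_rows_list 5 [[1, t1, t2, t3, t4], [0, a1, a2, a3, a4], [0, b1, b2, b3, b4],
       [0, c1, c2, c3, c4], [0, d1, d2, d3, d4]])"

definition rep_quad :: "label \<Rightarrow> 'a::field quad \<Rightarrow> 'a mat" where
  "rep_quad l = (\<lambda>(x1, x2, x3, x4). rep_mat l x1 x2 x3 x4)"

lemma less_5: "i < 5 \<longleftrightarrow> i = 0 \<or> i = 1 \<or> i = 2 \<or> i = 3 \<or> i = (4::nat)"
  by auto

lemma less_4: "i < 4 \<longleftrightarrow> i = 0 \<or> i = 1 \<or> i = 2 \<or> i = (3::nat)"
  by auto

lemma all_less_5: "(\<forall>i<5. P i) \<longleftrightarrow> P 0 \<and> P 1 \<and> P 2 \<and> P 3 \<and> P (4::nat)"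
  by (auto simp: less_5)

lemma affine_iff:
  "affine M \<longleftrightarrow> M \<in> carrier_mat 5 5 \<and> M $$ (0, 0) = 1 \<and> M $$ (1, 0) = 0 \<and> M $$ (2, 0) = 0
     \<and> M $$ (3, 0) = 0 \<and> M $$ (4, 0) = 0"
proof -
  have "col M 0 = unit_vec 5 0 \<longleftrightarrow> (\<forall>i<5. M $$ (i, 0) = (if i = 0 then 1 else 0))"
    if "M \<in> carrier_mat 5 5"
    using that by (auto simp: vec_eq_iff)
  then show ?thesis by (auto simp: affine_def all_less_5)
qed

lemma mult_entry:
  assumes "A \<in> carrier_mat 5 5" "B \<in> carrier_mat 5 5" "i < 5" "j < 5"
  shows "(A * B) $$ (i, j) = A $$ (i, 0) * B $$ (0, j) + A $$ (i, 1) * B $$ (1, j)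
    + A $$ (i, 2) * B $$ (2, j) + A $$ (i, 3) * B $$ (3, j) + A $$ (i, 4) * (B $$ (4, j) :: 'a::field)"
proof -
  have "{0..<5} = {0, 1, 2, 3, 4::nat}" by auto
  then show ?thesis using assms by (simp add: scalar_prod_def add.assoc)
qed

lemma affine_mult:
  assumes "affine A" "affine B"
  shows "affine (A * B)" "translation (A * B) = translation B + lin B (translation A)" "lin (A * B) v = lin B (lin A v)"
proof -
  have A: "A \<in> carrier_mat 5 5" and B: "B \<in> carrier_mat 5 5"
    using assms by (auto simp: affine_def)
  note e = mult_entry[OF A B]
  show "affine (A * B)" using assms A B by (simp add: affine_iff e del: index_mult_mat(1))
  show "translation (A * B) = translation B + lin B (translation A)"
    using assms by (simp add: affine_iff translation_def lin_def Let_def e del: index_mult_mat(1))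
  show "lin (A * B) v = lin B (lin A v)"
    using assms by (cases v) (simp add: affine_iff lin_def Let_def e algebra_simps del: index_mult_mat(1))
qed

lemma affine_one: "affine (1\<^sub>m 5)" "translation (1\<^sub>m 5) = 0" "lin (1\<^sub>m 5) v = v"
  by (cases v; simp add: affine_iff translation_def lin_def zero_prod_def)+

lemma affine_eqI:
  assumes "affine A" "affine B" "translation A = translation B" "\<And>v. lin A v = lin B v"
  shows "A = B"
proof (rule eq_matI)
  fix i j assume "i < dim_row B" "j < dim_col B"
  then have "i < 5" "j < 5" using assms by (auto simp: affine_def)
  then show "A $$ (i, j) = B $$ (i, j)"
    using assms(1-3) assms(4)[of "(1, 0, 0, 0)"] assms(4)[of "(0, 1, 0, 0)"]
      assms(4)[of "(0, 0, 1, 0)"] assms(4)[of "(0, 0, 0, 1)"]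
    unfolding less_5 affine_iff translation_def lin_def Let_def by (elim disjE; simp)
qed (use assms in \<open>auto simp: affine_def\<close>)

lemma affine_affine_mat:
  "affine (affine_mat t n1 n2 n3 n4)" "translation (affine_mat t n1 n2 n3 n4) = t"
  "lin (affine_mat t n1 n2 n3 n4) (a, b, c, d)
    = quad_scale a n1 + quad_scale b n2 + quad_scale c n3 + quad_scale d n4"
proof -
  obtain t1 t2 t3 t4 where t: "t = (t1, t2, t3, t4)" by (cases t)
  obtain a1 a2 a3 a4 where n1: "n1 = (a1, a2, a3, a4)" by (cases n1)
  obtain b1 b2 b3 b4 where n2: "n2 = (b1, b2, b3, b4)" by (cases n2)
  obtain c1 c2 c3 c4 where n3: "n3 = (c1, c2, c3, c4)" by (cases n3)
  obtain d1 d2 d3 d4 where n4: "n4 = (d1, d2, d3, d4)" by (cases n4)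
  have "affine_mat t n1 n2 n3 n4 \<in> carrier_mat 5 5"
    by (rule carrier_matI) (simp_all add: t n1 n2 n3 n4 affine_mat_def mat_of_rows_list_def)
  then show "affine (affine_mat t n1 n2 n3 n4)" "translation (affine_mat t n1 n2 n3 n4) = t"
    by (simp_all add: t n1 n2 n3 n4 affine_iff affine_mat_def mat_of_rows_list_def translation_def)
  show "lin (affine_mat t n1 n2 n3 n4) (a, b, c, d)
      = quad_scale a n1 + quad_scale b n2 + quad_scale c n3 + quad_scale d n4"
    by (simp add: t n1 n2 n3 n4 affine_mat_def mat_of_rows_list_def lin_def Let_def quad_scale_def)
qed

lemma lin_linear:
  "lin M (v + w) = lin M v + lin M w" "lin M (v - w) = lin M v - lin M w"
  "lin M (quad_scale k v) = quad_scale k (lin M v)" "lin M 0 = 0"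
  by (cases v; cases w; simp add: lin_def quad_scale_def zero_prod_def algebra_simps)+

lemma quad_vec_row:
  assumes "affine M"
  shows "row M 0 = vCons 1 (quad_vec t) \<longleftrightarrow> translation M = t"
proof -
  obtain a b c d where t: "t = (a, b, c, d)" by (cases t)
  have v: "quad_vec t \<in> carrier_vec 4"
    by (simp add: t quad_vec_def)
  have "row M 0 = vCons 1 (quad_vec t) \<longleftrightarrow> (\<forall>i<5. row M 0 $ i = vCons 1 (quad_vec t) $ i)"
    using assms v by (auto simp: vec_eq_iff affine_def)
  also have "\<dots> \<longleftrightarrow> translation M = t"
    using assms by (auto simp: all_less_5 affine_iff translation_def t quad_vec_def vec_index_vCons)
  finally show ?thesis .
qed

lemma quad_vec_surj: "carrier_vec 4 = range (quad_vec :: 'a quad \<Rightarrow> 'a vec)"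
proof -
  have "v = quad_vec (v $ 0, v $ 1, v $ 2, v $ 3)" if "v \<in> carrier_vec 4" for v :: "'a vec"
    using that by (auto simp: vec_eq_iff less_4 quad_vec_def)
  moreover have "quad_vec t \<in> carrier_vec 4" for t :: "'a quad"
    by (cases t) (simp add: quad_vec_def)
  ultimately show ?thesis by blast
qed

section \<open>The affine group in these coordinates\<close>

lemma GL_group: "group (GL TYPE('a::field) n)"
  unfolding GL_def
  by (intro monoid.units_group) (rule ring.is_monoid, rule ring_mat)

text \<open>The first column of M is M applied to the first unit vector. The defining condition
  therefore describes a stabiliser, closed under products and inverses.\<close>

lemma AGL_group: "group (AGL TYPE('a::field) n)"
proof -
  interpret G: group "GL TYPE('a) (Suc n)" by (rule GL_group)
  have mult: "M \<otimes>\<^bsub>GL TYPE('a) (Suc n)\<^esub> N = M * N" for M N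
    by (simp add: GL_def units_of_def ring_mat_def)
  have one: "\<one>\<^bsub>GL TYPE('a) (Suc n)\<^esub> = 1\<^sub>m (Suc n)"
    by (simp add: GL_def units_of_def ring_mat_def)
  have carr: "M \<in> carrier_mat (Suc n) (Suc n)" if "M \<in> carrier (GL TYPE('a) (Suc n))" for M
    using that by (auto simp: GL_def units_of_def Units_def ring_mat_def)
  have col: "col M 0 = M *\<^sub>v unit_vec (Suc n) 0" if "M \<in> carrier_mat (Suc n) (Suc n)" for M :: "'a mat"
    using that by (intro eq_vecI) auto
  have "subgroup {M \<in> carrier (GL TYPE('a) (Suc n)). col M 0 = unit_vec (Suc n) 0} (GL TYPE('a) (Suc n))"
  proof (rule G.subgroupI)
    show "{M \<in> carrier (GL TYPE('a) (Suc n)). col M 0 = unit_vec (Suc n) 0} \<noteq> {}"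
    proof -
      have "1\<^sub>m (Suc n) \<in> {M \<in> carrier (GL TYPE('a) (Suc n)). col M 0 = unit_vec (Suc n) 0}"
        using G.one_closed unfolding one by simp
      then show ?thesis by blast
    qed
  next
    fix M assume M: "M \<in> {M \<in> carrier (GL TYPE('a) (Suc n)). col M 0 = unit_vec (Suc n) 0}"
    define N where "N = inv\<^bsub>GL TYPE('a) (Suc n)\<^esub> M"
    have N: "N \<in> carrier (GL TYPE('a) (Suc n))" "N * M = 1\<^sub>m (Suc n)"
      using M G.l_inv[of M] by (auto simp: N_def mult one)
    have "col N 0 = N *\<^sub>v (M *\<^sub>v unit_vec (Suc n) 0)"
      using M col carr N(1) by auto
    also have "\<dots> = (N * M) *\<^sub>v unit_vec (Suc n) 0"
      using M carr N(1)
      by (auto intro!: assoc_mult_mat_vec[symmetric, where ?n\<^sub>1 = "Suc n" and ?n\<^sub>2 = "Suc n" and ?n\<^sub>3 = "Suc n"])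
    also have "\<dots> = unit_vec (Suc n) 0" by (simp add: N(2))
    finally show "inv\<^bsub>GL TYPE('a) (Suc n)\<^esub> M
        \<in> {M \<in> carrier (GL TYPE('a) (Suc n)). col M 0 = unit_vec (Suc n) 0}"
      using N by (simp add: N_def)
  next
    fix M N
    assume M: "M \<in> {M \<in> carrier (GL TYPE('a) (Suc n)). col M 0 = unit_vec (Suc n) 0}"
      and N: "N \<in> {M \<in> carrier (GL TYPE('a) (Suc n)). col M 0 = unit_vec (Suc n) 0}"
    have "col (M * N) 0 = (M * N) *\<^sub>v unit_vec (Suc n) 0"
      using M N carr by (intro col mult_carrier_mat[where n = "Suc n"]) auto
    also have "\<dots> = M *\<^sub>v (N *\<^sub>v unit_vec (Suc n) 0)"
      using M N carr
      by (auto intro!: assoc_mult_mat_vec[where ?n\<^sub>1 = "Suc n" and ?n\<^sub>2 = "Suc n" and ?n\<^sub>3 = "Suc n"])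
    also have "\<dots> = unit_vec (Suc n) 0" using M N col carr by auto
    finally show "M \<otimes>\<^bsub>GL TYPE('a) (Suc n)\<^esub> N
        \<in> {M \<in> carrier (GL TYPE('a) (Suc n)). col M 0 = unit_vec (Suc n) 0}"
      using M N G.m_closed[of M N] by (simp add: mult)
  qed auto
  then show ?thesis unfolding AGL_def Suc_eq_plus1[symmetric] by (rule G.subgroup_imp_group)
qed

lemma AGL_simps:
  "M \<otimes>\<^bsub>AGL TYPE('a::field) 4\<^esub> N = M * N" "\<one>\<^bsub>AGL TYPE('a) 4\<^esub> = 1\<^sub>m 5"
  by (simp_all add: AGL_def GL_def units_of_def ring_mat_def)

lemma AGL_carrier:
  "carrier (AGL TYPE('a::field) 4) = {M. affine M \<and> (\<exists>N. affine N \<and> N * M = 1\<^sub>m 5 \<and> M * N = 1\<^sub>m 5)}"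
proof -
  interpret G: group "AGL TYPE('a) 4" by (rule AGL_group)
  have aff: "affine M" if "M \<in> carrier (AGL TYPE('a) 4)" for M
    using that by (auto simp: AGL_def GL_def units_of_def Units_def ring_mat_def affine_def)
  show ?thesis
  proof (rule Set.set_eqI, rule iffI)
    fix M :: "'a mat"
    assume M: "M \<in> carrier (AGL TYPE('a) 4)"
    have "inv\<^bsub>AGL TYPE('a) 4\<^esub> M * M = 1\<^sub>m 5" "M * inv\<^bsub>AGL TYPE('a) 4\<^esub> M = 1\<^sub>m 5"
      using G.l_inv[OF M] G.r_inv[OF M] by (simp_all add: AGL_simps)
    then show "M \<in> {M. affine M \<and> (\<exists>N. affine N \<and> N * M = 1\<^sub>m 5 \<and> M * N = 1\<^sub>m 5)}"
      using aff M by blast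
  next
    fix M :: "'a mat"
    assume "M \<in> {M. affine M \<and> (\<exists>N. affine N \<and> N * M = 1\<^sub>m 5 \<and> M * N = 1\<^sub>m 5)}"
    then show "M \<in> carrier (AGL TYPE('a) 4)"
      by (auto simp: AGL_def GL_def units_of_def Units_def ring_mat_def affine_def)
  qed
qed

lemma AGL_inv:
  assumes "affine M" "affine N" "N * M = 1\<^sub>m 5" "M * N = (1\<^sub>m 5 :: 'a::field mat)"
  shows "inv\<^bsub>AGL TYPE('a) 4\<^esub> M = N"
proof -
  interpret G: group "AGL TYPE('a) 4" by (rule AGL_group)
  show ?thesis by (rule G.inv_equality) (use assms in \<open>auto simp: AGL_simps AGL_carrier\<close>)
qed

lemma regular_subgroup_iff:
  "regular_subgroup 4 R \<longleftrightarrow> subgroup R (AGL TYPE('a::field) 4) \<and> (\<forall>t. \<exists>!M. M \<in> R \<and> translation M = t)"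
proof -
  have "row M 0 = vCons 1 (quad_vec t) \<longleftrightarrow> translation M = t"
    if "subgroup R (AGL TYPE('a) 4)" "M \<in> R" for M t
    using subgroup.subset[OF that(1)] that(2) by (intro quad_vec_row) (auto simp: AGL_carrier)
  then show ?thesis
    unfolding regular_subgroup_def quad_vec_surj by (auto cong: conj_cong)
qed

section \<open>From multiplication tables to regular groups\<close>

lemma rep_range: "rep l = range (rep_quad l)"
  by (force simp: rep_def rep_quad_def image_def)

text \<open>The entries of the ten matrices are inspected here. Later arguments reach them through
  \<open>affine_rep\<close> and \<open>lin_rep\<close>: first row x, linear part v + v x.\<close>

lemma rep_quad_affine_mat:
  "rep_quad l x = affine_mat x ((1, 0, 0, 0) + table l (1, 0, 0, 0) x) ((0, 1, 0, 0) + table l (0, 1, 0, 0) x)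
    ((0, 0, 1, 0) + table l (0, 0, 1, 0) x) ((0, 0, 0, 1) + table l (0, 0, 0, 1) x)"
  by (cases x; cases l) (simp_all add: rep_quad_def affine_mat_def)

lemma affine_rep: "affine (rep_quad l x)" "translation (rep_quad l x) = x"
  unfolding rep_quad_affine_mat by (rule affine_affine_mat)+

lemma lin_rep: "lin (rep_quad l x) v = v + table l v x"
  unfolding rep_quad_affine_mat
  by (cases v; cases x; cases l) (simp_all add: affine_affine_mat(3) quad_scale_def algebra_simps)

lemma table_bilinear:
  "table l (x + y) z = table l x z + table l y z" "table l z (x + y) = table l z x + table l z y"
  "table l (quad_scale k x) z = quad_scale k (table l x z)" "table l z (quad_scale k x) = quad_scale k (table l z x)"
  by (cases x; cases y; cases z; cases l; simp add: quad_scale_def algebra_simps)+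

lemma table_commute: "table l x y = table l y x"
  by (cases x; cases y; cases l; simp add: algebra_simps)

lemma table_assoc: "table l (table l x y) z = table l x (table l y z)"
  by (cases x; cases y; cases z; cases l; simp add: algebra_simps)

lemma table_zero [simp]: "table l 0 x = 0" "table l x 0 = 0"
  using table_bilinear(1)[of l 0 0 x] table_bilinear(2)[of l x 0 0] by simp_all

lemma table_uminus_right: "table l x (- y) = - table l x y"
  using table_bilinear(2)[of l x y "- y"] by (simp add: eq_neg_iff_add_eq_0 add.commute)

text \<open>The geometric series stops because fifth powers vanish.\<close>

lemma table_quasi_inverse: "\<exists>y. x + y + table l x y = 0"
proof -
  define t where "t = table l x"
  have "t (t (t (t x))) = 0"
    by (cases x; cases l; simp add: t_def zero_prod_def)
  moreover have "t (a + b) = t a + t b" "t (- a) = - t a" "t (a - b) = t a - t b" for a b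
    using table_bilinear(2)[of l x a "- b"] by (simp_all add: t_def table_bilinear(2) table_uminus_right)
  ultimately have "x + (- x + t x + - t (t x) + t (t (t x))) + t (- x + t x + - t (t x) + t (t (t x))) = 0"
    by simp
  then show ?thesis unfolding t_def by blast
qed

text \<open>The circle operation x + y + x y of the algebra, coming from (1 + x)(1 + y).
  Associativity of the table gives the linear parts, its definition the translations.\<close>

lemma rep_quad_mult: "rep_quad l x * rep_quad l y = rep_quad l (x + y + table l x y)"
  by (rule affine_eqI)
    (simp_all add: affine_mult affine_rep lin_rep table_bilinear table_assoc add_ac)

lemma rep_quad_zero: "rep_quad l 0 = 1\<^sub>m 5"
  by (rule affine_eqI) (simp_all add: affine_rep lin_rep affine_one)

lemma rep_quad_inverse:
  obtains y where "rep_quad l x * rep_quad l y = 1\<^sub>m 5" "rep_quad l y * rep_quad l x = 1\<^sub>m 5"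
proof -
  obtain y where y: "x + y + table l x y = 0" using table_quasi_inverse by blast
  then have "y + x + table l y x = 0" by (simp add: add.commute table_commute[of l y x])
  then show ?thesis using that[of y] y by (simp only: rep_quad_mult rep_quad_zero)
qed

lemma rep_subset_AGL: "rep l \<subseteq> carrier (AGL TYPE('a::field) 4)"
proof
  fix M :: "'a mat" assume "M \<in> rep l"
  then obtain x where M: "M = rep_quad l x" by (auto simp: rep_range)
  obtain y where "rep_quad l x * rep_quad l y = 1\<^sub>m 5" "rep_quad l y * rep_quad l x = 1\<^sub>m 5"
    by (rule rep_quad_inverse)
  then show "M \<in> carrier (AGL TYPE('a) 4)" using affine_rep(1)[of l x] affine_rep(1)[of l y] M
    by (auto simp: AGL_carrier)
qed

lemma abelian_regular_rep: "abelian_regular_subgroup 4 (rep l :: 'a::field mat set)"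
proof -
  interpret G: group "AGL TYPE('a) 4" by (rule AGL_group)
  have sub: "subgroup (rep l) (AGL TYPE('a) 4)"
  proof (rule G.subgroupI)
    show "rep l \<noteq> {}" by (auto simp: rep_range)
  next
    fix M :: "'a mat" assume "M \<in> rep l"
    then obtain x where "M = rep_quad l x" by (auto simp: rep_range)
    moreover obtain y where "rep_quad l x * rep_quad l y = 1\<^sub>m 5" "rep_quad l y * rep_quad l x = 1\<^sub>m 5"
      by (rule rep_quad_inverse)
    ultimately show "inv\<^bsub>AGL TYPE('a) 4\<^esub> M \<in> rep l"
      using AGL_inv[OF affine_rep(1)[of l x] affine_rep(1)[of l y]] by (simp add: rep_range)
  qed (use rep_subset_AGL in \<open>auto simp: rep_range AGL_simps rep_quad_mult\<close>)
  then interpret H: group "(AGL TYPE('a) 4)\<lparr>carrier := rep l\<rparr>" by (rule G.subgroup_imp_group)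
  have "comm_group ((AGL TYPE('a) 4)\<lparr>carrier := rep l\<rparr>)"
    by (rule H.group_comm_groupI) (auto simp: AGL_simps rep_range rep_quad_mult table_commute add_ac)
  moreover have "\<exists>!M. M \<in> rep l \<and> translation M = t" for t :: "'a quad"
    by (auto simp: rep_range affine_rep intro!: ex1I[of _ "rep_quad l t"])
  ultimately show ?thesis
    using sub by (simp add: abelian_regular_subgroup_def regular_subgroup_iff)
qed

lemma quad_vector_space: "vector_space (quad_scale :: 'a::field \<Rightarrow> _)"
  by unfold_locales (auto simp: quad_scale_def algebra_simps)

lemma quad_decomp:
  "(a, b, c, d) = quad_scale a (1, 0, 0, 0) + quad_scale b (0, 1, 0, 0) + quad_scale c (0, 0, 1, 0)
    + quad_scale d (0, 0, 0, 1)"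
  by (simp add: quad_scale_def)

lemma quad_finite_dimensional: "finite_dimensional_vector_space (quad_scale :: 'a::field \<Rightarrow> _) quad_basis"
proof -
  interpret V: vector_space "quad_scale :: 'a \<Rightarrow> _" by (rule quad_vector_space)
  have scale: "quad_scale a (b, c, d, e) = (a * b, a * c, a * d, a * e)" for a b c d e :: 'a
    by (simp add: quad_scale_def)
  show ?thesis
  proof unfold_locales
    show "finite (quad_basis :: 'a quad set)" by (simp add: quad_basis_def)
    show "V.independent quad_basis"
      unfolding quad_basis_def
      by (simp add: V.independent_insert V.span_breakdown_eq scale zero_prod_def)
    show "V.span quad_basis = UNIV"
    proof -
      have "(a, b, c, d) \<in> V.span quad_basis" for a b c d :: 'a
        unfolding quad_decomp[of a b c d]
        by (intro V.span_add V.span_scale V.span_base) (auto simp: quad_basis_def)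
      then show ?thesis by auto
    qed
  qed
qed

section \<open>From an abelian regular subgroup to its algebra\<close>

locale abelian_regular =
  fixes R :: "'a::field mat set"
  assumes abelian_regular: "abelian_regular_subgroup 4 R"
begin

definition elt :: "'a quad \<Rightarrow> 'a mat" where
  "elt t = (THE M. M \<in> R \<and> translation M = t)"

text \<open>The first argument is the vector acted upon, so linearity in it is immediate. Linearity
  in \<open>u\<close>, which enters through the choice of a group element, has to wait for
  commutativity.\<close>

definition star :: "'a quad \<Rightarrow> 'a quad \<Rightarrow> 'a quad" where
  "star t u = lin (elt u) t - t"

lemma subgroup_R: "subgroup R (AGL TYPE('a) 4)"
  and ex1: "\<exists>!M. M \<in> R \<and> translation M = t"
  using abelian_regular unfolding abelian_regular_subgroup_def regular_subgroup_iff by blast+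

lemma elt: "elt t \<in> R" "translation (elt t) = t"
  using theI'[OF ex1[of t]] by (auto simp: elt_def)

lemma elt_unique: "M \<in> R \<Longrightarrow> elt (translation M) = M"
  using ex1 elt by blast

lemma R_elt: "R = range elt"
  using elt elt_unique by (metis (no_types, lifting) Set.set_eqI rangeE rangeI)

lemma elt_AGL: "elt t \<in> carrier (AGL TYPE('a) 4)"
  using subgroup.subset[OF subgroup_R] elt by blast

lemma affine_elt: "affine (elt t)"
  using elt_AGL by (simp add: AGL_carrier)

lemma lin_elt: "lin (elt u) t = t + star t u"
  by (simp add: star_def)

text \<open>A group element is determined by its translation, so it is enough to compute the
  translation of the product.\<close>

lemma elt_mult: "elt t * elt u = elt (t + u + star t u)"
proof -
  have "elt t * elt u \<in> R"
    using subgroup.m_closed[OF subgroup_R] elt by (simp add: AGL_simps)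
  moreover have "translation (elt t * elt u) = t + u + star t u"
    by (simp add: affine_mult affine_elt elt lin_elt add_ac)
  ultimately show ?thesis using elt_unique by metis
qed

text \<open>Commuting elements have products with equal translations t + u + t u and u + t + u t;
  the symmetric part cancels.\<close>

lemma star_commute: "star t u = star u t"
proof -
  have "elt t * elt u = elt u * elt t"
    using abelian_regular comm_groupE(4)[of "(AGL TYPE('a) 4)\<lparr>carrier := R\<rparr>"] elt
    by (simp add: abelian_regular_subgroup_def AGL_simps)
  then have "translation (elt t * elt u) = translation (elt u * elt t)" by simp
  then show ?thesis by (simp add: elt_mult elt add_ac)
qed

lemma star_nil_algebra: "nil_algebra4 quad_scale quad_basis star"
proof -
  interpret finite_dimensional_vector_space "quad_scale :: 'a \<Rightarrow> _" quad_basis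
    by (rule quad_finite_dimensional)
  have add: "star (x + y) z = star x z + star y z" for x y z
    by (simp add: star_def lin_linear)
  have add_right: "star x (y + z) = star x y + star x z" for x y z
    using add[of y z x] by (simp only: star_commute[of x])
  show ?thesis
  proof unfold_locales
    show "card (quad_basis :: 'a quad set) = 4" by (simp add: quad_basis_def)
    show "star x y = star y x" for x y by (rule star_commute)
    show "star (x + y) z = star x z + star y z" for x y z by (rule add)
    show "star (quad_scale c x) y = quad_scale c (star x y)" for c x y
      by (simp add: star_def lin_linear scale_right_diff_distrib)
    \<comment> \<open>Associativity is the comparison of linear parts in \<open>elt_mult\<close>,
      after the right argument y + z + y z has been expanded by additivity.\<close>
    show "star (star x y) z = star x (star y z)" for x y z
    proof -
      have "lin (elt y * elt z) x = lin (elt (y + z + star y z)) x" by (simp add: elt_mult)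
      then have "x + star x y + star (x + star x y) z = x + star x (y + z + star y z)"
        by (simp add: affine_mult affine_elt lin_elt)
      then show ?thesis
        by (simp add: add add_right)
    qed
    \<comment> \<open>If x y = x, then the group element with translation - y sends x to x - x y =
      0, and its invertibility gives x = 0.\<close>
    show "x = 0" if "star x y = x" for x y
    proof -
      have "star y x + star (- y) x = 0"
        using add[of y "- y" x] lin_linear(4)[of "elt x"] by (simp add: star_def)
      then have "lin (elt (- y)) x = 0"
        using that by (simp add: lin_elt star_commute[of x])
      moreover obtain N where "affine N" "elt (- y) * N = 1\<^sub>m 5"
        using elt_AGL[of "- y"] by (auto simp: AGL_carrier)
      ultimately show ?thesis
        using affine_mult(3)[OF affine_elt, of N "- y" x] by (simp add: affine_one lin_linear)
    qed
  qed
qed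

sublocale nil_algebra4 quad_scale quad_basis star
  by (rule star_nil_algebra)

text \<open>The conjugating element is the change of basis itself: an affine matrix without
  translation whose lower rows are the vectors that realise the table.\<close>

lemma conjugate_rep:
  assumes "realizes l"
  shows "conjugate_in (AGL TYPE('a) 4) R (rep l)"
proof -
  obtain n1 n2 n3 n4 where span: "span {n1, n2, n3, n4} = UNIV"
    and table: "\<And>x y. star (comb n1 n2 n3 n4 x) (comb n1 n2 n3 n4 y) = comb n1 n2 n3 n4 (table l x y)"
    using assms unfolding realizes_def by blast
  define c where "c = comb n1 n2 n3 n4"
  have surj: "\<exists>x. c x = v" for v
  proof -
    obtain x1 x2 x3 x4 where "v = quad_scale x1 n1 + quad_scale x2 n2 + quad_scale x3 n3 + quad_scale x4 n4"
      using span in_span4[of v n1 n2 n3 n4] by auto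
    then have "c (x1, x2, x3, x4) = v" by (simp add: c_def)
    then show ?thesis by blast
  qed
  define g where "g = affine_mat 0 n1 n2 n3 n4"
  have g: "affine g" "translation g = 0" by (simp_all add: g_def affine_affine_mat)
  have lin_g: "lin g v = c v" for v by (cases v) (simp add: g_def affine_affine_mat c_def)
  obtain m1 where m1: "c m1 = (1, 0, 0, 0)" using surj by blast
  obtain m2 where m2: "c m2 = (0, 1, 0, 0)" using surj by blast
  obtain m3 where m3: "c m3 = (0, 0, 1, 0)" using surj by blast
  obtain m4 where m4: "c m4 = (0, 0, 0, 1)" using surj by blast
  \<comment> \<open>The inverse of \<open>g\<close>, assembled from preimages of the standard basis
    vectors. A one-sided inverse suffices because the matrices are square.\<close>
  define h where "h = affine_mat 0 m1 m2 m3 m4"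
  have h: "affine h" "translation h = 0" by (simp_all add: h_def affine_affine_mat)
  have hg: "h * g = 1\<^sub>m 5"
  proof (rule affine_eqI)
    fix v :: "'a quad"
    obtain a b d e where v: "v = (a, b, d, e)" by (cases v)
    have "lin (h * g) v = lin g (lin h v)" using g h by (simp add: affine_mult)
    also have "\<dots> = v"
      by (simp add: v h_def affine_affine_mat lin_linear) (simp add: lin_g m1 m2 m3 m4 quad_scale_def)
    finally show "lin (h * g) v = lin (1\<^sub>m 5) v" by (simp add: affine_one)
  qed (use g h in \<open>simp_all add: affine_mult affine_one lin_linear\<close>)
  then have gh: "g * h = 1\<^sub>m 5"
    using mat_mult_left_right_inverse g h by (auto simp: affine_def)
  have inv: "inv\<^bsub>AGL TYPE('a) 4\<^esub> g = h" by (rule AGL_inv) (use g h hg gh in auto)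
  have gG: "g \<in> carrier (AGL TYPE('a) 4)" using g h hg gh by (auto simp: AGL_carrier)
  \<comment> \<open>Stated without inverses, so that translations and linear parts can be compared
    directly; the linear parts agree precisely because \<open>c\<close> turns the table into
    \<open>star\<close>.\<close>
  have intertwine: "g * elt (c x) = rep_quad l x * g" for x
  proof (rule affine_eqI)
    show "lin (g * elt (c x)) v = lin (rep_quad l x * g) v" for v
    proof -
      have "lin (g * elt (c x)) v = c v + star (c v) (c x)"
        by (simp add: affine_mult affine_elt g lin_g lin_elt)
      also have "\<dots> = lin g (v + table l v x)"
        by (simp add: lin_linear lin_g table[folded c_def])
      finally show ?thesis by (simp add: affine_mult affine_rep lin_rep g)
    qed
  qed (simp_all add: affine_mult affine_elt affine_rep g lin_g elt lin_linear)
  have conj: "g * elt (c x) * h = rep_quad l x" for x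
  proof -
    have "g * elt (c x) * h = rep_quad l x * (g * h)"
      using g(1) h(1) affine_rep(1)[of l x]
      by (simp add: intertwine affine_def) (intro assoc_mult_mat; auto)
    then show ?thesis using affine_rep(1)[of l x] by (simp add: gh affine_def right_mult_one_mat[of _ 5 5])
  qed
  have "rep l = {g * M * h | M. M \<in> R}"
  proof -
    have "range c = UNIV" unfolding surj_def using surj by metis
    then have R: "R = (\<lambda>x. elt (c x)) ` UNIV" by (metis R_elt image_image)
    have "{g * M * h | M. M \<in> R} = (\<lambda>M. g * M * h) ` R" by blast
    also have "\<dots> = rep l" by (subst R) (simp only: image_image conj rep_range)
    finally show ?thesis by simp
  qed
  also have "\<dots> = g <#\<^bsub>AGL TYPE('a) 4\<^esub> R #>\<^bsub>AGL TYPE('a) 4\<^esub> inv\<^bsub>AGL TYPE('a) 4\<^esub> g"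
    by (auto simp: inv l_coset_def r_coset_def AGL_simps)
  finally show ?thesis using gG by (auto simp: conjugate_in_def)
qed

end

lemma conjugate_to_rep:
  assumes "abelian_regular_subgroup 4 (R :: 'a::field mat set)" "\<And>b c :: 'a. \<exists>k. k * k = b * k + c"
  shows "\<exists>l\<in>labels TYPE('a). conjugate_in (AGL TYPE('a) 4) R (rep l)"
proof -
  interpret abelian_regular R by unfold_locales (rule assms(1))
  show ?thesis using realizes_label[OF assms(2)] conjugate_rep by blast
qed

section \<open>Invariants of the multiplication tables\<close>

text \<open>The map sends the first row of a group element to the first row of its conjugate. The
  conjugating element may have a translation t, so the map is x + t x followed by a linear part,
  rather than the linear part alone.\<close>

lemma table_isomorphism:
  assumes "conjugate_in (AGL TYPE('a::field) 4) (rep l) (rep l')"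
  obtains f :: "'a::field quad \<Rightarrow> 'a quad" where "bij f" "f 0 = 0" "\<And>x y. table l' (f x) (f y) = f (table l x y)"
proof -
  obtain k where "k \<in> carrier (AGL TYPE('a) 4)"
    and rep: "rep l' = k <#\<^bsub>AGL TYPE('a) 4\<^esub> rep l #>\<^bsub>AGL TYPE('a) 4\<^esub> inv\<^bsub>AGL TYPE('a) 4\<^esub> k"
    using assms by (auto simp: conjugate_in_def)
  then obtain N where k: "affine k" and N: "affine N" and Nk: "N * k = 1\<^sub>m 5" and kN: "k * N = 1\<^sub>m 5"
    by (auto simp: AGL_carrier)
  have inv: "inv\<^bsub>AGL TYPE('a) 4\<^esub> k = N" using AGL_inv k N Nk kN by blast
  have rep': "rep l' = range (\<lambda>x. k * rep_quad l x * N)"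
    unfolding rep inv by (auto simp: l_coset_def r_coset_def AGL_simps rep_range)
  define f where "f x = translation (k * rep_quad l x * N)" for x
  have conj: "k * rep_quad l x * N = rep_quad l' (f x)" for x
  proof -
    have "k * rep_quad l x * N \<in> rep l'" using rep' by blast
    then obtain y where "k * rep_quad l x * N = rep_quad l' y" by (auto simp: rep_range)
    then show ?thesis by (simp add: f_def affine_rep)
  qed
  have carr: "k \<in> carrier_mat 5 5" "N \<in> carrier_mat 5 5" "rep_quad l x \<in> carrier_mat 5 5" for x
    using k N affine_rep(1)[of l x] by (auto simp: affine_def)
  have J: "lin N (lin k v) = v" "lin k (lin N v) = v" for v
    using affine_mult(3)[OF k N, of v] affine_mult(3)[OF N k, of v] by (simp_all add: kN Nk affine_one)
  \<comment> \<open>The translation part of k k^-1 = 1; it removes the constant term from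
    \<open>f\<close>.\<close>
  have w: "translation N + lin N (translation k) = 0"
    using affine_mult(2)[OF k N] by (simp add: kN affine_one)
  have f: "f x = lin N (x + table l (translation k) x)" for x
  proof -
    have "f x = translation N + lin N (translation k) + lin N (x + table l (translation k) x)"
      using k N by (simp add: f_def affine_mult affine_rep lin_rep lin_linear add_ac)
    then show ?thesis by (simp add: w)
  qed
  \<comment> \<open>The linear part of the conjugated element is computed in two ways, directly and
    as the linear part of \<open>rep_quad l' (f x)\<close>.\<close>
  have table: "table l' v (f x) = lin N (table l (lin k v) x)" for v x
  proof -
    have "lin (k * rep_quad l x * N) v = v + table l' v (f x)" by (simp add: conj lin_rep)
    moreover have "lin (k * rep_quad l x * N) v = v + lin N (table l (lin k v) x)"
      using k N by (simp add: affine_mult affine_rep lin_rep lin_linear J)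
    ultimately show ?thesis by simp
  qed
  have "bij f"
  proof (rule bijI)
    show "inj f"
    proof (rule injI)
      fix x y assume "f x = f y"
      then have "k * rep_quad l x * N = k * rep_quad l y * N" by (simp add: conj)
      then have "N * (k * rep_quad l x * N) * k = N * (k * rep_quad l y * N) * k" by simp
      moreover have "N * (k * rep_quad l z * N) * k = rep_quad l z" for z
      proof -
        have "N * (k * rep_quad l z * N) * k = (N * k) * rep_quad l z * (N * k)"
          using carr(1,2) carr(3)[of z] by (simp add: assoc_mult_mat[of _ 5 5 _ 5 _ 5])
        then show ?thesis using carr(1,2) carr(3)[of z] by (simp add: Nk left_mult_one_mat[of _ 5 5] right_mult_one_mat[of _ 5 5])
      qed
      ultimately show "x = y" using affine_rep(2) by metis
    qed
    show "surj f"
      unfolding surj_def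
    proof (rule allI)
      fix y :: "'a quad"
      have "rep_quad l' y \<in> rep l'" by (auto simp: rep_range)
      then obtain x where "rep_quad l' y = k * rep_quad l x * N" using rep' by blast
      then have "y = f x" using affine_rep(2)[of l' y] by (simp add: f_def)
      then show "\<exists>x. y = f x" ..
    qed
  qed
  moreover have "f 0 = 0" by (simp add: f lin_linear)
  \<comment> \<open>Multiplicativity reduces to (x + t x) y = x y + t (x y), which is
    associativity.\<close>
  moreover have "table l' (f x) (f y) = f (table l x y)" for x y
    unfolding table f[of x] J by (simp add: f table_bilinear(1) table_assoc)
  ultimately show ?thesis using that by blast
qed

section \<open>Isomorphism invariants separating the tables\<close>

definition has_fourth_power :: "('b::zero \<Rightarrow> 'b \<Rightarrow> 'b) \<Rightarrow> bool" where
  "has_fourth_power m \<longleftrightarrow> (\<exists>x. m x (m x (m x x)) \<noteq> 0)"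

definition has_cube :: "('b::zero \<Rightarrow> 'b \<Rightarrow> 'b) \<Rightarrow> bool" where
  "has_cube m \<longleftrightarrow> (\<exists>x. m x (m x x) \<noteq> 0)"

definition has_product :: "('b::zero \<Rightarrow> 'b \<Rightarrow> 'b) \<Rightarrow> bool" where
  "has_product m \<longleftrightarrow> (\<exists>x y. m x y \<noteq> 0)"

definition has_square :: "('b::zero \<Rightarrow> 'b \<Rightarrow> 'b) \<Rightarrow> bool" where
  "has_square m \<longleftrightarrow> (\<exists>x. m x x \<noteq> 0)"

text \<open>An annihilating element that is not itself a product. It detects a direct summand with
  zero multiplication, as in \<open>S41\<close>, \<open>S311\<close> and
  \<open>S221_sharp\<close>.\<close>

definition has_prime_annihilator :: "('b::zero \<Rightarrow> 'b \<Rightarrow> 'b) \<Rightarrow> bool" where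
  "has_prime_annihilator m \<longleftrightarrow> (\<exists>y. (\<forall>z. m y z = 0) \<and> (\<forall>u v. m u v \<noteq> y))"

definition has_orthogonal_pair :: "('b::zero \<Rightarrow> 'b \<Rightarrow> 'b) \<Rightarrow> bool" where
  "has_orthogonal_pair m \<longleftrightarrow> (\<exists>x y. m x y = 0 \<and> m x x \<noteq> 0 \<and> m y y \<noteq> 0)"

text \<open>The property distinguishes algebras whose products lie on one line from
  \<open>S32\<close>, where two orthogonal generators have independent squares.\<close>

definition divides_squares :: "('b::zero \<Rightarrow> 'b \<Rightarrow> 'b) \<Rightarrow> bool" where
  "divides_squares m \<longleftrightarrow> (\<forall>x y. m x x \<noteq> 0 \<longrightarrow> (\<exists>z. m x z = m y y))"

text \<open>Each property uses only products, zero and equality, so its quantifiers can be reindexed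
  along the bijection \<open>f\<close>.\<close>

lemma isomorphism_invariants:
  assumes "bij f" "f 0 = 0" "\<And>x y. m' (f x) (f y) = f (m x y)"
  shows "has_fourth_power m' \<longleftrightarrow> has_fourth_power m" "has_cube m' \<longleftrightarrow> has_cube m"
    "has_product m' \<longleftrightarrow> has_product m" "has_square m' \<longleftrightarrow> has_square m"
    "has_prime_annihilator m' \<longleftrightarrow> has_prime_annihilator m"
    "has_orthogonal_pair m' \<longleftrightarrow> has_orthogonal_pair m"
    "divides_squares m' \<longleftrightarrow> divides_squares m"
proof -
  have ex: "(\<exists>y. P y) \<longleftrightarrow> (\<exists>x. P (f x))" and all: "(\<forall>y. P y) \<longleftrightarrow> (\<forall>x. P (f x))" for P
    using bij_is_surj[OF assms(1)] by (metis surjD)+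
  have eq: "f x = f y \<longleftrightarrow> x = y" for x y
    using bij_is_inj[OF assms(1)] by (auto dest: injD)
  then have eq0: "f x = 0 \<longleftrightarrow> x = 0" for x using assms(2) by metis
  have ex2: "(\<exists>x y. P x y) \<longleftrightarrow> (\<exists>x y. P (f x) (f y))" and all2: "(\<forall>x y. P x y) \<longleftrightarrow> (\<forall>x y. P (f x) (f y))" for P
    using bij_is_surj[OF assms(1)] by (metis surjD)+
  show "has_fourth_power m' \<longleftrightarrow> has_fourth_power m"
    unfolding has_fourth_power_def by (subst ex) (simp add: assms(3) eq0)
  show "has_cube m' \<longleftrightarrow> has_cube m"
    unfolding has_cube_def by (subst ex) (simp add: assms(3) eq0)
  show "has_product m' \<longleftrightarrow> has_product m"
    unfolding has_product_def by (subst ex2) (simp add: assms(3) eq0)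
  show "has_square m' \<longleftrightarrow> has_square m"
    unfolding has_square_def by (subst ex) (simp add: assms(3) eq0)
  have "(\<forall>z. m' (f y) z = 0) \<longleftrightarrow> (\<forall>z. m y z = 0)" for y
    by (subst all) (simp add: assms(3) eq0)
  moreover have "(\<forall>u v. m' u v \<noteq> f y) \<longleftrightarrow> (\<forall>u v. m u v \<noteq> y)" for y
    by (subst all2) (simp add: assms(3) eq)
  ultimately show "has_prime_annihilator m' \<longleftrightarrow> has_prime_annihilator m"
    unfolding has_prime_annihilator_def by (subst ex) (simp only:)
  show "has_orthogonal_pair m' \<longleftrightarrow> has_orthogonal_pair m"
    unfolding has_orthogonal_pair_def by (subst ex2) (simp add: assms(3) eq0)
  have "(\<exists>z. m' (f x) z = m' (f y) (f y)) \<longleftrightarrow> (\<exists>z. m x z = m y y)" for x y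
    by (subst ex) (simp add: assms(3) eq)
  then show "divides_squares m' \<longleftrightarrow> divides_squares m"
    unfolding divides_squares_def by (subst all2) (simp add: assms(3) eq0)
qed

lemma has_fourth_power_table: "has_fourth_power (table l :: 'a::field quad \<Rightarrow> _) \<longleftrightarrow> l = S5"
  by (cases l; auto simp: has_fourth_power_def zero_prod_def intro!: exI[of _ "1::'a"])

lemma has_cube_table: "has_cube (table l :: 'a::field quad \<Rightarrow> _) \<longleftrightarrow> l \<in> {S5, S32_sharp, S41}"
  by (cases l; auto simp: has_cube_def zero_prod_def intro!: exI[of _ "1::'a"])

lemma has_product_table: "has_product (table l :: 'a::field quad \<Rightarrow> _) \<longleftrightarrow> l \<noteq> S2111"
proof -
  have "table l (1, 0, 0, 0) (1, 0, 0, 0) \<noteq> (0 :: 'a quad) \<or> table l (1, 0, 0, 0) (0, 1, 0, 0) \<noteq> (0 :: 'a quad)"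
    if "l \<noteq> S2111"
    using that by (cases l; simp add: zero_prod_def)
  moreover have "table S2111 x y = 0" for x y :: "'a quad"
    by (cases x; cases y; simp add: zero_prod_def)
  ultimately show ?thesis unfolding has_product_def by metis
qed

text \<open>Membership in \<open>labels\<close> provides characteristic 2 for
  \<open>Char_two\<close>, where the square 2 x1 x2 vanishes.\<close>

lemma has_square_table:
  assumes "l \<in> labels TYPE('a::field)"
  shows "has_square (table l :: 'a quad \<Rightarrow> _) \<longleftrightarrow> l \<notin> {S2111, Char_two}"
proof (cases "l \<in> {S2111, Char_two}")
  case True
  have "a * b + b * a = 0" if "CHAR('a) = 2" for a b :: 'a
  proof -
    have "(2 :: 'a) = 0" using of_nat_CHAR[where ?'a = 'a] that by simp
    then show ?thesis by (metis mult.commute mult_2 mult_zero_left)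
  qed
  then have "table l x x = 0" for x :: "'a quad"
    using True assms by (cases x) (auto simp: zero_prod_def labels_def decomposable_labels_def
        indecomposable_labels_def split: if_splits)
  then show ?thesis using True by (auto simp: has_square_def)
next
  case False
  then have "table l (1, 0, 0, 0) (1, 0, 0, 0) \<noteq> (0 :: 'a quad)"
    by (cases l; simp add: zero_prod_def)
  then show ?thesis using False unfolding has_square_def by blast
qed

lemma has_prime_annihilator_table:
  "l \<in> {S41, S311, S221_sharp} \<Longrightarrow> has_prime_annihilator (table l :: 'a::field quad \<Rightarrow> _)"
  "l \<in> {S32_sharp, U1_4, S32, U2_4} \<Longrightarrow> \<not> has_prime_annihilator (table l :: 'a::field quad \<Rightarrow> _)"
proof -
  have no4: "table l u v \<noteq> (0, 0, 0, 1)" "table l (0, 0, 0, 1) v = 0"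
    if "l \<in> {S41, S311, S221_sharp}" for u v :: "'a quad"
    using that by (cases u; cases v; auto simp: zero_prod_def)+
  show "has_prime_annihilator (table l :: 'a quad \<Rightarrow> _)" if "l \<in> {S41, S311, S221_sharp}"
    unfolding has_prime_annihilator_def using no4[OF that] by blast
  show "\<not> has_prime_annihilator (table l :: 'a quad \<Rightarrow> _)" if l: "l \<in> {S32_sharp, U1_4, S32, U2_4}"
  proof -
    have "\<exists>u v. table l u v = y" if "\<forall>z. table l y z = 0" for y :: "'a quad"
    proof -
      obtain a b c d where y: "y = (a, b, c, d)" by (cases y)
      have e: "table l y (1, 0, 0, 0) = 0" "table l y (0, 1, 0, 0) = 0" "table l y (0, 0, 1, 0) = 0"
        using that by blast+
      \<comment> \<open>An annihilating element has only those coordinates left that are products.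
        One factor is fixed per label, and the coordinates of \<open>y\<close> are placed in the
        other so that the product reproduces them.\<close>
      have "table l (1, 0, if l = S32 then 1 else 0, 0)
          (if l = U2_4 then (d, 0, 0, 0) else if l = S32_sharp then (0, d, 0, 0) else (b, 0, d, 0)) = y"
        using l e by (auto simp: y zero_prod_def)
      then show ?thesis by blast
    qed
    then show ?thesis unfolding has_prime_annihilator_def by blast
  qed
qed

lemma has_orthogonal_pair_table:
  "l \<in> {S32, U2_4, S221_sharp} \<Longrightarrow> has_orthogonal_pair (table l :: 'a::field quad \<Rightarrow> _)"
  "l \<in> {U1_4, S311} \<Longrightarrow> \<not> has_orthogonal_pair (table l :: 'a::field quad \<Rightarrow> _)"
proof -
  show "has_orthogonal_pair (table l :: 'a quad \<Rightarrow> _)" if l: "l \<in> {S32, U2_4, S221_sharp}"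
  proof -
    \<comment> \<open>For \<open>U2_4\<close> these have product 1 - 1 = 0 and both squares equal to
      1 in the last coordinate, in every characteristic.\<close>
    define x :: "'a quad" where "x = (if l = U2_4 then (1, 1, 0, 0) else (1, 0, 0, 0))"
    define y :: "'a quad"
      where "y = (if l = U2_4 then (1, 0, - 1, 0) else if l = S32 then (0, 0, 1, 0) else (0, 1, 0, 0))"
    have "table l x y = 0 \<and> table l x x \<noteq> 0 \<and> table l y y \<noteq> 0"
      using l by (auto simp: x_def y_def zero_prod_def)
    then show ?thesis unfolding has_orthogonal_pair_def by blast
  qed
  show "\<not> has_orthogonal_pair (table l :: 'a quad \<Rightarrow> _)" if "l \<in> {U1_4, S311}"
    using that by (auto simp: has_orthogonal_pair_def zero_prod_def)
qed

lemma divides_squares_table: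
  "divides_squares (table U2_4 :: 'a::field quad \<Rightarrow> _)" "\<not> divides_squares (table S32 :: 'a::field quad \<Rightarrow> _)"
proof -
  show "divides_squares (table U2_4 :: 'a quad \<Rightarrow> _)"
    unfolding divides_squares_def
  proof (intro allI impI)
    fix x y :: "'a quad" assume "table U2_4 x x \<noteq> 0"
    moreover obtain s where s: "table U2_4 x x = (0, 0, 0, s)" by (cases x) simp
    moreover obtain t where t: "table U2_4 y y = (0, 0, 0, t)" by (cases y) simp
    ultimately have "table U2_4 x (quad_scale (t / s) x) = table U2_4 y y"
      unfolding table_bilinear by (simp add: quad_scale_def zero_prod_def)
    then show "\<exists>z. table U2_4 x z = table U2_4 y y" ..
  qed
  have "table S32 (1, 0, 0, 0) z \<noteq> table S32 (0, 0, 1, 0) (0, 0, 1, 0)" for z :: "'a quad"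
    by (cases z) simp
  moreover have "table S32 (1, 0, 0, 0) (1, 0, 0, 0) \<noteq> (0 :: 'a quad)" by (simp add: zero_prod_def)
  ultimately show "\<not> divides_squares (table S32 :: 'a quad \<Rightarrow> _)"
    unfolding divides_squares_def by metis
qed

text \<open>Fourth powers single out \<open>S5\<close>; among the other tables with a cube, prime
  annihilators separate \<open>S41\<close> from \<open>S32_sharp\<close>. Products and squares
  isolate \<open>S2111\<close> and \<open>Char_two\<close>. Of the five left, \<open>S311\<close>
  and \<open>S221_sharp\<close> have a prime annihilator and differ in orthogonal pairs; these also
  set \<open>U1_4\<close> apart, and divisibility of squares separates \<open>U2_4\<close> from
  \<open>S32\<close>.\<close>

lemma conjugate_rep_unique:
  assumes "conjugate_in (AGL TYPE('a::field) 4) (rep l) (rep l')"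
    and "l \<in> labels TYPE('a)" "l' \<in> labels TYPE('a)"
  shows "l = l'"
proof -
  obtain f :: "'a quad \<Rightarrow> 'a quad" where f: "bij f" "f 0 = 0" "\<And>x y. table l' (f x) (f y) = f (table l x y)"
    using table_isomorphism[OF assms(1)] by blast
  note inv = isomorphism_invariants[of f "table l'" "table l", OF f]
  note basic = inv(1-4)[unfolded has_fourth_power_table has_cube_table has_product_table
      has_square_table[OF assms(2)] has_square_table[OF assms(3)]]
  show ?thesis
    using basic inv(5-7) has_prime_annihilator_table[where ?'a = 'a] has_orthogonal_pair_table[where ?'a = 'a]
      divides_squares_table[where ?'a = 'a]
    by (cases l; cases l'; simp)
qed

section \<open>Decomposability\<close>

lemma quad_vec_simps:
  "quad_vec v \<in> carrier_vec 4" "quad_vec 0 = 0\<^sub>v 4" "quad_vec (v + w) = quad_vec v + quad_vec w"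
  "quad_vec (quad_scale k v) = k \<cdot>\<^sub>v quad_vec (v :: 'a::field quad)"
  by (cases v; cases w; auto simp: quad_vec_def vec_eq_iff less_4 quad_scale_def zero_prod_def)+

lemma quad_vec_inj: "quad_vec v = quad_vec w \<longleftrightarrow> v = w"
proof
  assume eq: "quad_vec v = quad_vec w"
  have "quad_vec v $ i = quad_vec w $ i" for i using eq by simp
  from this[of 0] this[of 1] this[of 2] this[of 3] show "v = w"
    by (cases v; cases w) (simp add: quad_vec_def)
qed simp

lemma row_vec_mult_quad:
  assumes "affine M"
  shows "row_vec_mult (quad_vec v) (linear_part M) = quad_vec (lin M v)"
proof -
  obtain a b c d where v: "v = (a, b, c, d)" by (cases v)
  have M: "M \<in> carrier_mat 5 5" using assms by (simp add: affine_def)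
  have P: "linear_part M \<in> carrier_mat 4 4" "\<And>i j. i < 4 \<Longrightarrow> j < 4 \<Longrightarrow> linear_part M $$ (i, j) = M $$ (Suc i, Suc j)"
    using M by (auto simp: linear_part_def mat_delete_def)
  have "{0..<4} = {0, 1, 2, 3::nat}" by auto
  then have entry: "row_vec_mult (quad_vec v) (linear_part M) $ j = a * M $$ (1, Suc j) + b * M $$ (2, Suc j)
      + c * M $$ (3, Suc j) + d * M $$ (4, Suc j)" if "j < 4" for j
    using P that by (simp add: v quad_vec_def row_vec_mult_def scalar_prod_def add.assoc numeral_eq_Suc)
  show ?thesis
  proof (rule eq_vecI)
    fix j assume "j < dim_vec (quad_vec (lin M v))"
    then have j: "j < 4" by (simp add: quad_vec_def split: prod.splits)
    show "row_vec_mult (quad_vec v) (linear_part M) $ j = quad_vec (lin M v) $ j"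
      unfolding entry[OF j] using j unfolding less_4 by (elim disjE) (simp_all add: v quad_vec_def lin_def numeral_eq_Suc)
  qed (use P in \<open>simp add: row_vec_mult_def quad_vec_def split: prod.splits\<close>)
qed

text \<open>Decomposability becomes the existence of two complementary nonzero ideals of the table
  algebra.\<close>

definition table_ideal :: "label \<Rightarrow> 'a::field quad set \<Rightarrow> bool" where
  "table_ideal l V \<longleftrightarrow> 0 \<in> V \<and> (\<forall>v\<in>V. \<forall>w\<in>V. v + w \<in> V) \<and> (\<forall>k. \<forall>v\<in>V. quad_scale k v \<in> V)
     \<and> (\<forall>v\<in>V. \<forall>x. table l v x \<in> V)"

lemma subspace_quad_vec_iff:
  "VectorSpace.subspace class_ring (quad_vec ` V) (module_vec TYPE('a::field) 4) \<longleftrightarrow>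
     0 \<in> V \<and> (\<forall>v\<in>V. \<forall>w\<in>V. v + w \<in> V) \<and> (\<forall>k. \<forall>v\<in>V. quad_scale k (v :: 'a quad) \<in> V)"
proof -
  interpret vec_space "TYPE('a)" 4 .
  have inV: "quad_vec v \<in> quad_vec ` V \<longleftrightarrow> v \<in> V" for v :: "'a quad"
    using quad_vec_inj by (metis image_iff)
  have "VectorSpace.subspace class_ring (quad_vec ` V) (module_vec TYPE('a) 4)
      \<longleftrightarrow> submodule class_ring (quad_vec ` V) (module_vec TYPE('a) 4)"
    unfolding VectorSpace.subspace_def using vectorspace_axioms by blast
  also have "\<dots> \<longleftrightarrow> quad_vec ` V \<subseteq> carrier_vec 4 \<and> (\<forall>v\<in>quad_vec ` V. \<forall>w\<in>quad_vec ` V. v + w \<in> quad_vec ` V)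
      \<and> 0\<^sub>v 4 \<in> quad_vec ` V \<and> (\<forall>k. \<forall>v\<in>quad_vec ` V. k \<cdot>\<^sub>v v \<in> quad_vec ` V)"
    unfolding submodule_def module_vec_simps class_ring_simps using module_axioms by blast
  also have "\<dots> \<longleftrightarrow> 0 \<in> V \<and> (\<forall>v\<in>V. \<forall>w\<in>V. v + w \<in> V) \<and> (\<forall>k. \<forall>v\<in>V. quad_scale k v \<in> V)"
    unfolding ball_simps quad_vec_simps(2-4)[symmetric] inV quad_vec_surj by blast
  finally show ?thesis .
qed

text \<open>A subspace is stable under v -> v + v x exactly when it is stable under v -> v x,
  because v can be subtracted.\<close>

lemma invariant_subspace_iff:
  "invariant_subspace 4 (rep l) (quad_vec ` V) \<longleftrightarrow> table_ideal l (V :: 'a::field quad set)"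
proof (cases "VectorSpace.subspace class_ring (quad_vec ` V) (module_vec TYPE('a) 4)")
  case True
  have inV: "quad_vec v \<in> quad_vec ` V \<longleftrightarrow> v \<in> V" for v
    using quad_vec_inj by (metis image_iff)
  from True have sub: "0 \<in> V" "\<And>v w. v \<in> V \<Longrightarrow> w \<in> V \<Longrightarrow> v + w \<in> V" "\<And>k v. v \<in> V \<Longrightarrow> quad_scale k v \<in> V"
    unfolding subspace_quad_vec_iff by blast+
  have "v + table l v x \<in> V \<longleftrightarrow> table l v x \<in> V" if "v \<in> V" for v x
  proof
    have "quad_scale (- 1) v = - v" by (cases v) (simp add: quad_scale_def)
    then have "- v \<in> V" using sub(3)[OF that, of "- 1"] by simp
    then show "v + table l v x \<in> V \<Longrightarrow> table l v x \<in> V" using sub(2)[of "- v" "v + table l v x"] by simp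
  qed (use sub(2) that in blast)
  moreover have "(\<forall>M\<in>rep l. \<forall>w\<in>quad_vec ` V. row_vec_mult w (linear_part M) \<in> quad_vec ` V)
      \<longleftrightarrow> (\<forall>v\<in>V. \<forall>x. v + table l v x \<in> V)"
    unfolding rep_range ball_simps row_vec_mult_quad[OF affine_rep(1)] lin_rep inV by blast
  ultimately show ?thesis
    using True unfolding invariant_subspace_def table_ideal_def subspace_quad_vec_iff by blast
next
  case False
  then show ?thesis unfolding invariant_subspace_def table_ideal_def subspace_quad_vec_iff by blast
qed

lemma decomposable_rep_iff:
  "decomposable 4 (rep l :: 'a::field mat set) \<longleftrightarrow>
     (\<exists>V W :: 'a quad set. table_ideal l V \<and> V \<noteq> {0} \<and> table_ideal l W \<and> W \<noteq> {0}
        \<and> V \<inter> W = {0} \<and> (\<forall>x. \<exists>v\<in>V. \<exists>w\<in>W. x = v + w))"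
    (is "_ \<longleftrightarrow> (\<exists>V W. ?P V W)")
proof -
  have eq: "quad_vec ` V = quad_vec ` W \<longleftrightarrow> V = W" for V W :: "'a quad set"
    by (rule inj_image_eq_iff) (auto intro: injI simp: quad_vec_inj)
  have zero: "{0\<^sub>v 4} = quad_vec ` {0 :: 'a quad}" by (simp add: quad_vec_simps(2))
  have int: "quad_vec ` V \<inter> quad_vec ` W = quad_vec ` (V \<inter> W)" for V W :: "'a quad set"
    by (rule image_Int[symmetric]) (auto intro: injI simp: quad_vec_inj)
  have sum: "{v + w |v w. v \<in> quad_vec ` V \<and> w \<in> quad_vec ` W} = quad_vec ` {v + w |v w. v \<in> V \<and> w \<in> W}"
    for V W :: "'a quad set"
  proof -
    have "{v + w |v w. v \<in> quad_vec ` V \<and> w \<in> quad_vec ` W} = {quad_vec v + quad_vec w |v w. v \<in> V \<and> w \<in> W}"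
      by blast
    also have "\<dots> = quad_vec ` {v + w |v w. v \<in> V \<and> w \<in> W}"
      unfolding quad_vec_simps(3)[symmetric] by blast
    finally show ?thesis .
  qed
  have image: "V \<subseteq> carrier_vec 4 \<Longrightarrow> \<exists>V'. V = quad_vec ` V'" for V :: "'a vec set"
    unfolding quad_vec_surj by (rule subset_imageE) auto
  have sub: "V \<subseteq> carrier_vec 4" if "invariant_subspace 4 (rep l) V" for V :: "'a vec set"
    using that unfolding invariant_subspace_def VectorSpace.subspace_def submodule_def
    by (auto simp: module_vec_simps)
  have all: "{v + w |v w. v \<in> V \<and> w \<in> W} = UNIV \<longleftrightarrow> (\<forall>x. \<exists>v\<in>V. \<exists>w\<in>W. x = v + w)" for V W :: "'a quad set"
    by blast
  have "decomposable 4 (rep l :: 'a mat set) \<longleftrightarrow> (\<exists>V W. invariant_subspace 4 (rep l) (quad_vec ` V :: 'a vec set)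
       \<and> quad_vec ` V \<noteq> {0\<^sub>v 4} \<and> invariant_subspace 4 (rep l) (quad_vec ` W) \<and> quad_vec ` W \<noteq> {0\<^sub>v 4}
       \<and> quad_vec ` V \<inter> quad_vec ` W = {0\<^sub>v 4}
       \<and> {v + w |v w. v \<in> quad_vec ` V \<and> w \<in> quad_vec ` W} = carrier_vec 4)"
  proof
    assume "decomposable 4 (rep l :: 'a mat set)"
    then obtain V W :: "'a vec set" where *: "invariant_subspace 4 (rep l) V" "V \<noteq> {0\<^sub>v 4}"
      "invariant_subspace 4 (rep l) W" "W \<noteq> {0\<^sub>v 4}" "V \<inter> W = {0\<^sub>v 4}"
      "{v + w |v w. v \<in> V \<and> w \<in> W} = carrier_vec 4"
      unfolding decomposable_def by blast
    obtain V' where V': "V = quad_vec ` V'" using image[OF sub[OF *(1)]] by blast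
    obtain W' where W': "W = quad_vec ` W'" using image[OF sub[OF *(3)]] by blast
    show "\<exists>V W. invariant_subspace 4 (rep l) (quad_vec ` V :: 'a vec set)
       \<and> quad_vec ` V \<noteq> {0\<^sub>v 4} \<and> invariant_subspace 4 (rep l) (quad_vec ` W) \<and> quad_vec ` W \<noteq> {0\<^sub>v 4}
       \<and> quad_vec ` V \<inter> quad_vec ` W = {0\<^sub>v 4}
       \<and> {v + w |v w. v \<in> quad_vec ` V \<and> w \<in> quad_vec ` W} = (carrier_vec 4 :: 'a vec set)"
      using *[unfolded V' W'] by (intro exI conjI)
  qed (unfold decomposable_def, blast)
  then show ?thesis
    unfolding invariant_subspace_iff zero eq int sum quad_vec_surj all .
qed

text \<open>\<open>S32\<close> splits into two planes, each generated by one element. In the other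
  cases the last basis vector annihilates everything and does not occur in products, so it spans a
  summand.\<close>

lemma decomposable_rep:
  assumes "l \<in> decomposable_labels TYPE('a::field)"
  shows "decomposable 4 (rep l :: 'a mat set)"
proof -
  have ne: "v \<noteq> 0 \<Longrightarrow> v \<in> A \<Longrightarrow> A \<noteq> {0}" for v :: "'a quad" and A by blast
  have nonzero: "(1, 0, 0, 0) \<noteq> (0 :: 'a quad)" "(0, 0, 0, 1) \<noteq> (0 :: 'a quad)" by (simp_all add: zero_prod_def)
  show ?thesis
  proof (cases "l = S32")
    case True
    have "table_ideal S32 {((a, b, 0, 0) :: 'a quad) | a b. True}" "table_ideal S32 {((0, 0, a, b) :: 'a quad) | a b. True}"
      by (auto simp: table_ideal_def zero_prod_def quad_scale_def)
    moreover have "{((a, b, 0, 0) :: 'a quad) | a b. True} \<noteq> {0}"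
      by (rule ne[OF nonzero(1)]) simp
    moreover have "{((0, 0, a, b) :: 'a quad) | a b. True} \<noteq> {0}"
      by (rule ne[OF nonzero(2)]) simp
    moreover have "{((a, b, 0, 0) :: 'a quad) | a b. True} \<inter> {((0, 0, a, b) :: 'a quad) | a b. True} = {0}"
      by (auto simp: zero_prod_def)
    moreover have "\<exists>v\<in>{((a, b, 0, 0) :: 'a quad) | a b. True}. \<exists>w\<in>{((0, 0, a, b) :: 'a quad) | a b. True}. x = v + w" for x
      by (cases x) auto
    ultimately show ?thesis unfolding True decomposable_rep_iff by blast
  next
    case False
    have "table_ideal l {((a, b, c, 0) :: 'a quad) | a b c. True}" "table_ideal l {((0, 0, 0, a) :: 'a quad) | a. True}"
      using assms False
      by (cases l; auto simp: table_ideal_def zero_prod_def quad_scale_def decomposable_labels_def split: if_splits)+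
    moreover have "{((a, b, c, 0) :: 'a quad) | a b c. True} \<noteq> {0}"
      by (rule ne[OF nonzero(1)]) simp
    moreover have "{((0, 0, 0, a) :: 'a quad) | a. True} \<noteq> {0}"
      by (rule ne[OF nonzero(2)]) simp
    moreover have "{((a, b, c, 0) :: 'a quad) | a b c. True} \<inter> {((0, 0, 0, a) :: 'a quad) | a. True} = {0}"
      by (auto simp: zero_prod_def)
    moreover have "\<exists>v\<in>{((a, b, c, 0) :: 'a quad) | a b c. True}. \<exists>w\<in>{((0, 0, 0, a) :: 'a quad) | a. True}. x = v + w" for x
      by (cases x) auto
    ultimately show ?thesis unfolding decomposable_rep_iff by blast
  qed
qed

text \<open>For these three labels the annihilator is the line of the last basis vector, and every
  nonzero ideal meets it. Two nonzero ideals can then never intersect trivially.\<close>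

lemma socle_in_ideal:
  assumes "table_ideal l V" "V \<noteq> {0}" "l \<in> {S5, S32_sharp, U2_4}"
  shows "(0, 0, 0, 1 :: 'a::field) \<in> V"
proof -
  obtain v where v: "v \<in> V" "v \<noteq> 0"
    using assms(1,2) unfolding table_ideal_def by blast
  obtain a b c d where abcd: "v = (a, b, c, d)" by (cases v)
  have scale: "(0, 0, 0, 1) \<in> V" if "(0, 0, 0, k) \<in> V" "k \<noteq> 0" for k
  proof -
    have "quad_scale (inverse k) (0, 0, 0, k) \<in> V" using assms(1) that unfolding table_ideal_def by blast
    then show ?thesis using that by (simp add: quad_scale_def)
  qed
  have mult: "table l v x \<in> V" for x using assms(1) v unfolding table_ideal_def by blast
  have "\<exists>k. k \<noteq> 0 \<and> (0, 0, 0, k) \<in> V"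
  proof (cases "a = 0 \<and> b = 0 \<and> c = 0")
    case True
    then show ?thesis using v by (auto simp: abcd zero_prod_def)
  next
    case False
    \<comment> \<open>Each choice multiplies \<open>v\<close> into the last coordinate alone, with a
      nonzero coordinate of \<open>v\<close> as the result.\<close>
    define x :: "'a quad" where "x = (if l = S5 then (if a \<noteq> 0 then (0, 0, 1, 0) else if b \<noteq> 0 then (0, 1, 0, 0) else (1, 0, 0, 0))
      else if l = S32_sharp then (if c \<noteq> 0 then (0, 0, 1, 0) else if a \<noteq> 0 then (0, 1, 0, 0) else (1, 0, 0, 0))
      else (if a \<noteq> 0 then (1, 0, 0, 0) else if b \<noteq> 0 then (0, 0, 1, 0) else (0, 1, 0, 0)))"
    show ?thesis
      using mult[of x] False assms(3) by (auto simp: abcd x_def split: if_splits)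
  qed
  then show ?thesis using scale by blast
qed

lemma indecomposable_U1: "indecomposable 4 (rep U1_4 :: 'a::field mat set)"
proof -
  have False if V: "table_ideal U1_4 V" "V \<noteq> {0}" and W: "table_ideal U1_4 W" "W \<noteq> {0}"
    and int: "V \<inter> W = {0}" and sum: "\<forall>x. \<exists>v\<in>V. \<exists>w\<in>W. x = v + w"
    and v: "(1, b, 0, d) \<in> V" for V W :: "'a quad set" and b d
  proof -
    have mult: "table U1_4 u x \<in> V" if "u \<in> V" for u x
      using V that unfolding table_ideal_def by blast
    have multW: "table U1_4 x u \<in> W" if "u \<in> W" for u x
      using W that unfolding table_commute[of U1_4 x u] table_ideal_def by blast
    \<comment> \<open>Such a vector multiplies into the whole annihilator, so V contains it. An
      element of W then has zero product with \<open>v\<close>, hence lies in the annihilator and so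
      in V.\<close>
    have e: "(0, 1, 0, 0) \<in> V" "(0, 0, 0, 1) \<in> V"
      using mult[OF v, of "(1, 0, 0, 0)"] mult[OF v, of "(0, 0, 1, 0)"] by simp_all
    have "w = 0" if w: "w \<in> W" for w
    proof -
      obtain p q r s where pqrs: "w = (p, q, r, s)" by (cases w)
      have "table U1_4 (1, b, 0, d) w \<in> V \<inter> W" using mult v multW w by blast
      then have pr: "p = 0" "r = 0" using int by (auto simp: pqrs zero_prod_def)
      have "quad_scale q (0, 1, 0, 0) + quad_scale s (0, 0, 0, 1) \<in> V"
        using V(1) e unfolding table_ideal_def by blast
      then have "w \<in> V" by (simp add: pqrs pr quad_scale_def)
      then show ?thesis using w int by blast
    qed
    then show False using W unfolding table_ideal_def by blast
  qed
  note contra = this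
  have False if V: "table_ideal U1_4 V" "V \<noteq> {0}" and W: "table_ideal U1_4 W" "W \<noteq> {0}"
    and int: "V \<inter> W = {0}" and sum: "\<forall>x. \<exists>v\<in>V. \<exists>w\<in>W. x = v + w" for V W :: "'a quad set"
  proof -
    obtain v w where vw: "v \<in> V" "w \<in> W" "(1, 0, 0, 0) = v + w" using sum by blast
    obtain a b c d where v: "v = (a, b, c, d)" by (cases v)
    have w: "w = (1 - a, - b, - c, - d)"
      using vw(3) by (cases w) (simp add: v eq_neg_iff_add_eq_0 add.commute eq_diff_eq)
    have "table U1_4 v w \<in> V" using V(1) vw(1) unfolding table_ideal_def by blast
    moreover have "table U1_4 v w \<in> W"
      using W(1) vw(2) unfolding table_commute[of U1_4 v w] table_ideal_def by blast
    \<comment> \<open>The product of \<open>v\<close> and \<open>w\<close> belongs to both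
      ideals.\<close>
    ultimately have "table U1_4 v w = 0" using int by blast
    then have eq: "a * (1 - a) = 0" "c * (1 - a) - a * c = 0"
      by (simp_all add: v w zero_prod_def algebra_simps)
    have "a = 0 \<or> a = 1" using eq(1) by auto
    moreover from this have "c = 0" using eq(2) by (elim disjE) simp_all
    ultimately consider "a = 1" "c = 0" | "a = 0" "c = 0" by blast
    then show False
    proof cases
      case 1
      then show False using contra[OF V W int sum, of b d] vw(1) by (simp add: v)
    next
      case 2
      have "\<forall>x. \<exists>w\<in>W. \<exists>v\<in>V. x = w + v" using sum by (metis add.commute)
      then show False using contra[OF W V _ _, of "- b" "- d"] int vw(2) 2 by (simp add: w Int_commute)
    qed
  qed
  then show ?thesis unfolding decomposable_rep_iff by blast
qed

lemma indecomposable_rep: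
  assumes "l \<in> indecomposable_labels"
  shows "indecomposable 4 (rep l :: 'a::field mat set)"
proof (cases "l = U1_4")
  case True
  then show ?thesis using indecomposable_U1 by simp
next
  case False
  then have l: "l \<in> {S5, S32_sharp, U2_4}" using assms by (auto simp: indecomposable_labels_def)
  have "(0, 0, 0, 1 :: 'a) \<noteq> 0" by (simp add: zero_prod_def)
  then show ?thesis
    unfolding decomposable_rep_iff using socle_in_ideal[OF _ _ l] by blast
qed

section \<open>Presentations of the algebras\<close>

text \<open>The nil algebra with a unit adjoined; (a, x) stands for a + x.\<close>

definition alg_mult :: "label \<Rightarrow> 'a::field \<times> 'a quad \<Rightarrow> 'a \<times> 'a quad \<Rightarrow> 'a \<times> 'a quad" where
  "alg_mult l = (\<lambda>(a, x) (b, y). (a * b, quad_scale a y + quad_scale b x + table l x y))"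

definition alg :: "label \<Rightarrow> ('a::field \<times> 'a quad) ring" where
  "alg l = \<lparr>carrier = UNIV, mult = alg_mult l, one = (1, 0), zero = 0, add = (+)\<rparr>"

interpretation quad: vector_space "quad_scale :: 'a::field \<Rightarrow> _"
  by (rule quad_vector_space)

lemma alg_mult_commute: "alg_mult l p q = alg_mult l q p"
  by (cases p; cases q) (simp add: alg_mult_def table_commute mult.commute add_ac)

lemma alg_mult_assoc: "alg_mult l (alg_mult l p q) r = alg_mult l p (alg_mult l q r)"
proof -
  obtain a x b y c z where "p = (a, x)" "q = (b, y)" "r = (c, z)" by (cases p; cases q; cases r)
  then show ?thesis
    by (simp add: alg_mult_def table_bilinear table_assoc quad.scale_right_distrib mult_ac add_ac)
qed

lemma alg_mult_add: "alg_mult l (p + q) r = alg_mult l p r + alg_mult l q r"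
proof -
  obtain a x b y c z where "p = (a, x)" "q = (b, y)" "r = (c, z)" by (cases p; cases q; cases r)
  then show ?thesis
    by (simp add: alg_mult_def table_bilinear quad.scale_right_distrib quad.scale_left_distrib distrib_right add_ac)
qed

lemma alg_mult_left_commute: "alg_mult l p (alg_mult l q r) = alg_mult l q (alg_mult l p r)"
  by (metis alg_mult_assoc alg_mult_commute)

lemma alg_mult_one: "alg_mult l (1, 0) p = p"
  by (cases p) (simp add: alg_mult_def)

lemma alg_cring: "cring (alg l)"
proof (rule cringI)
  show "abelian_group (alg l)"
  proof (rule abelian_groupI)
    fix x assume "x \<in> carrier (alg l)"
    show "\<exists>y\<in>carrier (alg l). y \<oplus>\<^bsub>alg l\<^esub> x = \<zero>\<^bsub>alg l\<^esub>"
      by (rule bexI[of _ "- x"]) (simp_all add: alg_def)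
  qed (simp_all add: alg_def add_ac)
  show "Group.comm_monoid (alg l)"
    by (rule comm_monoidI) (simp_all add: alg_def alg_mult_one alg_mult_assoc, rule alg_mult_commute)
qed (simp add: alg_def alg_mult_add)

text \<open>The \<open>5 \<times> 5\<close> matrices of the span form the regular representation of \<open>alg l\<close>:
  row vectors \<open>(s, v)\<close> are multiplied from the right.\<close>

definition act :: "'a::field mat \<Rightarrow> 'a \<times> 'a quad \<Rightarrow> 'a \<times> 'a quad" where
  "act M = (\<lambda>(s, a, b, c, d).
     let f = (\<lambda>j. s * M $$ (0, j) + a * M $$ (1, j) + b * M $$ (2, j) + c * M $$ (3, j) + d * M $$ (4, j))
     in (f 0, f 1, f 2, f 3, f 4))"

lemma act_mult:
  assumes "M \<in> carrier_mat 5 5" "N \<in> carrier_mat 5 5"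
  shows "act (M * N) p = act N (act M p)"
  by (cases p) (simp add: act_def Let_def mult_entry[OF assms] algebra_simps del: index_mult_mat(1))

lemma act_add:
  assumes "M \<in> carrier_mat 5 5" "N \<in> carrier_mat 5 5"
  shows "act (M + N) p = act M p + act N p"
  using assms by (cases p) (simp add: act_def Let_def algebra_simps)

lemma act_smult:
  assumes "M \<in> carrier_mat 5 5"
  shows "act (c \<cdot>\<^sub>m M) p = (case act M p of (s, v) \<Rightarrow> (c * s, quad_scale c v))"
  using assms by (cases p) (simp add: act_def Let_def quad_scale_def algebra_simps)

lemma act_one: "act (1\<^sub>m 5) p = p"
  by (cases p) (simp add: act_def)

lemma act_rep: "act (rep_quad l x) (s, v) = (s, quad_scale s x + v + table l v x)"
proof -
  have eq: "act M (s, v) = (s, quad_scale s (translation M) + lin M v)" if "affine M" for M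
    using that by (cases v) (simp add: affine_iff act_def translation_def lin_def quad_scale_def Let_def add_ac)
  show ?thesis by (simp add: eq affine_rep lin_rep add_ac)
qed

lemma act_eqI:
  assumes "A \<in> carrier_mat 5 5" "B \<in> carrier_mat 5 5" "\<And>p. act A p = act B p"
  shows "A = B"
proof (rule eq_matI)
  fix i j assume "i < dim_row B" "j < dim_col B"
  then have "i < 5" "j < 5" using assms by auto
  moreover have "A $$ (0, j) = B $$ (0, j) \<and> A $$ (1, j) = B $$ (1, j) \<and> A $$ (2, j) = B $$ (2, j)
      \<and> A $$ (3, j) = B $$ (3, j) \<and> A $$ (4, j) = B $$ (4, j)" if "j \<in> {0, 1, 2, 3, 4}" for j
    using that assms(3)[of "(1, 0, 0, 0, 0)"] assms(3)[of "(0, 1, 0, 0, 0)"]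
      assms(3)[of "(0, 0, 1, 0, 0)"] assms(3)[of "(0, 0, 0, 1, 0)"] assms(3)[of "(0, 0, 0, 0, 1)"]
    by (simp add: act_def Let_def) (elim disjE conjE; simp only:)
  ultimately show "A $$ (i, j) = B $$ (i, j)" by (auto simp: less_5)
qed (use assms in auto)

text \<open>The scalar is a - 1 because the matrix \<open>rep_quad l x\<close> already contains the
  identity.\<close>

definition alg_mat :: "label \<Rightarrow> 'a::field \<times> 'a quad \<Rightarrow> 'a mat" where
  "alg_mat l = (\<lambda>(a, x). (a - 1) \<cdot>\<^sub>m 1\<^sub>m 5 + rep_quad l x)"

lemma rep_quad_carrier: "rep_quad l x \<in> carrier_mat 5 5"
  using affine_rep(1)[of l x] by (simp add: affine_def)

lemma alg_mat_carrier: "alg_mat l p \<in> carrier_mat 5 5"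
  by (cases p) (simp add: alg_mat_def rep_quad_carrier)

lemma act_alg_mat: "act (alg_mat l p) q = alg_mult l q p"
proof -
  obtain a x s v where pq: "p = (a, x)" "q = (s, v)" by (cases p; cases q)
  have "quad_scale (a - 1) v + v = quad_scale a v"
    by (simp add: quad.scale_left_diff_distrib)
  then show ?thesis
    by (simp add: pq alg_mat_def alg_mult_def act_add act_smult act_one act_rep rep_quad_carrier algebra_simps)
qed

text \<open>A matrix is determined by its action on row vectors, and \<open>alg_mat l p\<close> acts
  as multiplication by p. All homomorphism laws thus become laws of \<open>alg_mult\<close>, and the
  action on the unit recovers p.\<close>

lemma alg_mat_iso: "alg_mat l \<in> ring_iso (alg l) (span_algebra 4 (rep l :: 'a::field mat set))"
proof -
  have eqI: "M = alg_mat l p" if "M \<in> carrier_mat 5 5" "\<And>q. act M q = alg_mult l q p" for M :: "'a mat" and p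
    using that by (intro act_eqI) (simp_all add: alg_mat_carrier act_alg_mat)
  have hom: "alg_mat l \<in> Ring.ring_hom (alg l) (span_algebra 4 (rep l :: 'a mat set))"
  proof (rule ring_hom_memI)
    fix p q :: "'a \<times> 'a quad"
    show "alg_mat l p \<in> carrier (span_algebra 4 (rep l :: 'a mat set))"
    proof -
      have "alg_mat l p = (fst p - 1) \<cdot>\<^sub>m 1\<^sub>m (4 + 1) + 1 \<cdot>\<^sub>m rep_quad l (snd p)"
        using rep_quad_carrier[of l "snd p"] by (cases p) (auto simp: alg_mat_def intro!: eq_matI)
      then have "alg_mat l p \<in> {\<alpha> \<cdot>\<^sub>m 1\<^sub>m (4 + 1) + \<beta> \<cdot>\<^sub>m u |\<alpha> \<beta> u. u \<in> rep l}"
        unfolding rep_range by blast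
      then show ?thesis by (simp add: span_algebra_def)
    qed
    show "alg_mat l (p \<otimes>\<^bsub>alg l\<^esub> q) = alg_mat l p \<otimes>\<^bsub>span_algebra 4 (rep l)\<^esub> alg_mat l q"
    proof -
      have "alg_mat l p * alg_mat l q = alg_mat l (alg_mult l p q)"
        by (rule eqI) (simp_all add: act_mult alg_mat_carrier act_alg_mat alg_mult_assoc mult_carrier_mat[of _ 5 5])
      then show ?thesis by (simp add: alg_def span_algebra_def ring_mat_def)
    qed
    show "alg_mat l (p \<oplus>\<^bsub>alg l\<^esub> q) = alg_mat l p \<oplus>\<^bsub>span_algebra 4 (rep l)\<^esub> alg_mat l q"
    proof -
      have "alg_mat l p + alg_mat l q = alg_mat l (p + q)"
        by (rule eqI) (simp_all add: act_add alg_mat_carrier act_alg_mat alg_mult_commute[of l _ "p + q"]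
            alg_mult_add alg_mult_commute[of l p] alg_mult_commute[of l q])
      then show ?thesis by (simp add: alg_def span_algebra_def ring_mat_def)
    qed
    show "alg_mat l \<one>\<^bsub>alg l\<^esub> = \<one>\<^bsub>span_algebra 4 (rep l :: 'a mat set)\<^esub>"
    proof -
      have "1\<^sub>m 5 = alg_mat l (1 :: 'a, 0)"
        by (rule eqI) (simp_all add: act_one alg_mult_commute[of l _ "(1, 0)"] alg_mult_one)
      then show ?thesis by (simp add: alg_def span_algebra_def ring_mat_def)
    qed
  qed
  have "bij_betw (alg_mat l) (carrier (alg l :: ('a \<times> 'a quad) ring)) (carrier (span_algebra 4 (rep l :: 'a mat set)))"
    unfolding bij_betw_def
  proof
    show "inj_on (alg_mat l) (carrier (alg l :: ('a \<times> 'a quad) ring))"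
    proof (rule inj_onI)
      fix p q :: "'a \<times> 'a quad" assume "alg_mat l p = alg_mat l q"
      then have "act (alg_mat l p) (1, 0) = act (alg_mat l q) (1, 0)" by simp
      then show "p = q" by (simp add: act_alg_mat alg_mult_one)
    qed
    \<comment> \<open>This shows that the set of all a I + b u is already closed under the ring
      operations: it is the full range of \<open>alg_mat l\<close>.\<close>
    have "a \<cdot>\<^sub>m 1\<^sub>m 5 + b \<cdot>\<^sub>m rep_quad l x = alg_mat l (a + b, quad_scale b x)" for a b :: 'a and x
    proof (rule eqI)
      show "act (a \<cdot>\<^sub>m 1\<^sub>m 5 + b \<cdot>\<^sub>m rep_quad l x) q = alg_mult l q (a + b, quad_scale b x)" for q
        by (cases q) (simp add: act_add act_smult act_one act_rep rep_quad_carrier alg_mult_def table_bilinear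
            quad.scale_left_distrib quad.scale_right_distrib algebra_simps)
    qed (simp add: rep_quad_carrier)
    then have sub: "carrier (span_algebra 4 (rep l)) \<subseteq> range (alg_mat l :: 'a \<times> 'a quad \<Rightarrow> _)"
      by (auto simp: span_algebra_def rep_range)
    moreover have "alg_mat l ` carrier (alg l) \<subseteq> carrier (span_algebra 4 (rep l :: 'a mat set))"
      using ring_hom_closed[OF hom] by blast
    ultimately show "alg_mat l ` carrier (alg l) = carrier (span_algebra 4 (rep l :: 'a mat set))"
      by (auto simp: alg_def)
  qed
  with hom show ?thesis by (simp add: ring_iso_def)
qed

lemma alg_mat_scalar: "alg_mat l (c, 0) = scalar_mat 4 c"
proof (rule act_eqI)
  show "act (alg_mat l (c, 0)) p = act (scalar_mat 4 c) p" for p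
    unfolding act_alg_mat by (cases p) (simp add: scalar_mat_def act_smult act_one alg_mult_def mult.commute)
qed (simp_all add: alg_mat_carrier scalar_mat_def)

section \<open>Polynomial rings and evaluation in the table algebra\<close>

abbreviation polys :: "nat \<Rightarrow> 'a::field mpoly set" where
  "polys k \<equiv> carrier (poly_ring k)"

lemma poly_ring_simps:
  "p \<otimes>\<^bsub>poly_ring k\<^esub> q = p * q" "p \<oplus>\<^bsub>poly_ring k\<^esub> q = p + q"
  "\<one>\<^bsub>poly_ring k\<^esub> = 1" "\<zero>\<^bsub>poly_ring k\<^esub> = 0"
  by (simp_all add: poly_ring_def)

lemma polys_iff: "p \<in> polys k \<longleftrightarrow> (\<forall>m\<in>Poly_Mapping.keys p. Poly_Mapping.keys m \<subseteq> {1..k})"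
  by (simp add: poly_ring_def)

lemma polys_add: "p \<in> polys k \<Longrightarrow> q \<in> polys k \<Longrightarrow> p + q \<in> polys k"
  using Poly_Mapping.keys_add[of p q] by (auto simp: polys_iff)

lemma polys_mult: "p \<in> polys k \<Longrightarrow> q \<in> polys k \<Longrightarrow> p * q \<in> polys k"
proof -
  assume p: "p \<in> polys k" and q: "q \<in> polys k"
  have "Poly_Mapping.keys m \<subseteq> {1..k}" if m: "m \<in> Poly_Mapping.keys (p * q)" for m
  proof -
    obtain a b where "m = a + b" "a \<in> Poly_Mapping.keys p" "b \<in> Poly_Mapping.keys q"
      using m keys_mult[of p q] by blast
    then show ?thesis using p q Poly_Mapping.keys_add[of a b] by (fastforce simp: polys_iff)
  qed
  then show ?thesis by (simp add: polys_iff)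
qed

lemma polys_uminus: "p \<in> polys k \<Longrightarrow> - p \<in> polys k"
  by (simp add: polys_iff in_keys_iff)

lemma polys_diff: "p \<in> polys k \<Longrightarrow> q \<in> polys k \<Longrightarrow> p - q \<in> polys k"
  by (simp only: diff_conv_add_uminus polys_add polys_uminus)

lemma polys_scalar: "scalar_poly c \<in> polys k"
  by (simp add: polys_iff scalar_poly_def)

lemma polys_tvar: "i \<in> {1..k} \<Longrightarrow> tvar i \<in> polys k"
  by (simp add: polys_iff tvar_def)

lemma polys_zero: "0 \<in> polys k" and polys_one: "1 \<in> polys k"
  by (simp_all add: polys_iff)

lemma polys_power: "p \<in> polys k \<Longrightarrow> p ^ n \<in> polys k"
  by (induction n) (simp_all add: polys_one polys_mult)

lemmas polys_closed = polys_add polys_mult polys_uminus polys_diff polys_scalar polys_tvar polys_zero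
  polys_one polys_power

lemma poly_ring_cring: "cring (poly_ring k :: 'a::field mpoly ring)"
proof (rule cringI)
  show "abelian_group (poly_ring k :: 'a mpoly ring)"
  proof (rule abelian_groupI)
    fix x :: "'a mpoly" assume "x \<in> polys k"
    then show "\<exists>y\<in>polys k. y \<oplus>\<^bsub>poly_ring k\<^esub> x = \<zero>\<^bsub>poly_ring k\<^esub>"
      by (intro bexI[of _ "- x"]) (simp_all add: poly_ring_simps polys_uminus)
  qed (simp_all add: poly_ring_simps polys_closed add_ac)
  show "Group.comm_monoid (poly_ring k :: 'a mpoly ring)"
    by (rule comm_monoidI) (simp_all add: poly_ring_simps polys_closed mult_ac)
qed (simp add: poly_ring_simps distrib_right)

text \<open>Updating at a fresh key amounts to adding a single term, so a property stable under
  addition need only be checked on single terms.\<close>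

lemma poly_mapping_add_induct [case_names zero single add]:
  assumes "P 0" "\<And>m c. P (Poly_Mapping.single m c)" "\<And>p q. P p \<Longrightarrow> P q \<Longrightarrow> P (p + q)"
  shows "P (p :: 'b \<Rightarrow>\<^sub>0 'c::monoid_add)"
proof (induction p rule: update_induct)
  case (update f a b)
  have "Poly_Mapping.update a b f = f + Poly_Mapping.single a b"
    using update(1) by (intro poly_mapping_eqI) (auto simp: lookup_update lookup_add lookup_single in_keys_iff when_def)
  then show ?case using assms update by simp
qed (rule assms(1))

definition monomial_value :: "label \<Rightarrow> (nat \<Rightarrow> 'a::field \<times> 'a quad) \<Rightarrow> (nat \<Rightarrow>\<^sub>0 nat) \<Rightarrow> 'a \<times> 'a quad" where
  "monomial_value l g m = (\<Otimes>\<^bsub>alg l\<^esub>i\<in>Poly_Mapping.keys m. g i [^]\<^bsub>alg l\<^esub> Poly_Mapping.lookup m i)"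

definition evaluate :: "label \<Rightarrow> (nat \<Rightarrow> 'a::field \<times> 'a quad) \<Rightarrow> 'a mpoly \<Rightarrow> 'a \<times> 'a quad" where
  "evaluate l g p = (\<Sum>m\<in>Poly_Mapping.keys p. alg_mult l (Poly_Mapping.lookup p m, 0) (monomial_value l g m))"

text \<open>Both finite products are extended to the union of the supports, where the extra factors
  have exponent 0, and then multiplied factor by factor.\<close>

lemma monomial_value_add:
  "monomial_value l g (m + n) = alg_mult l (monomial_value l g m) (monomial_value l g n)"
proof -
  interpret A: cring "alg l :: ('a \<times> 'a quad) ring" by (rule alg_cring)
  have carr: "x \<in> carrier (alg l)" for x :: "'a \<times> 'a quad" by (simp add: alg_def)
  have val: "monomial_value l g u = (\<Otimes>\<^bsub>alg l\<^esub>i\<in>Poly_Mapping.keys m \<union> Poly_Mapping.keys n. g i [^]\<^bsub>alg l\<^esub> Poly_Mapping.lookup u i)"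
    if "Poly_Mapping.keys u \<subseteq> Poly_Mapping.keys m \<union> Poly_Mapping.keys n" for u
    unfolding monomial_value_def
    using that by (intro A.finprod_mono_neutral_cong_left) (auto simp: carr in_keys_iff)
  have "monomial_value l g (m + n) = (\<Otimes>\<^bsub>alg l\<^esub>i\<in>Poly_Mapping.keys m \<union> Poly_Mapping.keys n.
      g i [^]\<^bsub>alg l\<^esub> Poly_Mapping.lookup m i \<otimes>\<^bsub>alg l\<^esub> g i [^]\<^bsub>alg l\<^esub> Poly_Mapping.lookup n i)"
    by (subst val) (auto simp: Poly_Mapping.keys_add lookup_add A.nat_pow_mult carr)
  also have "\<dots> = monomial_value l g m \<otimes>\<^bsub>alg l\<^esub> monomial_value l g n"
    by (subst A.finprod_multf) (auto simp: carr val)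
  finally show ?thesis by (simp add: alg_def)
qed

lemma alg_mult_zero [simp]: "alg_mult l 0 p = 0" "alg_mult l p 0 = 0" "alg_mult l (0, 0) p = 0"
  by (cases p; simp add: alg_mult_def zero_prod_def[where 'a = 'a and 'b = "'a quad"])+

lemma alg_mult_add_right: "alg_mult l p (q + r) = alg_mult l p q + alg_mult l p r"
  using alg_mult_add[of l q r p] by (simp only: alg_mult_commute[of l p])

lemma evaluate_add: "evaluate l g (p + q) = evaluate l g p + evaluate l g q"
  unfolding evaluate_def
proof (rule setsum_keys_plus_distrib)
  show "alg_mult l (0, 0) (monomial_value l g m) = 0" for m by simp
  show "alg_mult l (Poly_Mapping.lookup p m + Poly_Mapping.lookup q m, 0) (monomial_value l g m)
      = alg_mult l (Poly_Mapping.lookup p m, 0) (monomial_value l g m)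
      + alg_mult l (Poly_Mapping.lookup q m, 0) (monomial_value l g m)" for m
    by (simp add: alg_mult_add[symmetric])
qed

lemma evaluate_zero [simp]: "evaluate l g 0 = 0"
  by (simp add: evaluate_def)

lemma evaluate_single: "evaluate l g (Poly_Mapping.single m c) = alg_mult l (c, 0) (monomial_value l g m)"
  by (cases "c = 0") (simp_all add: evaluate_def)

lemma monomial_value_zero: "monomial_value l g 0 = (1, 0)"
proof -
  interpret A: cring "alg l :: ('a \<times> 'a quad) ring" by (rule alg_cring)
  show ?thesis by (simp add: monomial_value_def) (simp add: alg_def)
qed

lemma evaluate_scalar: "evaluate l g (scalar_poly c) = (c, 0)"
  using alg_mult_one[of l "(c, 0)"]
  by (simp add: scalar_poly_def evaluate_single monomial_value_zero alg_mult_commute[of l "(c, 0)"])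

lemma evaluate_tvar: "evaluate l g (tvar i) = g i"
proof -
  interpret A: cring "alg l :: ('a \<times> 'a quad) ring" by (rule alg_cring)
  have carr: "x \<in> carrier (alg l)" for x :: "'a \<times> 'a quad" by (simp add: alg_def)
  show ?thesis
    by (simp add: tvar_def evaluate_single alg_mult_one monomial_value_def A.finprod_insert carr)
qed

text \<open>Both sides are additive in each factor, which reduces the claim to single terms; there
  it is \<open>monomial_value_add\<close>.\<close>

lemma evaluate_mult: "evaluate l g (p * q) = alg_mult l (evaluate l g p) (evaluate l g q)"
proof (induction p rule: poly_mapping_add_induct)
  case (single m c)
  show ?case
  proof (induction q rule: poly_mapping_add_induct)
    case (single n d)
    have scalars: "alg_mult l (c, 0) (d, 0) = (c * d, 0)" by (simp add: alg_mult_def)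
    have "alg_mult l (alg_mult l (c, 0) u) (alg_mult l (d, 0) v) = alg_mult l (c * d, 0) (alg_mult l u v)" for u v
      by (simp only: scalars[symmetric] alg_mult_assoc alg_mult_commute alg_mult_left_commute)
    then show ?case
      by (simp add: mult_single evaluate_single monomial_value_add)
  qed (simp_all add: distrib_left evaluate_add alg_mult_add_right)
qed (simp_all add: distrib_right evaluate_add alg_mult_add)

lemma evaluate_one: "evaluate l g 1 = (1, 0)"
  using evaluate_scalar[of l g 1] by (simp add: scalar_poly_def)

lemma evaluate_uminus: "evaluate l g (- p) = - evaluate l g p"
  using evaluate_add[of l g p "- p"] by (simp add: eq_neg_iff_add_eq_0 add.commute)

lemma evaluate_diff: "evaluate l g (p - q) = evaluate l g p - evaluate l g q"
  using evaluate_add[of l g p "- q"] by (simp add: evaluate_uminus)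

lemma scalar_poly_simps:
  "scalar_poly (a + b) = scalar_poly a + scalar_poly b" "scalar_poly (a * b) = scalar_poly a * scalar_poly b"
  "scalar_poly 0 = 0" "scalar_poly 1 = 1"
  by (simp_all add: scalar_poly_def single_add mult_single)

lemma evaluate_hom: "ring_hom_ring (poly_ring k) (alg l) (evaluate l g)"
proof -
  have "evaluate l g \<in> Ring.ring_hom (poly_ring k) (alg l)"
    by (rule ring_hom_memI)
      (simp_all add: poly_ring_simps evaluate_mult evaluate_add evaluate_one alg_def)
  then show ?thesis
    using cring.axioms(1)[OF poly_ring_cring] cring.axioms(1)[OF alg_cring] by (intro ring_hom_ringI2)
qed

definition normal_form :: "'a::field mpoly \<Rightarrow> 'a mpoly \<Rightarrow> 'a mpoly \<Rightarrow> 'a mpoly \<Rightarrow> 'a \<times> 'a quad \<Rightarrow> 'a mpoly" where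
  "normal_form m1 m2 m3 m4 = (\<lambda>(a, x1, x2, x3, x4). scalar_poly a + scalar_poly x1 * m1 + scalar_poly x2 * m2
     + scalar_poly x3 * m3 + scalar_poly x4 * m4)"

lemma alg_zero: "\<zero>\<^bsub>alg l\<^esub> = 0"
  by (simp add: alg_def)

text \<open>A presentation: \<open>g\<close> assigns to each variable its value in the algebra, the monomials \<open>m\<^sub>j\<close> lift the
  basis vectors, and modulo \<open>I\<close> multiplication by a variable preserves the span of \<open>1, m\<^sub>1, \<dots>, m\<^sub>4\<close>.\<close>

lemma algebra_presentation:
  fixes g :: "nat \<Rightarrow> 'a::field quad"
  assumes I: "ideal I (poly_ring k)" and kernel: "\<And>p. p \<in> I \<Longrightarrow> evaluate l (\<lambda>i. (0, g i)) p = 0"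
    and m: "m1 \<in> polys k" "m2 \<in> polys k" "m3 \<in> polys k" "m4 \<in> polys k"
    and basis: "evaluate l (\<lambda>i. (0, g i)) m1 = (0, 1, 0, 0, 0)" "evaluate l (\<lambda>i. (0, g i)) m2 = (0, 0, 1, 0, 0)"
      "evaluate l (\<lambda>i. (0, g i)) m3 = (0, 0, 0, 1, 0)" "evaluate l (\<lambda>i. (0, g i)) m4 = (0, 0, 0, 0, 1)"
    and tvars: "\<And>i. i \<in> {1..k} \<Longrightarrow> tvar i = normal_form m1 m2 m3 m4 (0, g i)"
    and products: "\<And>i. i \<in> {1..k} \<Longrightarrow>
        tvar i * m1 - normal_form m1 m2 m3 m4 (0, table l (g i) (1, 0, 0, 0)) \<in> I
        \<and> tvar i * m2 - normal_form m1 m2 m3 m4 (0, table l (g i) (0, 1, 0, 0)) \<in> I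
        \<and> tvar i * m3 - normal_form m1 m2 m3 m4 (0, table l (g i) (0, 0, 1, 0)) \<in> I
        \<and> tvar i * m4 - normal_form m1 m2 m3 m4 (0, table l (g i) (0, 0, 0, 1)) \<in> I"
  shows "algebra_isomorphic (span_algebra 4 (rep l)) (scalar_mat 4) (poly_ring k Quot I) (scalar_coset k I)"
proof -
  let ?ev = "evaluate l (\<lambda>i. (0, g i))"
  let ?nf = "normal_form m1 m2 m3 m4"
  interpret R: cring "poly_ring k :: 'a mpoly ring" by (rule poly_ring_cring)
  interpret I: ideal I "poly_ring k" by (rule I)
  interpret E: ring_hom_ring "poly_ring k" "alg l" ?ev by (rule evaluate_hom)
  have I_add: "p + q \<in> I" if "p \<in> I" "q \<in> I" for p q
    using I.a_closed[OF that] by (simp add: poly_ring_simps)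
  have I_mult: "q * p \<in> I" if "p \<in> I" "q \<in> polys k" for p q
    using I.I_l_closed[OF that] by (simp add: poly_ring_simps)
  have I_zero: "0 \<in> I" using I.zero_closed by (simp add: poly_ring_simps)
  have nf_add: "?nf (p + q) = ?nf p + ?nf q" for p q
    by (cases p; cases q) (simp add: normal_form_def scalar_poly_simps algebra_simps)
  have nf_scale: "?nf (0, quad_scale c x) = scalar_poly c * ?nf (0, x)" for c x
    by (cases x) (simp add: normal_form_def quad_scale_def scalar_poly_simps algebra_simps)
  have nf_polys: "?nf p \<in> polys k" for p
    using m by (cases p) (simp add: normal_form_def polys_closed)
  \<comment> \<open>Evaluation inverts \<open>normal_form\<close>. This yields surjectivity and
    shows that distinct normal forms have distinct values.\<close>
  have ev_nf: "?ev (?nf p) = p" for p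
    by (cases p) (simp add: normal_form_def evaluate_add evaluate_mult evaluate_scalar basis alg_mult_def
        quad_scale_def table_zero[where 'a = 'a, unfolded zero_prod_def])
  \<comment> \<open>The hypotheses on the four basis monomials extend by linearity to every normal
    form; the constant term is covered by \<open>tvars\<close>.\<close>
  have nf_mult: "tvar i * ?nf p - ?nf (alg_mult l (0, g i) p) \<in> I" if i: "i \<in> {1..k}" for i p
  proof -
    obtain a x1 x2 x3 x4 where p: "p = (a, x1, x2, x3, x4)" by (cases p)
    have "alg_mult l (0, g i) p = (0, quad_scale a (g i)) + (0, quad_scale x1 (table l (g i) (1, 0, 0, 0)))
        + (0, quad_scale x2 (table l (g i) (0, 1, 0, 0))) + (0, quad_scale x3 (table l (g i) (0, 0, 1, 0)))
        + (0, quad_scale x4 (table l (g i) (0, 0, 0, 1)))"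
      unfolding p by (subst quad_decomp) (simp add: alg_mult_def table_bilinear)
    then have "tvar i * ?nf p - ?nf (alg_mult l (0, g i) p) =
          scalar_poly x1 * (tvar i * m1 - ?nf (0, table l (g i) (1, 0, 0, 0)))
        + scalar_poly x2 * (tvar i * m2 - ?nf (0, table l (g i) (0, 1, 0, 0)))
        + scalar_poly x3 * (tvar i * m3 - ?nf (0, table l (g i) (0, 0, 1, 0)))
        + scalar_poly x4 * (tvar i * m4 - ?nf (0, table l (g i) (0, 0, 0, 1)))
        + scalar_poly a * (tvar i - ?nf (0, g i))"
      by (simp only: nf_add nf_scale) (simp add: p normal_form_def[of m1 m2 m3 m4, THEN fun_cong, of "(a, x1, x2, x3, x4)"] algebra_simps)
    also have "\<dots> \<in> I"
      using products[OF i] by (intro I_add I_mult polys_scalar) (auto simp: tvars[OF i, symmetric] I_zero)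
    finally show ?thesis .
  qed
  \<comment> \<open>The polynomials congruent modulo I to a normal form. Constants belong to it, and
    it is closed under addition and under multiplication by variables, so it contains all of
    \<open>polys k\<close>.\<close>
  define D where "D = {p. \<exists>q. p - ?nf q \<in> I}"
  have D_add: "p + q \<in> D" if pq: "p \<in> D" "q \<in> D" for p q
  proof -
    obtain p' q' where "p - ?nf p' \<in> I" "q - ?nf q' \<in> I" using pq unfolding D_def by blast
    then have "p - ?nf p' + (q - ?nf q') \<in> I" by (rule I_add)
    then have "p + q - ?nf (p' + q') \<in> I" by (simp add: nf_add algebra_simps)
    then show ?thesis unfolding D_def by blast
  qed
  have D_tvar: "tvar i * p \<in> D" if p: "p \<in> D" and i: "i \<in> {1..k}" for i p
  proof -
    obtain p' where "p - ?nf p' \<in> I" using p unfolding D_def by blast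
    then have "tvar i * (p - ?nf p') + (tvar i * ?nf p' - ?nf (alg_mult l (0, g i) p')) \<in> I"
      using i by (intro I_add I_mult nf_mult polys_tvar)
    then have "tvar i * p - ?nf (alg_mult l (0, g i) p') \<in> I" by (simp add: algebra_simps)
    then show ?thesis unfolding D_def by blast
  qed
  have D_scalar: "scalar_poly c \<in> D" for c
  proof -
    have "scalar_poly c - ?nf (c, 0, 0, 0, 0) \<in> I"
      by (simp add: normal_form_def scalar_poly_simps I_zero)
    then show ?thesis unfolding D_def by blast
  qed
  \<comment> \<open>Monomials are built one variable at a time, and within each variable one
    exponent at a time, so that every step is multiplication by a single variable.\<close>
  have D_monomial: "Poly_Mapping.single n c \<in> D" if "Poly_Mapping.keys n \<subseteq> {1..k}" for n c
    using that
  proof (induction n rule: update_induct)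
    case const
    then show ?case using D_scalar by (simp add: scalar_poly_def)
  next
    case (update f i e)
    then have i: "i \<in> {1..k}" and f: "Poly_Mapping.single f c \<in> D" by (auto simp: keys_update)
    have "Poly_Mapping.single (f + Poly_Mapping.single i e) c \<in> D" for e
    proof (induction e)
      case 0
      then show ?case using f by simp
    next
      case (Suc e)
      have "Poly_Mapping.single (f + Poly_Mapping.single i (Suc e)) c
          = tvar i * Poly_Mapping.single (f + Poly_Mapping.single i e) c"
        using single_add[of i 1 e] by (simp add: tvar_def mult_single add_ac)
      then show ?case using D_tvar[OF Suc i] by simp
    qed
    moreover have "Poly_Mapping.update i e f = f + Poly_Mapping.single i e"
      using update(1) by (intro poly_mapping_eqI) (auto simp: lookup_update lookup_add lookup_single in_keys_iff when_def)
    ultimately show ?case by simp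
  qed
  have normal: "p \<in> D" if "p \<in> polys k" for p
    using that
  proof (induction p rule: update_induct)
    case const
    then show ?case using D_scalar[of 0] by (simp add: scalar_poly_simps)
  next
    case (update f n c)
    then have "f \<in> D" "Poly_Mapping.keys n \<subseteq> {1..k}" by (auto simp: polys_iff keys_update)
    moreover have "Poly_Mapping.update n c f = f + Poly_Mapping.single n c"
      using update(1) by (intro poly_mapping_eqI) (auto simp: lookup_update lookup_add lookup_single in_keys_iff when_def)
    ultimately show ?case using D_add D_monomial by simp
  qed
  \<comment> \<open>An element of the kernel is congruent modulo I to a normal form whose value is
    0. That normal form is then 0, and the element lies in I.\<close>
  have ker: "a_kernel (poly_ring k) (alg l) ?ev = I"
  proof (intro subset_antisym subsetI)
    fix p assume "p \<in> a_kernel (poly_ring k) (alg l) ?ev"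
    then have p: "p \<in> polys k" "?ev p = 0" unfolding a_kernel_def' alg_zero by blast+
    obtain q where q: "p - ?nf q \<in> I" using normal[OF p(1)] unfolding D_def by blast
    have "?ev (p - ?nf q) = 0" by (rule kernel[OF q])
    then have "q = 0" using p by (simp add: evaluate_diff ev_nf)
    then show "p \<in> I" using q by (simp add: normal_form_def scalar_poly_simps zero_prod_def)
  next
    fix p assume "p \<in> I"
    then show "p \<in> a_kernel (poly_ring k) (alg l) ?ev"
      using kernel[of p] I.Icarr[of p] unfolding a_kernel_def' alg_zero by blast
  qed
  have "?ev ` polys k = carrier (alg l)"
  proof -
    have "q \<in> ?ev ` polys k" for q using ev_nf[of q] nf_polys[of q] by (metis imageI)
    then show ?thesis by (auto simp: alg_def)
  qed
  then have "(\<lambda>X. the_elem (?ev ` X)) \<in> ring_iso (poly_ring k Quot I) (alg l)"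
    using E.FactRing_iso_set by (simp add: ker)
  from ring_iso_set_trans[OF this alg_mat_iso]
  have iso: "alg_mat l \<circ> (\<lambda>X. the_elem (?ev ` X)) \<in> ring_iso (poly_ring k Quot I) (span_algebra 4 (rep l))"
    (is "?h \<in> _") .
  have coset: "scalar_coset k I c \<in> carrier (poly_ring k Quot I)" for c
    unfolding scalar_coset_def FactRing_def A_RCOSETS_def' using polys_scalar by auto
  have "?h (scalar_coset k I c) = scalar_mat 4 c" for c
  proof -
    have "?ev ` scalar_coset k I c = {(c, 0)}"
    proof -
      have ev: "?ev (p + scalar_poly c) = (c, 0)" if "p \<in> I" for p
        using kernel[OF that] by (simp add: evaluate_add evaluate_scalar)
      have cos: "scalar_coset k I c = (\<lambda>p. p + scalar_poly c) ` I"
        by (auto simp: scalar_coset_def a_r_coset_def' poly_ring_simps)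
      have "?ev ` scalar_coset k I c = (\<lambda>p. (c, 0)) ` I"
        unfolding cos image_image by (rule image_cong[OF refl]) (rule ev)
      then show ?thesis by (simp only: image_constant[OF I_zero])
    qed
    then show ?thesis by (simp add: alg_mat_scalar)
  qed
  \<comment> \<open>The isomorphism found runs from the quotient to the matrices; its inverse is
    wanted, and compatibility with scalars has to be transported to it.\<close>
  then have "inv_into (carrier (poly_ring k Quot I)) ?h (scalar_mat 4 c) = scalar_coset k I c" for c
    using iso coset[of c] inv_into_f_f[of ?h "carrier (poly_ring k Quot I)" "scalar_coset k I c"]
    by (simp add: ring_iso_def bij_betw_def)
  moreover have "inv_into (carrier (poly_ring k Quot I)) ?h \<in> ring_iso (span_algebra 4 (rep l)) (poly_ring k Quot I)"
    using ring_iso_set_sym[OF I.quotient_is_ring iso] .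
  ultimately show ?thesis unfolding algebra_isomorphic_def by blast
qed

lemma Idl_closed:
  assumes "G \<subseteq> polys k"
  shows "p \<in> G \<Longrightarrow> p \<in> Idl\<^bsub>poly_ring k\<^esub> G"
    and "p \<in> Idl\<^bsub>poly_ring k\<^esub> G \<Longrightarrow> q \<in> Idl\<^bsub>poly_ring k\<^esub> G \<Longrightarrow> p + q \<in> Idl\<^bsub>poly_ring k\<^esub> G"
    and "p \<in> Idl\<^bsub>poly_ring k\<^esub> G \<Longrightarrow> q \<in> polys k \<Longrightarrow> q * p \<in> Idl\<^bsub>poly_ring k\<^esub> G"
    and "0 \<in> Idl\<^bsub>poly_ring k\<^esub> G"
    and "ideal (Idl\<^bsub>poly_ring k\<^esub> G) (poly_ring k)"
proof -
  interpret R: cring "poly_ring k :: 'a mpoly ring" by (rule poly_ring_cring)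
  show ideal: "ideal (Idl\<^bsub>poly_ring k\<^esub> G) (poly_ring k)" by (rule R.genideal_ideal[OF assms])
  interpret I: ideal "Idl\<^bsub>poly_ring k\<^esub> G" "poly_ring k" by (rule ideal)
  show "p \<in> G \<Longrightarrow> p \<in> Idl\<^bsub>poly_ring k\<^esub> G" using R.genideal_self[OF assms] by blast
  show "p \<in> Idl\<^bsub>poly_ring k\<^esub> G \<Longrightarrow> q \<in> Idl\<^bsub>poly_ring k\<^esub> G \<Longrightarrow> p + q \<in> Idl\<^bsub>poly_ring k\<^esub> G"
    using I.a_closed[of p q] unfolding poly_ring_simps .
  show "p \<in> Idl\<^bsub>poly_ring k\<^esub> G \<Longrightarrow> q \<in> polys k \<Longrightarrow> q * p \<in> Idl\<^bsub>poly_ring k\<^esub> G"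
    using I.I_l_closed[of p q] unfolding poly_ring_simps .
  show "0 \<in> Idl\<^bsub>poly_ring k\<^esub> G" using I.zero_closed unfolding poly_ring_simps .
qed

lemma evaluate_Idl:
  assumes "G \<subseteq> polys k" "\<And>p. p \<in> G \<Longrightarrow> evaluate l g p = 0" "p \<in> Idl\<^bsub>poly_ring k\<^esub> G"
  shows "evaluate l g p = 0"
proof -
  interpret R: cring "poly_ring k :: 'a mpoly ring" by (rule poly_ring_cring)
  interpret E: ring_hom_ring "poly_ring k" "alg l" "evaluate l g" by (rule evaluate_hom)
  have "G \<subseteq> a_kernel (poly_ring k) (alg l) (evaluate l g)"
    using assms(1,2) unfolding a_kernel_def' alg_zero by blast
  then have "Idl\<^bsub>poly_ring k\<^esub> G \<subseteq> a_kernel (poly_ring k) (alg l) (evaluate l g)"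
    by (rule R.genideal_minimal[OF E.kernel_is_ideal])
  then show ?thesis using assms(3) unfolding a_kernel_def' alg_zero by blast
qed

text \<open>The product conditions are required for an arbitrary set I with the closure properties
  of an ideal containing the generators. Concrete cases then use only these closure rules.\<close>

lemma generated_algebra_presentation:
  fixes g :: "nat \<Rightarrow> 'a::field quad"
  assumes G: "G \<subseteq> polys k" and kernel: "\<And>p. p \<in> G \<Longrightarrow> evaluate l (\<lambda>i. (0, g i)) p = 0"
    and m: "m1 \<in> polys k" "m2 \<in> polys k" "m3 \<in> polys k" "m4 \<in> polys k"
    and basis: "evaluate l (\<lambda>i. (0, g i)) m1 = (0, 1, 0, 0, 0)" "evaluate l (\<lambda>i. (0, g i)) m2 = (0, 0, 1, 0, 0)"
      "evaluate l (\<lambda>i. (0, g i)) m3 = (0, 0, 0, 1, 0)" "evaluate l (\<lambda>i. (0, g i)) m4 = (0, 0, 0, 0, 1)"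
    and tvars: "\<And>i. i \<in> {1..k} \<Longrightarrow> tvar i = normal_form m1 m2 m3 m4 (0, g i)"
    and products: "\<And>I i. 0 \<in> I \<Longrightarrow> (\<And>p. p \<in> G \<Longrightarrow> p \<in> I) \<Longrightarrow> (\<And>p q. p \<in> I \<Longrightarrow> q \<in> I \<Longrightarrow> p + q \<in> I) \<Longrightarrow>
        (\<And>p q. p \<in> I \<Longrightarrow> q \<in> polys k \<Longrightarrow> q * p \<in> I) \<Longrightarrow> i \<in> {1..k} \<Longrightarrow>
        tvar i * m1 - normal_form m1 m2 m3 m4 (0, table l (g i) (1, 0, 0, 0)) \<in> I
        \<and> tvar i * m2 - normal_form m1 m2 m3 m4 (0, table l (g i) (0, 1, 0, 0)) \<in> I
        \<and> tvar i * m3 - normal_form m1 m2 m3 m4 (0, table l (g i) (0, 0, 1, 0)) \<in> I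
        \<and> tvar i * m4 - normal_form m1 m2 m3 m4 (0, table l (g i) (0, 0, 0, 1)) \<in> I"
  shows "algebra_isomorphic (span_algebra 4 (rep l)) (scalar_mat 4)
    (poly_ring k Quot (Idl\<^bsub>poly_ring k\<^esub> G)) (scalar_coset k (Idl\<^bsub>poly_ring k\<^esub> G))"
  by (rule algebra_presentation[OF Idl_closed(5)[OF G] evaluate_Idl[OF G kernel] m basis tvars])
    (assumption+, rule products[OF Idl_closed(4)[OF G] Idl_closed(1)[OF G] Idl_closed(2)[OF G] Idl_closed(3)[OF G]])

lemma power_products:
  "(x :: 'b::monoid_mult) ^ 2 = x * x" "x ^ 3 = x * x * x" "x ^ 4 = x * x * x * x" "x ^ 5 = x * x * x * x * x"
  by (simp_all add: numeral_eq_Suc mult.assoc)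

lemmas evaluate_simps = evaluate_mult evaluate_tvar evaluate_diff alg_mult_def quad_scale_def power_products

section \<open>The ten presentations, each by its basis of monomials and the consequences of its
  relations\<close>

lemma algebra_S5:
  "algebra_isomorphic (span_algebra 4 (rep S5 :: 'a::field mat set)) (scalar_mat 4)
    (poly_ring (nvars S5) Quot rel_ideal S5) (scalar_coset (nvars S5) (rel_ideal S5))"
  unfolding nvars.simps rel_ideal.simps
proof (rule generated_algebra_presentation[where g = "\<lambda>_. (1, 0, 0, 0)"
      and ?m1.0 = "tvar 1" and ?m2.0 = "tvar 1 * tvar 1" and ?m3.0 = "tvar 1 * tvar 1 * tvar 1" and ?m4.0 = "tvar 1 * tvar 1 * tvar 1 * tvar 1"])
  fix I :: "'a mpoly set" and i :: nat
  assume I: "0 \<in> I" "\<And>p. p \<in> {tvar 1 ^ 5} \<Longrightarrow> p \<in> I"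
    "\<And>p q. p \<in> I \<Longrightarrow> q \<in> I \<Longrightarrow> p + q \<in> I" "\<And>p q. p \<in> I \<Longrightarrow> q \<in> polys 1 \<Longrightarrow> q * p \<in> I"
    and i: "i \<in> {1..1}"
  have gens: "tvar 1 * tvar 1 * tvar 1 * tvar 1 * tvar 1 \<in> I"
    using I(2)[of "tvar 1 ^ 5"] by (simp_all add: power_products)
  have "i \<in> {1}" using i by auto
  then show "tvar i * (tvar 1) - normal_form (tvar 1) (tvar 1 * tvar 1) (tvar 1 * tvar 1 * tvar 1) (tvar 1 * tvar 1 * tvar 1 * tvar 1) (0, table S5 ((\<lambda>_. (1, 0, 0, 0)) i) (1, 0, 0, 0)) \<in> I
      \<and> tvar i * (tvar 1 * tvar 1) - normal_form (tvar 1) (tvar 1 * tvar 1) (tvar 1 * tvar 1 * tvar 1) (tvar 1 * tvar 1 * tvar 1 * tvar 1) (0, table S5 ((\<lambda>_. (1, 0, 0, 0)) i) (0, 1, 0, 0)) \<in> I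
      \<and> tvar i * (tvar 1 * tvar 1 * tvar 1) - normal_form (tvar 1) (tvar 1 * tvar 1) (tvar 1 * tvar 1 * tvar 1) (tvar 1 * tvar 1 * tvar 1 * tvar 1) (0, table S5 ((\<lambda>_. (1, 0, 0, 0)) i) (0, 0, 1, 0)) \<in> I
      \<and> tvar i * (tvar 1 * tvar 1 * tvar 1 * tvar 1) - normal_form (tvar 1) (tvar 1 * tvar 1) (tvar 1 * tvar 1 * tvar 1) (tvar 1 * tvar 1 * tvar 1 * tvar 1) (0, table S5 ((\<lambda>_. (1, 0, 0, 0)) i) (0, 0, 0, 1)) \<in> I"
    using gens  I(1) by (auto simp: normal_form_def scalar_poly_simps mult_ac)
next
  fix i :: nat assume "i \<in> {1..1::nat}"
  then have "i \<in> {1}" by auto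
  then show "tvar i = normal_form (tvar 1) (tvar 1 * tvar 1) (tvar 1 * tvar 1 * tvar 1) (tvar 1 * tvar 1 * tvar 1 * tvar 1) (0, (\<lambda>_. (1, 0, 0, 0)) i)"
    by (auto simp: normal_form_def scalar_poly_simps)
qed (auto simp: evaluate_simps zero_prod_def[where 'a = 'a] intro!: polys_closed)

lemma algebra_S32_sharp:
  "algebra_isomorphic (span_algebra 4 (rep S32_sharp :: 'a::field mat set)) (scalar_mat 4)
    (poly_ring (nvars S32_sharp) Quot rel_ideal S32_sharp) (scalar_coset (nvars S32_sharp) (rel_ideal S32_sharp))"
  unfolding nvars.simps rel_ideal.simps
proof (rule generated_algebra_presentation[where g = "\<lambda>i. if i = 1 then (1, 0, 0, 0) else (0, 0, 1, 0)"
      and ?m1.0 = "tvar 1" and ?m2.0 = "tvar 1 * tvar 1" and ?m3.0 = "tvar 2" and ?m4.0 = "tvar 1 * tvar 1 * tvar 1"])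
  fix I :: "'a mpoly set" and i :: nat
  assume I: "0 \<in> I" "\<And>p. p \<in> {tvar 1 ^ 3 - tvar 2 ^ 2, tvar 1 * tvar 2} \<Longrightarrow> p \<in> I"
    "\<And>p q. p \<in> I \<Longrightarrow> q \<in> I \<Longrightarrow> p + q \<in> I" "\<And>p q. p \<in> I \<Longrightarrow> q \<in> polys 2 \<Longrightarrow> q * p \<in> I"
    and i: "i \<in> {1..2}"
  have gens: "tvar 1 * tvar 1 * tvar 1 - tvar 2 * tvar 2 \<in> I"
    "tvar 1 * tvar 2 \<in> I"
    using I(2)[of "tvar 1 ^ 3 - tvar 2 ^ 2"] I(2)[of "tvar 1 * tvar 2"] by (simp_all add: power_products)
  \<comment> \<open>The relation t1^4 = 0 is not among the generators; it arises as t1 (t1^3 - t2^2)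
    + t2 (t1 t2).\<close>
  have "tvar 1 * (tvar 1 * tvar 1 * tvar 1 - tvar 2 * tvar 2) + tvar 2 * (tvar 1 * tvar 2) \<in> I"
    by (rule I(3)[OF I(4)[OF gens(1)] I(4)[OF gens(2)]]) (auto intro!: polys_closed)
  then have rel1: "tvar 1 * tvar 1 * tvar 1 * tvar 1 \<in> I" by (simp add: algebra_simps)
  have "tvar 1 * (tvar 1 * tvar 2) \<in> I"
    by (rule I(4)[OF gens(2)]) (auto intro!: polys_closed)
  then have rel2: "tvar 2 * tvar 1 * tvar 1 \<in> I" by (simp add: algebra_simps)
  have "(tvar 1 * tvar 1) * (tvar 1 * tvar 2) \<in> I"
    by (rule I(4)[OF gens(2)]) (auto intro!: polys_closed)
  then have rel3: "tvar 2 * tvar 1 * tvar 1 * tvar 1 \<in> I" by (simp add: algebra_simps)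
  have "(- 1) * (tvar 1 * tvar 1 * tvar 1 - tvar 2 * tvar 2) \<in> I"
    by (rule I(4)[OF gens(1)]) (auto intro!: polys_closed)
  then have rel4: "tvar 2 * tvar 2 - tvar 1 * tvar 1 * tvar 1 \<in> I" by (simp add: algebra_simps)
  have "i \<in> {1, 2}" using i by auto
  then show "tvar i * (tvar 1) - normal_form (tvar 1) (tvar 1 * tvar 1) (tvar 2) (tvar 1 * tvar 1 * tvar 1) (0, table S32_sharp ((\<lambda>i. if i = 1 then (1, 0, 0, 0) else (0, 0, 1, 0)) i) (1, 0, 0, 0)) \<in> I
      \<and> tvar i * (tvar 1 * tvar 1) - normal_form (tvar 1) (tvar 1 * tvar 1) (tvar 2) (tvar 1 * tvar 1 * tvar 1) (0, table S32_sharp ((\<lambda>i. if i = 1 then (1, 0, 0, 0) else (0, 0, 1, 0)) i) (0, 1, 0, 0)) \<in> I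
      \<and> tvar i * (tvar 2) - normal_form (tvar 1) (tvar 1 * tvar 1) (tvar 2) (tvar 1 * tvar 1 * tvar 1) (0, table S32_sharp ((\<lambda>i. if i = 1 then (1, 0, 0, 0) else (0, 0, 1, 0)) i) (0, 0, 1, 0)) \<in> I
      \<and> tvar i * (tvar 1 * tvar 1 * tvar 1) - normal_form (tvar 1) (tvar 1 * tvar 1) (tvar 2) (tvar 1 * tvar 1 * tvar 1) (0, table S32_sharp ((\<lambda>i. if i = 1 then (1, 0, 0, 0) else (0, 0, 1, 0)) i) (0, 0, 0, 1)) \<in> I"
    using gens rel1 rel2 rel3 rel4 I(1) by (auto simp: normal_form_def scalar_poly_simps mult_ac)
next
  fix i :: nat assume "i \<in> {1..2::nat}"
  then have "i \<in> {1, 2}" by auto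
  then show "tvar i = normal_form (tvar 1) (tvar 1 * tvar 1) (tvar 2) (tvar 1 * tvar 1 * tvar 1) (0, (\<lambda>i. if i = 1 then (1, 0, 0, 0) else (0, 0, 1, 0)) i)"
    by (auto simp: normal_form_def scalar_poly_simps)
qed (auto simp: evaluate_simps zero_prod_def[where 'a = 'a] intro!: polys_closed)

lemma algebra_U1_4:
  "algebra_isomorphic (span_algebra 4 (rep U1_4 :: 'a::field mat set)) (scalar_mat 4)
    (poly_ring (nvars U1_4) Quot rel_ideal U1_4) (scalar_coset (nvars U1_4) (rel_ideal U1_4))"
  unfolding nvars.simps rel_ideal.simps
proof (rule generated_algebra_presentation[where g = "\<lambda>i. if i = 1 then (1, 0, 0, 0) else (0, 0, 1, 0)"
      and ?m1.0 = "tvar 1" and ?m2.0 = "tvar 1 * tvar 1" and ?m3.0 = "tvar 2" and ?m4.0 = "tvar 1 * tvar 2"])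
  fix I :: "'a mpoly set" and i :: nat
  assume I: "0 \<in> I" "\<And>p. p \<in> {tvar 1 ^ 3, tvar 1 ^ 2 * tvar 2, tvar 2 ^ 2} \<Longrightarrow> p \<in> I"
    "\<And>p q. p \<in> I \<Longrightarrow> q \<in> I \<Longrightarrow> p + q \<in> I" "\<And>p q. p \<in> I \<Longrightarrow> q \<in> polys 2 \<Longrightarrow> q * p \<in> I"
    and i: "i \<in> {1..2}"
  have gens: "tvar 1 * tvar 1 * tvar 1 \<in> I"
    "tvar 1 * tvar 1 * tvar 2 \<in> I"
    "tvar 2 * tvar 2 \<in> I"
    using I(2)[of "tvar 1 ^ 3"] I(2)[of "tvar 1 ^ 2 * tvar 2"] I(2)[of "tvar 2 ^ 2"] by (simp_all add: power_products)
  \<comment> \<open>The basis monomial t1 t2 multiplied by t2 must vanish, which follows from t2^2 =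
    0.\<close>
  have "tvar 1 * (tvar 2 * tvar 2) \<in> I"
    by (rule I(4)[OF gens(3)]) (auto intro!: polys_closed)
  then have rel1: "tvar 2 * tvar 1 * tvar 2 \<in> I" by (simp add: algebra_simps)
  have "i \<in> {1, 2}" using i by auto
  then show "tvar i * (tvar 1) - normal_form (tvar 1) (tvar 1 * tvar 1) (tvar 2) (tvar 1 * tvar 2) (0, table U1_4 ((\<lambda>i. if i = 1 then (1, 0, 0, 0) else (0, 0, 1, 0)) i) (1, 0, 0, 0)) \<in> I
      \<and> tvar i * (tvar 1 * tvar 1) - normal_form (tvar 1) (tvar 1 * tvar 1) (tvar 2) (tvar 1 * tvar 2) (0, table U1_4 ((\<lambda>i. if i = 1 then (1, 0, 0, 0) else (0, 0, 1, 0)) i) (0, 1, 0, 0)) \<in> I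
      \<and> tvar i * (tvar 2) - normal_form (tvar 1) (tvar 1 * tvar 1) (tvar 2) (tvar 1 * tvar 2) (0, table U1_4 ((\<lambda>i. if i = 1 then (1, 0, 0, 0) else (0, 0, 1, 0)) i) (0, 0, 1, 0)) \<in> I
      \<and> tvar i * (tvar 1 * tvar 2) - normal_form (tvar 1) (tvar 1 * tvar 1) (tvar 2) (tvar 1 * tvar 2) (0, table U1_4 ((\<lambda>i. if i = 1 then (1, 0, 0, 0) else (0, 0, 1, 0)) i) (0, 0, 0, 1)) \<in> I"
    using gens rel1 I(1) by (auto simp: normal_form_def scalar_poly_simps mult_ac)
next
  fix i :: nat assume "i \<in> {1..2::nat}"
  then have "i \<in> {1, 2}" by auto
  then show "tvar i = normal_form (tvar 1) (tvar 1 * tvar 1) (tvar 2) (tvar 1 * tvar 2) (0, (\<lambda>i. if i = 1 then (1, 0, 0, 0) else (0, 0, 1, 0)) i)"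
    by (auto simp: normal_form_def scalar_poly_simps)
qed (auto simp: evaluate_simps zero_prod_def[where 'a = 'a] intro!: polys_closed)

lemma algebra_U2_4:
  "algebra_isomorphic (span_algebra 4 (rep U2_4 :: 'a::field mat set)) (scalar_mat 4)
    (poly_ring (nvars U2_4) Quot rel_ideal U2_4) (scalar_coset (nvars U2_4) (rel_ideal U2_4))"
  unfolding nvars.simps rel_ideal.simps
proof (rule generated_algebra_presentation[where g = "\<lambda>i. if i = 1 then (1, 0, 0, 0) else if i = 2 then (0, 1, 0, 0) else (0, 0, 1, 0)"
      and ?m1.0 = "tvar 1" and ?m2.0 = "tvar 2" and ?m3.0 = "tvar 3" and ?m4.0 = "tvar 1 * tvar 1"])
  fix I :: "'a mpoly set" and i :: nat
  assume I: "0 \<in> I" "\<And>p. p \<in> {tvar 1 ^ 2 - tvar 2 * tvar 3, tvar 2 ^ 2, tvar 3 ^ 2, tvar 1 * tvar 2, tvar 1 * tvar 3} \<Longrightarrow> p \<in> I"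
    "\<And>p q. p \<in> I \<Longrightarrow> q \<in> I \<Longrightarrow> p + q \<in> I" "\<And>p q. p \<in> I \<Longrightarrow> q \<in> polys 3 \<Longrightarrow> q * p \<in> I"
    and i: "i \<in> {1..3}"
  have gens: "tvar 1 * tvar 1 - tvar 2 * tvar 3 \<in> I"
    "tvar 2 * tvar 2 \<in> I"
    "tvar 3 * tvar 3 \<in> I"
    "tvar 1 * tvar 2 \<in> I"
    "tvar 1 * tvar 3 \<in> I"
    using I(2)[of "tvar 1 ^ 2 - tvar 2 * tvar 3"] I(2)[of "tvar 2 ^ 2"] I(2)[of "tvar 3 ^ 2"] I(2)[of "tvar 1 * tvar 2"] I(2)[of "tvar 1 * tvar 3"] by (simp_all add: power_products)
  \<comment> \<open>The vanishing of t1^3 follows by cancelling t1 t2 t3 between t1 (t1^2 - t2 t3)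
    and t3 (t1 t2).\<close>
  have "tvar 1 * (tvar 1 * tvar 1 - tvar 2 * tvar 3) + tvar 3 * (tvar 1 * tvar 2) \<in> I"
    by (rule I(3)[OF I(4)[OF gens(1)] I(4)[OF gens(4)]]) (auto intro!: polys_closed)
  then have rel1: "tvar 1 * tvar 1 * tvar 1 \<in> I" by (simp add: algebra_simps)
  have "(- 1) * (tvar 1 * tvar 1 - tvar 2 * tvar 3) \<in> I"
    by (rule I(4)[OF gens(1)]) (auto intro!: polys_closed)
  then have rel2: "tvar 2 * tvar 3 - tvar 1 * tvar 1 \<in> I" by (simp add: algebra_simps)
  have "tvar 1 * (tvar 1 * tvar 2) \<in> I"
    by (rule I(4)[OF gens(4)]) (auto intro!: polys_closed)
  then have rel3: "tvar 2 * tvar 1 * tvar 1 \<in> I" by (simp add: algebra_simps)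
  have "tvar 1 * (tvar 1 * tvar 3) \<in> I"
    by (rule I(4)[OF gens(5)]) (auto intro!: polys_closed)
  then have rel4: "tvar 3 * tvar 1 * tvar 1 \<in> I" by (simp add: algebra_simps)
  have "i \<in> {1, 2, 3}" using i by auto
  then show "tvar i * (tvar 1) - normal_form (tvar 1) (tvar 2) (tvar 3) (tvar 1 * tvar 1) (0, table U2_4 ((\<lambda>i. if i = 1 then (1, 0, 0, 0) else if i = 2 then (0, 1, 0, 0) else (0, 0, 1, 0)) i) (1, 0, 0, 0)) \<in> I
      \<and> tvar i * (tvar 2) - normal_form (tvar 1) (tvar 2) (tvar 3) (tvar 1 * tvar 1) (0, table U2_4 ((\<lambda>i. if i = 1 then (1, 0, 0, 0) else if i = 2 then (0, 1, 0, 0) else (0, 0, 1, 0)) i) (0, 1, 0, 0)) \<in> I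
      \<and> tvar i * (tvar 3) - normal_form (tvar 1) (tvar 2) (tvar 3) (tvar 1 * tvar 1) (0, table U2_4 ((\<lambda>i. if i = 1 then (1, 0, 0, 0) else if i = 2 then (0, 1, 0, 0) else (0, 0, 1, 0)) i) (0, 0, 1, 0)) \<in> I
      \<and> tvar i * (tvar 1 * tvar 1) - normal_form (tvar 1) (tvar 2) (tvar 3) (tvar 1 * tvar 1) (0, table U2_4 ((\<lambda>i. if i = 1 then (1, 0, 0, 0) else if i = 2 then (0, 1, 0, 0) else (0, 0, 1, 0)) i) (0, 0, 0, 1)) \<in> I"
    using gens rel1 rel2 rel3 rel4 I(1) by (auto simp: normal_form_def scalar_poly_simps mult_ac)
next
  fix i :: nat assume "i \<in> {1..3::nat}"
  then have "i \<in> {1, 2, 3}" by auto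
  then show "tvar i = normal_form (tvar 1) (tvar 2) (tvar 3) (tvar 1 * tvar 1) (0, (\<lambda>i. if i = 1 then (1, 0, 0, 0) else if i = 2 then (0, 1, 0, 0) else (0, 0, 1, 0)) i)"
    by (auto simp: normal_form_def scalar_poly_simps)
qed (auto simp: evaluate_simps zero_prod_def[where 'a = 'a] intro!: polys_closed)

lemma algebra_S41:
  "algebra_isomorphic (span_algebra 4 (rep S41 :: 'a::field mat set)) (scalar_mat 4)
    (poly_ring (nvars S41) Quot rel_ideal S41) (scalar_coset (nvars S41) (rel_ideal S41))"
  unfolding nvars.simps rel_ideal.simps
proof (rule generated_algebra_presentation[where g = "\<lambda>i. if i = 1 then (1, 0, 0, 0) else (0, 0, 0, 1)"
      and ?m1.0 = "tvar 1" and ?m2.0 = "tvar 1 * tvar 1" and ?m3.0 = "tvar 1 * tvar 1 * tvar 1" and ?m4.0 = "tvar 2"])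
  fix I :: "'a mpoly set" and i :: nat
  assume I: "0 \<in> I" "\<And>p. p \<in> {tvar 1 ^ 4, tvar 2 ^ 2, tvar 1 * tvar 2} \<Longrightarrow> p \<in> I"
    "\<And>p q. p \<in> I \<Longrightarrow> q \<in> I \<Longrightarrow> p + q \<in> I" "\<And>p q. p \<in> I \<Longrightarrow> q \<in> polys 2 \<Longrightarrow> q * p \<in> I"
    and i: "i \<in> {1..2}"
  have gens: "tvar 1 * tvar 1 * tvar 1 * tvar 1 \<in> I"
    "tvar 2 * tvar 2 \<in> I"
    "tvar 1 * tvar 2 \<in> I"
    using I(2)[of "tvar 1 ^ 4"] I(2)[of "tvar 2 ^ 2"] I(2)[of "tvar 1 * tvar 2"] by (simp_all add: power_products)
  have "tvar 1 * (tvar 1 * tvar 2) \<in> I"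
    by (rule I(4)[OF gens(3)]) (auto intro!: polys_closed)
  then have rel1: "tvar 2 * tvar 1 * tvar 1 \<in> I" by (simp add: algebra_simps)
  have "(tvar 1 * tvar 1) * (tvar 1 * tvar 2) \<in> I"
    by (rule I(4)[OF gens(3)]) (auto intro!: polys_closed)
  then have rel2: "tvar 2 * tvar 1 * tvar 1 * tvar 1 \<in> I" by (simp add: algebra_simps)
  have "i \<in> {1, 2}" using i by auto
  then show "tvar i * (tvar 1) - normal_form (tvar 1) (tvar 1 * tvar 1) (tvar 1 * tvar 1 * tvar 1) (tvar 2) (0, table S41 ((\<lambda>i. if i = 1 then (1, 0, 0, 0) else (0, 0, 0, 1)) i) (1, 0, 0, 0)) \<in> I
      \<and> tvar i * (tvar 1 * tvar 1) - normal_form (tvar 1) (tvar 1 * tvar 1) (tvar 1 * tvar 1 * tvar 1) (tvar 2) (0, table S41 ((\<lambda>i. if i = 1 then (1, 0, 0, 0) else (0, 0, 0, 1)) i) (0, 1, 0, 0)) \<in> I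
      \<and> tvar i * (tvar 1 * tvar 1 * tvar 1) - normal_form (tvar 1) (tvar 1 * tvar 1) (tvar 1 * tvar 1 * tvar 1) (tvar 2) (0, table S41 ((\<lambda>i. if i = 1 then (1, 0, 0, 0) else (0, 0, 0, 1)) i) (0, 0, 1, 0)) \<in> I
      \<and> tvar i * (tvar 2) - normal_form (tvar 1) (tvar 1 * tvar 1) (tvar 1 * tvar 1 * tvar 1) (tvar 2) (0, table S41 ((\<lambda>i. if i = 1 then (1, 0, 0, 0) else (0, 0, 0, 1)) i) (0, 0, 0, 1)) \<in> I"
    using gens rel1 rel2 I(1) by (auto simp: normal_form_def scalar_poly_simps mult_ac)
next
  fix i :: nat assume "i \<in> {1..2::nat}"
  then have "i \<in> {1, 2}" by auto
  then show "tvar i = normal_form (tvar 1) (tvar 1 * tvar 1) (tvar 1 * tvar 1 * tvar 1) (tvar 2) (0, (\<lambda>i. if i = 1 then (1, 0, 0, 0) else (0, 0, 0, 1)) i)"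
    by (auto simp: normal_form_def scalar_poly_simps)
qed (auto simp: evaluate_simps zero_prod_def[where 'a = 'a] intro!: polys_closed)

lemma algebra_S32:
  "algebra_isomorphic (span_algebra 4 (rep S32 :: 'a::field mat set)) (scalar_mat 4)
    (poly_ring (nvars S32) Quot rel_ideal S32) (scalar_coset (nvars S32) (rel_ideal S32))"
  unfolding nvars.simps rel_ideal.simps
proof (rule generated_algebra_presentation[where g = "\<lambda>i. if i = 1 then (1, 0, 0, 0) else (0, 0, 1, 0)"
      and ?m1.0 = "tvar 1" and ?m2.0 = "tvar 1 * tvar 1" and ?m3.0 = "tvar 2" and ?m4.0 = "tvar 2 * tvar 2"])
  fix I :: "'a mpoly set" and i :: nat
  assume I: "0 \<in> I" "\<And>p. p \<in> {tvar 1 ^ 3, tvar 2 ^ 3, tvar 1 * tvar 2} \<Longrightarrow> p \<in> I"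
    "\<And>p q. p \<in> I \<Longrightarrow> q \<in> I \<Longrightarrow> p + q \<in> I" "\<And>p q. p \<in> I \<Longrightarrow> q \<in> polys 2 \<Longrightarrow> q * p \<in> I"
    and i: "i \<in> {1..2}"
  have gens: "tvar 1 * tvar 1 * tvar 1 \<in> I"
    "tvar 2 * tvar 2 * tvar 2 \<in> I"
    "tvar 1 * tvar 2 \<in> I"
    using I(2)[of "tvar 1 ^ 3"] I(2)[of "tvar 2 ^ 3"] I(2)[of "tvar 1 * tvar 2"] by (simp_all add: power_products)
  have "tvar 2 * (tvar 1 * tvar 2) \<in> I"
    by (rule I(4)[OF gens(3)]) (auto intro!: polys_closed)
  then have rel1: "tvar 1 * tvar 2 * tvar 2 \<in> I" by (simp add: algebra_simps)
  have "tvar 1 * (tvar 1 * tvar 2) \<in> I"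
    by (rule I(4)[OF gens(3)]) (auto intro!: polys_closed)
  then have rel2: "tvar 2 * tvar 1 * tvar 1 \<in> I" by (simp add: algebra_simps)
  have "i \<in> {1, 2}" using i by auto
  then show "tvar i * (tvar 1) - normal_form (tvar 1) (tvar 1 * tvar 1) (tvar 2) (tvar 2 * tvar 2) (0, table S32 ((\<lambda>i. if i = 1 then (1, 0, 0, 0) else (0, 0, 1, 0)) i) (1, 0, 0, 0)) \<in> I
      \<and> tvar i * (tvar 1 * tvar 1) - normal_form (tvar 1) (tvar 1 * tvar 1) (tvar 2) (tvar 2 * tvar 2) (0, table S32 ((\<lambda>i. if i = 1 then (1, 0, 0, 0) else (0, 0, 1, 0)) i) (0, 1, 0, 0)) \<in> I
      \<and> tvar i * (tvar 2) - normal_form (tvar 1) (tvar 1 * tvar 1) (tvar 2) (tvar 2 * tvar 2) (0, table S32 ((\<lambda>i. if i = 1 then (1, 0, 0, 0) else (0, 0, 1, 0)) i) (0, 0, 1, 0)) \<in> I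
      \<and> tvar i * (tvar 2 * tvar 2) - normal_form (tvar 1) (tvar 1 * tvar 1) (tvar 2) (tvar 2 * tvar 2) (0, table S32 ((\<lambda>i. if i = 1 then (1, 0, 0, 0) else (0, 0, 1, 0)) i) (0, 0, 0, 1)) \<in> I"
    using gens rel1 rel2 I(1) by (auto simp: normal_form_def scalar_poly_simps mult_ac)
next
  fix i :: nat assume "i \<in> {1..2::nat}"
  then have "i \<in> {1, 2}" by auto
  then show "tvar i = normal_form (tvar 1) (tvar 1 * tvar 1) (tvar 2) (tvar 2 * tvar 2) (0, (\<lambda>i. if i = 1 then (1, 0, 0, 0) else (0, 0, 1, 0)) i)"
    by (auto simp: normal_form_def scalar_poly_simps)
qed (auto simp: evaluate_simps zero_prod_def[where 'a = 'a] intro!: polys_closed)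

lemma algebra_S311:
  "algebra_isomorphic (span_algebra 4 (rep S311 :: 'a::field mat set)) (scalar_mat 4)
    (poly_ring (nvars S311) Quot rel_ideal S311) (scalar_coset (nvars S311) (rel_ideal S311))"
  unfolding nvars.simps rel_ideal.simps
proof (rule generated_algebra_presentation[where g = "\<lambda>i. if i = 1 then (1, 0, 0, 0) else if i = 2 then (0, 0, 1, 0) else (0, 0, 0, 1)"
      and ?m1.0 = "tvar 1" and ?m2.0 = "tvar 1 * tvar 1" and ?m3.0 = "tvar 2" and ?m4.0 = "tvar 3"])
  fix I :: "'a mpoly set" and i :: nat
  assume I: "0 \<in> I" "\<And>p. p \<in> {tvar 1 ^ 3, tvar 2 ^ 2, tvar 3 ^ 2, tvar 1 * tvar 2, tvar 1 * tvar 3, tvar 2 * tvar 3} \<Longrightarrow> p \<in> I"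
    "\<And>p q. p \<in> I \<Longrightarrow> q \<in> I \<Longrightarrow> p + q \<in> I" "\<And>p q. p \<in> I \<Longrightarrow> q \<in> polys 3 \<Longrightarrow> q * p \<in> I"
    and i: "i \<in> {1..3}"
  have gens: "tvar 1 * tvar 1 * tvar 1 \<in> I"
    "tvar 2 * tvar 2 \<in> I"
    "tvar 3 * tvar 3 \<in> I"
    "tvar 1 * tvar 2 \<in> I"
    "tvar 1 * tvar 3 \<in> I"
    "tvar 2 * tvar 3 \<in> I"
    using I(2)[of "tvar 1 ^ 3"] I(2)[of "tvar 2 ^ 2"] I(2)[of "tvar 3 ^ 2"] I(2)[of "tvar 1 * tvar 2"] I(2)[of "tvar 1 * tvar 3"] I(2)[of "tvar 2 * tvar 3"] by (simp_all add: power_products)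
  have "tvar 1 * (tvar 1 * tvar 2) \<in> I"
    by (rule I(4)[OF gens(4)]) (auto intro!: polys_closed)
  then have rel1: "tvar 2 * tvar 1 * tvar 1 \<in> I" by (simp add: algebra_simps)
  have "tvar 1 * (tvar 1 * tvar 3) \<in> I"
    by (rule I(4)[OF gens(5)]) (auto intro!: polys_closed)
  then have rel2: "tvar 3 * tvar 1 * tvar 1 \<in> I" by (simp add: algebra_simps)
  have "i \<in> {1, 2, 3}" using i by auto
  then show "tvar i * (tvar 1) - normal_form (tvar 1) (tvar 1 * tvar 1) (tvar 2) (tvar 3) (0, table S311 ((\<lambda>i. if i = 1 then (1, 0, 0, 0) else if i = 2 then (0, 0, 1, 0) else (0, 0, 0, 1)) i) (1, 0, 0, 0)) \<in> I
      \<and> tvar i * (tvar 1 * tvar 1) - normal_form (tvar 1) (tvar 1 * tvar 1) (tvar 2) (tvar 3) (0, table S311 ((\<lambda>i. if i = 1 then (1, 0, 0, 0) else if i = 2 then (0, 0, 1, 0) else (0, 0, 0, 1)) i) (0, 1, 0, 0)) \<in> I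
      \<and> tvar i * (tvar 2) - normal_form (tvar 1) (tvar 1 * tvar 1) (tvar 2) (tvar 3) (0, table S311 ((\<lambda>i. if i = 1 then (1, 0, 0, 0) else if i = 2 then (0, 0, 1, 0) else (0, 0, 0, 1)) i) (0, 0, 1, 0)) \<in> I
      \<and> tvar i * (tvar 3) - normal_form (tvar 1) (tvar 1 * tvar 1) (tvar 2) (tvar 3) (0, table S311 ((\<lambda>i. if i = 1 then (1, 0, 0, 0) else if i = 2 then (0, 0, 1, 0) else (0, 0, 0, 1)) i) (0, 0, 0, 1)) \<in> I"
    using gens rel1 rel2 I(1) by (auto simp: normal_form_def scalar_poly_simps mult_ac)
next
  fix i :: nat assume "i \<in> {1..3::nat}"
  then have "i \<in> {1, 2, 3}" by auto
  then show "tvar i = normal_form (tvar 1) (tvar 1 * tvar 1) (tvar 2) (tvar 3) (0, (\<lambda>i. if i = 1 then (1, 0, 0, 0) else if i = 2 then (0, 0, 1, 0) else (0, 0, 0, 1)) i)"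
    by (auto simp: normal_form_def scalar_poly_simps)
qed (auto simp: evaluate_simps zero_prod_def[where 'a = 'a] intro!: polys_closed)

lemma algebra_S221_sharp:
  "algebra_isomorphic (span_algebra 4 (rep S221_sharp :: 'a::field mat set)) (scalar_mat 4)
    (poly_ring (nvars S221_sharp) Quot rel_ideal S221_sharp) (scalar_coset (nvars S221_sharp) (rel_ideal S221_sharp))"
  unfolding nvars.simps rel_ideal.simps
proof (rule generated_algebra_presentation[where g = "\<lambda>i. if i = 1 then (1, 0, 0, 0) else if i = 2 then (0, 1, 0, 0) else (0, 0, 0, 1)"
      and ?m1.0 = "tvar 1" and ?m2.0 = "tvar 2" and ?m3.0 = "tvar 1 * tvar 1" and ?m4.0 = "tvar 3"])
  fix I :: "'a mpoly set" and i :: nat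
  assume I: "0 \<in> I" "\<And>p. p \<in> {tvar 1 ^ 2 - tvar 2 ^ 2, tvar 3 ^ 2, tvar 1 * tvar 2, tvar 1 * tvar 3, tvar 2 * tvar 3} \<Longrightarrow> p \<in> I"
    "\<And>p q. p \<in> I \<Longrightarrow> q \<in> I \<Longrightarrow> p + q \<in> I" "\<And>p q. p \<in> I \<Longrightarrow> q \<in> polys 3 \<Longrightarrow> q * p \<in> I"
    and i: "i \<in> {1..3}"
  have gens: "tvar 1 * tvar 1 - tvar 2 * tvar 2 \<in> I"
    "tvar 3 * tvar 3 \<in> I"
    "tvar 1 * tvar 2 \<in> I"
    "tvar 1 * tvar 3 \<in> I"
    "tvar 2 * tvar 3 \<in> I"
    using I(2)[of "tvar 1 ^ 2 - tvar 2 ^ 2"] I(2)[of "tvar 3 ^ 2"] I(2)[of "tvar 1 * tvar 2"] I(2)[of "tvar 1 * tvar 3"] I(2)[of "tvar 2 * tvar 3"] by (simp_all add: power_products)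
  \<comment> \<open>Again t1^3 is a consequence: the terms t1 t2^2 cancel.\<close>
  have "tvar 1 * (tvar 1 * tvar 1 - tvar 2 * tvar 2) + tvar 2 * (tvar 1 * tvar 2) \<in> I"
    by (rule I(3)[OF I(4)[OF gens(1)] I(4)[OF gens(3)]]) (auto intro!: polys_closed)
  then have rel1: "tvar 1 * tvar 1 * tvar 1 \<in> I" by (simp add: algebra_simps)
  have "(- 1) * (tvar 1 * tvar 1 - tvar 2 * tvar 2) \<in> I"
    by (rule I(4)[OF gens(1)]) (auto intro!: polys_closed)
  then have rel2: "tvar 2 * tvar 2 - tvar 1 * tvar 1 \<in> I" by (simp add: algebra_simps)
  have "tvar 1 * (tvar 1 * tvar 2) \<in> I"
    by (rule I(4)[OF gens(3)]) (auto intro!: polys_closed)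
  then have rel3: "tvar 2 * tvar 1 * tvar 1 \<in> I" by (simp add: algebra_simps)
  have "tvar 1 * (tvar 1 * tvar 3) \<in> I"
    by (rule I(4)[OF gens(4)]) (auto intro!: polys_closed)
  then have rel4: "tvar 3 * tvar 1 * tvar 1 \<in> I" by (simp add: algebra_simps)
  have "i \<in> {1, 2, 3}" using i by auto
  then show "tvar i * (tvar 1) - normal_form (tvar 1) (tvar 2) (tvar 1 * tvar 1) (tvar 3) (0, table S221_sharp ((\<lambda>i. if i = 1 then (1, 0, 0, 0) else if i = 2 then (0, 1, 0, 0) else (0, 0, 0, 1)) i) (1, 0, 0, 0)) \<in> I
      \<and> tvar i * (tvar 2) - normal_form (tvar 1) (tvar 2) (tvar 1 * tvar 1) (tvar 3) (0, table S221_sharp ((\<lambda>i. if i = 1 then (1, 0, 0, 0) else if i = 2 then (0, 1, 0, 0) else (0, 0, 0, 1)) i) (0, 1, 0, 0)) \<in> I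
      \<and> tvar i * (tvar 1 * tvar 1) - normal_form (tvar 1) (tvar 2) (tvar 1 * tvar 1) (tvar 3) (0, table S221_sharp ((\<lambda>i. if i = 1 then (1, 0, 0, 0) else if i = 2 then (0, 1, 0, 0) else (0, 0, 0, 1)) i) (0, 0, 1, 0)) \<in> I
      \<and> tvar i * (tvar 3) - normal_form (tvar 1) (tvar 2) (tvar 1 * tvar 1) (tvar 3) (0, table S221_sharp ((\<lambda>i. if i = 1 then (1, 0, 0, 0) else if i = 2 then (0, 1, 0, 0) else (0, 0, 0, 1)) i) (0, 0, 0, 1)) \<in> I"
    using gens rel1 rel2 rel3 rel4 I(1) by (auto simp: normal_form_def scalar_poly_simps mult_ac)
next
  fix i :: nat assume "i \<in> {1..3::nat}"
  then have "i \<in> {1, 2, 3}" by auto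
  then show "tvar i = normal_form (tvar 1) (tvar 2) (tvar 1 * tvar 1) (tvar 3) (0, (\<lambda>i. if i = 1 then (1, 0, 0, 0) else if i = 2 then (0, 1, 0, 0) else (0, 0, 0, 1)) i)"
    by (auto simp: normal_form_def scalar_poly_simps)
qed (auto simp: evaluate_simps zero_prod_def[where 'a = 'a] intro!: polys_closed)

lemma algebra_Char_two:
  "algebra_isomorphic (span_algebra 4 (rep Char_two :: 'a::field mat set)) (scalar_mat 4)
    (poly_ring (nvars Char_two) Quot rel_ideal Char_two) (scalar_coset (nvars Char_two) (rel_ideal Char_two))"
  unfolding nvars.simps rel_ideal.simps
proof (rule generated_algebra_presentation[where g = "\<lambda>i. if i = 1 then (1, 0, 0, 0) else if i = 2 then (0, 1, 0, 0) else (0, 0, 0, 1)"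
      and ?m1.0 = "tvar 1" and ?m2.0 = "tvar 2" and ?m3.0 = "tvar 1 * tvar 2" and ?m4.0 = "tvar 3"])
  fix I :: "'a mpoly set" and i :: nat
  assume I: "0 \<in> I" "\<And>p. p \<in> {tvar 1 ^ 2, tvar 2 ^ 2, tvar 3 ^ 2, tvar 1 * tvar 3, tvar 2 * tvar 3} \<Longrightarrow> p \<in> I"
    "\<And>p q. p \<in> I \<Longrightarrow> q \<in> I \<Longrightarrow> p + q \<in> I" "\<And>p q. p \<in> I \<Longrightarrow> q \<in> polys 3 \<Longrightarrow> q * p \<in> I"
    and i: "i \<in> {1..3}"
  have gens: "tvar 1 * tvar 1 \<in> I"
    "tvar 2 * tvar 2 \<in> I"
    "tvar 3 * tvar 3 \<in> I"
    "tvar 1 * tvar 3 \<in> I"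
    "tvar 2 * tvar 3 \<in> I"
    using I(2)[of "tvar 1 ^ 2"] I(2)[of "tvar 2 ^ 2"] I(2)[of "tvar 3 ^ 2"] I(2)[of "tvar 1 * tvar 3"] I(2)[of "tvar 2 * tvar 3"] by (simp_all add: power_products)
  have "tvar 2 * (tvar 1 * tvar 1) \<in> I"
    by (rule I(4)[OF gens(1)]) (auto intro!: polys_closed)
  then have rel1: "tvar 1 * tvar 1 * tvar 2 \<in> I" by (simp add: algebra_simps)
  have "tvar 1 * (tvar 2 * tvar 2) \<in> I"
    by (rule I(4)[OF gens(2)]) (auto intro!: polys_closed)
  then have rel2: "tvar 2 * tvar 1 * tvar 2 \<in> I" by (simp add: algebra_simps)
  have "tvar 2 * (tvar 1 * tvar 3) \<in> I"
    by (rule I(4)[OF gens(4)]) (auto intro!: polys_closed)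
  then have rel3: "tvar 3 * tvar 1 * tvar 2 \<in> I" by (simp add: algebra_simps)
  have "i \<in> {1, 2, 3}" using i by auto
  then show "tvar i * (tvar 1) - normal_form (tvar 1) (tvar 2) (tvar 1 * tvar 2) (tvar 3) (0, table Char_two ((\<lambda>i. if i = 1 then (1, 0, 0, 0) else if i = 2 then (0, 1, 0, 0) else (0, 0, 0, 1)) i) (1, 0, 0, 0)) \<in> I
      \<and> tvar i * (tvar 2) - normal_form (tvar 1) (tvar 2) (tvar 1 * tvar 2) (tvar 3) (0, table Char_two ((\<lambda>i. if i = 1 then (1, 0, 0, 0) else if i = 2 then (0, 1, 0, 0) else (0, 0, 0, 1)) i) (0, 1, 0, 0)) \<in> I
      \<and> tvar i * (tvar 1 * tvar 2) - normal_form (tvar 1) (tvar 2) (tvar 1 * tvar 2) (tvar 3) (0, table Char_two ((\<lambda>i. if i = 1 then (1, 0, 0, 0) else if i = 2 then (0, 1, 0, 0) else (0, 0, 0, 1)) i) (0, 0, 1, 0)) \<in> I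
      \<and> tvar i * (tvar 3) - normal_form (tvar 1) (tvar 2) (tvar 1 * tvar 2) (tvar 3) (0, table Char_two ((\<lambda>i. if i = 1 then (1, 0, 0, 0) else if i = 2 then (0, 1, 0, 0) else (0, 0, 0, 1)) i) (0, 0, 0, 1)) \<in> I"
    using gens rel1 rel2 rel3 I(1) by (auto simp: normal_form_def scalar_poly_simps mult_ac)
next
  fix i :: nat assume "i \<in> {1..3::nat}"
  then have "i \<in> {1, 2, 3}" by auto
  then show "tvar i = normal_form (tvar 1) (tvar 2) (tvar 1 * tvar 2) (tvar 3) (0, (\<lambda>i. if i = 1 then (1, 0, 0, 0) else if i = 2 then (0, 1, 0, 0) else (0, 0, 0, 1)) i)"
    by (auto simp: normal_form_def scalar_poly_simps)
qed (auto simp: evaluate_simps zero_prod_def[where 'a = 'a] intro!: polys_closed)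

text \<open>The ideal is a product of ideals rather than one given by generators, so
  \<open>algebra_presentation\<close> is applied directly. Products of two elements without constant
  term vanish because the table is zero.\<close>

lemma algebra_S2111:
  "algebra_isomorphic (span_algebra 4 (rep S2111 :: 'a::field mat set)) (scalar_mat 4)
    (poly_ring (nvars S2111) Quot rel_ideal S2111) (scalar_coset (nvars S2111) (rel_ideal S2111))"
  unfolding nvars.simps rel_ideal.simps
proof -
  let ?G = "{tvar 1, tvar 2, tvar 3, tvar 4} :: 'a mpoly set"
  let ?J = "Idl\<^bsub>poly_ring 4\<^esub> ?G"
  define g :: "nat \<Rightarrow> 'a quad" where
    "g i = (if i = 1 then (1, 0, 0, 0) else if i = 2 then (0, 1, 0, 0) else if i = 3 then (0, 0, 1, 0) else (0, 0, 0, 1))" for i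
  interpret R: cring "poly_ring 4 :: 'a mpoly ring" by (rule poly_ring_cring)
  have G: "?G \<subseteq> polys 4" by (auto intro!: polys_tvar)
  note J = Idl_closed[OF G]
  \<comment> \<open>Polynomials whose value has scalar part 0 form an ideal containing the
    variables, hence containing J.\<close>
  have "?J \<subseteq> {p \<in> polys 4. fst (evaluate S2111 (\<lambda>i. (0, g i)) p) = 0}"
  proof (rule R.genideal_minimal)
    show "ideal {p \<in> polys 4. fst (evaluate S2111 (\<lambda>i. (0, g i)) p) = 0} (poly_ring 4)"
    proof (rule idealI)
      show "subgroup {p \<in> polys 4. fst (evaluate S2111 (\<lambda>i. (0, g i)) p) = 0} (add_monoid (poly_ring 4))"
      proof (rule R.add.subgroupI)
        show "{p \<in> polys 4. fst (evaluate S2111 (\<lambda>i. (0, g i)) p) = 0} \<noteq> {}"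
          using polys_zero evaluate_zero by fastforce
        fix p :: "'a mpoly" assume p: "p \<in> {p \<in> polys 4. fst (evaluate S2111 (\<lambda>i. (0, g i)) p) = 0}"
        have "\<ominus>\<^bsub>poly_ring 4\<^esub> p = - p"
          using p by (intro R.minus_equality) (auto simp: poly_ring_simps polys_uminus)
        then show "\<ominus>\<^bsub>poly_ring 4\<^esub> p \<in> {p \<in> polys 4. fst (evaluate S2111 (\<lambda>i. (0, g i)) p) = 0}"
          using p by (simp add: polys_uminus evaluate_uminus)
      qed (auto simp: poly_ring_simps polys_add evaluate_add)
    qed (auto simp: R.ring_axioms poly_ring_simps polys_mult evaluate_mult alg_mult_def split: prod.splits)
    show "?G \<subseteq> {p \<in> polys 4. fst (evaluate S2111 (\<lambda>i. (0, g i)) p) = 0}"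
      using G by (auto simp: evaluate_tvar)
  qed
  then have fst: "fst (evaluate S2111 (\<lambda>i. (0, g i)) p) = 0" if "p \<in> ?J" for p using that by blast
  show "algebra_isomorphic (span_algebra 4 (rep S2111)) (scalar_mat 4)
    (poly_ring 4 Quot ideal_prod (poly_ring 4) ?J ?J) (scalar_coset 4 (ideal_prod (poly_ring 4) ?J ?J))"
  proof (rule algebra_presentation[where g = g and ?m1.0 = "tvar 1" and ?m2.0 = "tvar 2" and ?m3.0 = "tvar 3" and ?m4.0 = "tvar 4"])
    show "ideal (ideal_prod (poly_ring 4) ?J ?J) (poly_ring 4)"
      by (rule R.ideal_prod_is_ideal[OF J(5) J(5)])
    show "evaluate S2111 (\<lambda>i. (0, g i)) p = 0" if "p \<in> ideal_prod (poly_ring 4) ?J ?J" for p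
      using that
    proof (induction p rule: ideal_prod.induct)
      case (prod p q)
      obtain x where x: "evaluate S2111 (\<lambda>i. (0, g i)) p = (0, x)" using fst[OF prod(1)] by (metis prod.collapse)
      obtain y where y: "evaluate S2111 (\<lambda>i. (0, g i)) q = (0, y)" using fst[OF prod(2)] by (metis prod.collapse)
      have "table S2111 x y = 0" by (cases x; cases y) (simp add: zero_prod_def)
      then show ?case
        unfolding poly_ring_simps evaluate_mult x y by (simp add: alg_mult_def zero_prod_def[where 'a = 'a and 'b = "'a quad"])
    next
      case (sum p q)
      then show ?case unfolding poly_ring_simps evaluate_add by simp
    qed
    fix i :: nat assume "i \<in> {1..4}"
    then have i: "i \<in> {1, 2, 3, 4}" by auto
    then show "tvar i = normal_form (tvar 1) (tvar 2) (tvar 3) (tvar 4) (0, g i :: 'a quad)"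
      by (auto simp: normal_form_def scalar_poly_simps g_def)
    have prod: "tvar i * tvar j \<in> ideal_prod (poly_ring 4) ?J ?J" if "j \<in> {1, 2, 3, 4}" for j
    proof -
      have "tvar i \<in> ?J" "tvar j \<in> ?J" using i that J(1) by auto
      then have "tvar i \<otimes>\<^bsub>poly_ring 4\<^esub> tvar j \<in> ideal_prod (poly_ring 4) ?J ?J" by (rule ideal_prod.prod)
      then show ?thesis unfolding poly_ring_simps .
    qed
    have zero: "normal_form (tvar 1) (tvar 2) (tvar 3) (tvar 4) (0, table S2111 (g i) x) = (0 :: 'a mpoly)" for x :: "'a quad"
      by (cases "g i"; cases x) (simp add: normal_form_def scalar_poly_simps)
    show "tvar i * tvar 1 - normal_form (tvar 1) (tvar 2) (tvar 3) (tvar 4) (0, table S2111 (g i) (1, 0, 0, 0))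
          \<in> ideal_prod (poly_ring 4) ?J ?J
        \<and> tvar i * tvar 2 - normal_form (tvar 1) (tvar 2) (tvar 3) (tvar 4) (0, table S2111 (g i) (0, 1, 0, 0))
          \<in> ideal_prod (poly_ring 4) ?J ?J
        \<and> tvar i * tvar 3 - normal_form (tvar 1) (tvar 2) (tvar 3) (tvar 4) (0, table S2111 (g i) (0, 0, 1, 0))
          \<in> ideal_prod (poly_ring 4) ?J ?J
        \<and> tvar i * tvar 4 - normal_form (tvar 1) (tvar 2) (tvar 3) (tvar 4) (0, table S2111 (g i) (0, 0, 0, 1))
          \<in> ideal_prod (poly_ring 4) ?J ?J"
      unfolding zero diff_zero using prod by blast
  qed (auto simp: evaluate_tvar g_def intro!: polys_tvar)
qed

lemma algebra_rep:
  "algebra_isomorphic (span_algebra 4 (rep l :: 'a::field mat set)) (scalar_mat 4)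
    (poly_ring (nvars l) Quot rel_ideal l) (scalar_coset (nvars l) (rel_ideal l))"
  by (cases l) (simp_all only: algebra_S5 algebra_S32_sharp algebra_U1_4 algebra_U2_4 algebra_S41 algebra_S32
      algebra_S311 algebra_S221_sharp algebra_Char_two algebra_S2111)

section \<open>The classification\<close>

text \<open>The conjugating element is g' g^-1. It turns two representatives of one group into
  conjugate representatives, to which uniqueness applies.\<close>

lemma conjugate_in_common:
  fixes G (structure)
  assumes "group G" and H: "H \<subseteq> carrier G" and "conjugate_in G H K" "conjugate_in G H K'"
  shows "conjugate_in G K K'"
proof -
  interpret group G by fact
  have image: "g <# H #> inv g = (\<lambda>h. g \<otimes> h \<otimes> inv g) ` H" for g H
    by (auto simp: l_coset_def r_coset_def)
  obtain g where g: "g \<in> carrier G" "K = (\<lambda>h. g \<otimes> h \<otimes> inv g) ` H"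
    using assms(3) by (auto simp: conjugate_in_def image)
  obtain g' where g': "g' \<in> carrier G" "K' = (\<lambda>h. g' \<otimes> h \<otimes> inv g') ` H"
    using assms(4) by (auto simp: conjugate_in_def image)
  let ?k = "g' \<otimes> inv g"
  have "?k \<otimes> (g \<otimes> h \<otimes> inv g) \<otimes> inv ?k = g' \<otimes> h \<otimes> inv g'" if "h \<in> H" for h
  proof -
    have "inv g \<otimes> (g \<otimes> x) = x" if "x \<in> carrier G" for x
      using g that by (simp add: m_assoc[symmetric])
    then show ?thesis
      using g g' H that by (simp add: subset_iff m_assoc inv_mult_group)
  qed
  then have "K' = ?k <# K #> inv ?k"
    unfolding image g(2) g'(2) image_image by (intro image_cong) auto
  then show ?thesis using g g' unfolding conjugate_in_def by (intro bexI[of _ ?k]) simp_all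
qed

theorem mainTheorem4:
  assumes "no_quadratic_extensions TYPE('a::field)"
  shows "(\<forall>l\<in>labels TYPE('a). abelian_regular_subgroup 4 (rep l :: 'a mat set)) \<and>
    (\<forall>R :: 'a mat set. abelian_regular_subgroup 4 R \<longrightarrow>
        (\<exists>!l. l \<in> labels TYPE('a) \<and> conjugate_in (AGL TYPE('a) 4) R (rep l))) \<and>
    (\<forall>l\<in>indecomposable_labels. indecomposable 4 (rep l :: 'a mat set)) \<and>
    (\<forall>l\<in>decomposable_labels TYPE('a). decomposable 4 (rep l :: 'a mat set)) \<and>
    (\<forall>l\<in>labels TYPE('a). algebra_isomorphic
        (span_algebra 4 (rep l :: 'a mat set)) (scalar_mat 4)
        (poly_ring (nvars l) Quot rel_ideal l) (scalar_coset (nvars l) (rel_ideal l)))"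
proof (intro conjI ballI allI impI)
  fix R :: "'a mat set" assume R: "abelian_regular_subgroup 4 R"
  then have sub: "R \<subseteq> carrier (AGL TYPE('a) 4)"
    using subgroup.subset by (auto simp: abelian_regular_subgroup_def regular_subgroup_def)
  show "\<exists>!l. l \<in> labels TYPE('a) \<and> conjugate_in (AGL TYPE('a) 4) R (rep l)"
  proof (rule ex_ex1I)
    show "\<exists>l. l \<in> labels TYPE('a) \<and> conjugate_in (AGL TYPE('a) 4) R (rep l)"
      using conjugate_to_rep[OF R quadratic_root[OF assms]] by blast
  next
    fix l l'
    assume "l \<in> labels TYPE('a) \<and> conjugate_in (AGL TYPE('a) 4) R (rep l)"
      and "l' \<in> labels TYPE('a) \<and> conjugate_in (AGL TYPE('a) 4) R (rep l')"
    then show "l = l'"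
      using conjugate_rep_unique conjugate_in_common[OF AGL_group sub] by blast
  qed
next
  fix l assume "l \<in> indecomposable_labels"
  then show "indecomposable 4 (rep l :: 'a mat set)" by (rule indecomposable_rep)
qed (rule abelian_regular_rep decomposable_rep algebra_rep, assumption?)+

end
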